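(* Let $H$ be a Hopf algebra over an algebraically closed field $\mathbb{K}$ of characteristic zero which possesses a nonzero left integral, and let $\check H$ be the vector space $H$ equipped with the convolution product $*$. Then the category of completely reducible right $H$-comodules is equivalent to the category of completely reducible $\check H$-modules.
   Context: $S$ is the antipode of $H$; Sweedler's notation $\Delta(g)=g_1\otimes g_2$ is used. A left integral is a nonzero linear functional $\int:H\to\mathbb{K}$ with $x_1\int(x_2)=\int(x)1_H$ for all $x\in H$; one such is fixed. The convolution product on $H$ is $g*f:=\int(fS(g_1))\,g_2$; it is associative but in general has no unit. Modules over $\check H$ are left modules over this (non-unital) algebra. A module or comodule is completely reducible if it is a direct sum of simple ones. Simple $\check H$-modules are understood to be cyclic, i.e. nonzero, without proper nonzero submodules, and of the form $V=\{f*\bar v: f\in\check H\}$ for some $\bar v\in V$ (so the one-dimensional module with zero action is not counted as simple). Morphisms are all module (resp. comodule) homomorphisms. *)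

theory Defs
  imports "HOL-Algebra.Module" "HOL-Algebra.Algebraic_Closure"
begin

section \<open>Linear maps and tensor products of vector spaces\<close>

text \<open>A vector space over a field \<open>K\<close> is a module in the sense of HOL-Algebra, i.e. \<open>module K V\<close>;
  the ring fields \<open>monoid.mult\<close> and \<open>one\<close> of its record carry no information.\<close>

definition linear_map ::
  "('k, 'r) ring_scheme \<Rightarrow> ('k, 'v, 'm) module_scheme \<Rightarrow> ('k, 'w, 'n) module_scheme \<Rightarrow> ('v \<Rightarrow> 'w) \<Rightarrow> bool"
  where "linear_map K V W f \<longleftrightarrow>
    f \<in> carrier V \<rightarrow> carrier W \<and>
    (\<forall>x \<in> carrier V. \<forall>y \<in> carrier V. f (x \<oplus>\<^bsub>V\<^esub> y) = f x \<oplus>\<^bsub>W\<^esub> f y) \<and>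
    (\<forall>a \<in> carrier K. \<forall>x \<in> carrier V. f (a \<odot>\<^bsub>V\<^esub> x) = a \<odot>\<^bsub>W\<^esub> f x)"

definition scalars :: "('k, 'r) ring_scheme \<Rightarrow> ('k, 'k) module"
  where "scalars K = \<lparr>carrier = carrier K, monoid.mult = (\<otimes>\<^bsub>K\<^esub>), one = \<one>\<^bsub>K\<^esub>,
    ring.zero = \<zero>\<^bsub>K\<^esub>, ring.add = (\<oplus>\<^bsub>K\<^esub>), smult = (\<otimes>\<^bsub>K\<^esub>)\<rparr>"

definition free_space :: "('k, 'r) ring_scheme \<Rightarrow> 's set \<Rightarrow> ('k, 's \<Rightarrow> 'k) module"
  where "free_space K S =
    \<lparr>carrier = {p. range p \<subseteq> carrier K \<and> (\<forall>s. s \<notin> S \<longrightarrow> p s = \<zero>\<^bsub>K\<^esub>) \<and> finite {s. p s \<noteq> \<zero>\<^bsub>K\<^esub>}},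
     monoid.mult = undefined, one = undefined,
     ring.zero = (\<lambda>s. \<zero>\<^bsub>K\<^esub>), ring.add = (\<lambda>p q s. p s \<oplus>\<^bsub>K\<^esub> q s), smult = (\<lambda>a p s. a \<otimes>\<^bsub>K\<^esub> p s)\<rparr>"

definition free_gen :: "('k, 'r) ring_scheme \<Rightarrow> 's \<Rightarrow> ('s \<Rightarrow> 'k)"
  where "free_gen K s = (\<lambda>t. if t = s then \<one>\<^bsub>K\<^esub> else \<zero>\<^bsub>K\<^esub>)"

definition span_of ::
  "('k, 'r) ring_scheme \<Rightarrow> ('k, 'v, 'm) module_scheme \<Rightarrow> 'v set \<Rightarrow> 'v set"
  where "span_of K V S = \<Inter>{N. submodule N K V \<and> S \<subseteq> N}"

definition quotient_space ::
  "('k, 'v, 'm) module_scheme \<Rightarrow> 'v set \<Rightarrow> ('k, 'v set) module"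
  where "quotient_space V N =
    \<lparr>carrier = a_rcosets\<^bsub>V\<^esub> N, monoid.mult = undefined, one = undefined,
     ring.zero = N, ring.add = (\<lambda>A B. A <+>\<^bsub>V\<^esub> B), smult = (\<lambda>a A. N <+>\<^bsub>V\<^esub> ((\<lambda>x. a \<odot>\<^bsub>V\<^esub> x) ` A))\<rparr>"

definition tensor_rels ::
  "('k, 'r) ring_scheme \<Rightarrow> ('k, 'v, 'm) module_scheme \<Rightarrow> ('k, 'w, 'n) module_scheme \<Rightarrow> ('v \<times> 'w \<Rightarrow> 'k) set"
  where "tensor_rels K V W =
    (let F = free_space K (carrier V \<times> carrier W); e = (\<lambda>v w. free_gen K (v, w)) in
      {e (v \<oplus>\<^bsub>V\<^esub> v') w \<ominus>\<^bsub>F\<^esub> (e v w \<oplus>\<^bsub>F\<^esub> e v' w) | v v' w.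
         v \<in> carrier V \<and> v' \<in> carrier V \<and> w \<in> carrier W} \<union>
      {e v (w \<oplus>\<^bsub>W\<^esub> w') \<ominus>\<^bsub>F\<^esub> (e v w \<oplus>\<^bsub>F\<^esub> e v w') | v w w'.
         v \<in> carrier V \<and> w \<in> carrier W \<and> w' \<in> carrier W} \<union>
      {e (a \<odot>\<^bsub>V\<^esub> v) w \<ominus>\<^bsub>F\<^esub> (a \<odot>\<^bsub>F\<^esub> e v w) | a v w.
         a \<in> carrier K \<and> v \<in> carrier V \<and> w \<in> carrier W} \<union>
      {e v (a \<odot>\<^bsub>W\<^esub> w) \<ominus>\<^bsub>F\<^esub> (a \<odot>\<^bsub>F\<^esub> e v w) | a v w.
         a \<in> carrier K \<and> v \<in> carrier V \<and> w \<in> carrier W})"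

definition tensor_null ::
  "('k, 'r) ring_scheme \<Rightarrow> ('k, 'v, 'm) module_scheme \<Rightarrow> ('k, 'w, 'n) module_scheme \<Rightarrow> ('v \<times> 'w \<Rightarrow> 'k) set"
  where "tensor_null K V W =
    span_of K (free_space K (carrier V \<times> carrier W)) (tensor_rels K V W)"

definition tensor ::
  "('k, 'r) ring_scheme \<Rightarrow> ('k, 'v, 'm) module_scheme \<Rightarrow> ('k, 'w, 'n) module_scheme
    \<Rightarrow> ('k, ('v \<times> 'w \<Rightarrow> 'k) set) module"
  where "tensor K V W =
    quotient_space (free_space K (carrier V \<times> carrier W)) (tensor_null K V W)"

definition tens ::
  "('k, 'r) ring_scheme \<Rightarrow> ('k, 'v, 'm) module_scheme \<Rightarrow> ('k, 'w, 'n) module_scheme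
    \<Rightarrow> 'v \<Rightarrow> 'w \<Rightarrow> ('v \<times> 'w \<Rightarrow> 'k) set"
  where "tens K V W v w =
    tensor_null K V W +>\<^bsub>free_space K (carrier V \<times> carrier W)\<^esub> free_gen K (v, w)"

text \<open>The linear map on \<open>V \<otimes> W\<close> induced by a bilinear map \<open>b\<close>. In Sweedler's notation,
  \<open>b x\<^sub>1 x\<^sub>2\<close> is \<open>tensor_lift K H H U b (\<Delta> x)\<close>.\<close>

definition tensor_lift ::
  "('k, 'r) ring_scheme \<Rightarrow> ('k, 'v, 'm) module_scheme \<Rightarrow> ('k, 'w, 'n) module_scheme
    \<Rightarrow> ('k, 'u, 'p) module_scheme \<Rightarrow> ('v \<Rightarrow> 'w \<Rightarrow> 'u) \<Rightarrow> ('v \<times> 'w \<Rightarrow> 'k) set \<Rightarrow> 'u"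
  where "tensor_lift K V W U b = (THE h.
    h \<in> extensional (carrier (tensor K V W)) \<and> linear_map K (tensor K V W) U h \<and>
    (\<forall>v \<in> carrier V. \<forall>w \<in> carrier W. h (tens K V W v w) = b v w))"

definition tensor_map ::
  "('k, 'r) ring_scheme \<Rightarrow> ('k, 'v, 'm) module_scheme \<Rightarrow> ('k, 'w, 'n) module_scheme
    \<Rightarrow> ('k, 'v', 'm') module_scheme \<Rightarrow> ('k, 'w', 'n') module_scheme
    \<Rightarrow> ('v \<Rightarrow> 'v') \<Rightarrow> ('w \<Rightarrow> 'w') \<Rightarrow> ('v \<times> 'w \<Rightarrow> 'k) set \<Rightarrow> ('v' \<times> 'w' \<Rightarrow> 'k) set"
  where "tensor_map K V W V' W' f g =
    tensor_lift K V W (tensor K V' W') (\<lambda>v w. tens K V' W' (f v) (g w))"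

text \<open>The associativity isomorphism \<open>(V \<otimes> W) \<otimes> U \<rightarrow> V \<otimes> (W \<otimes> U)\<close>.\<close>

definition tensor_assoc ::
  "('k, 'r) ring_scheme \<Rightarrow> ('k, 'v, 'm) module_scheme \<Rightarrow> ('k, 'w, 'n) module_scheme
    \<Rightarrow> ('k, 'u, 'p) module_scheme
    \<Rightarrow> (('v \<times> 'w \<Rightarrow> 'k) set \<times> 'u \<Rightarrow> 'k) set \<Rightarrow> ('v \<times> ('w \<times> 'u \<Rightarrow> 'k) set \<Rightarrow> 'k) set"
  where "tensor_assoc K V W U =
    tensor_lift K (tensor K V W) U (tensor K V (tensor K W U))
      (\<lambda>x u. tensor_lift K V W (tensor K V (tensor K W U))
        (\<lambda>v w. tens K V (tensor K W U) v (tens K W U w u)) x)"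

section \<open>Hopf algebras and left integrals\<close>

record ('k, 'h) hopf = "('k, 'h) module" +
  comult :: "'h \<Rightarrow> ('h \<times> 'h \<Rightarrow> 'k) set"
  counit :: "'h \<Rightarrow> 'k"
  antipode :: "'h \<Rightarrow> 'h"

definition tensor_mult ::
  "('k, 'r) ring_scheme \<Rightarrow> ('k, 'h, 'm) module_scheme
    \<Rightarrow> ('h \<times> 'h \<Rightarrow> 'k) set \<Rightarrow> ('h \<times> 'h \<Rightarrow> 'k) set \<Rightarrow> ('h \<times> 'h \<Rightarrow> 'k) set"
  where "tensor_mult K H A B =
    tensor_lift K H H (tensor K H H) (\<lambda>a b.
      tensor_lift K H H (tensor K H H) (\<lambda>c d. tens K H H (a \<otimes>\<^bsub>H\<^esub> c) (b \<otimes>\<^bsub>H\<^esub> d)) B) A"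

locale hopf_algebra = K: field K + mod: module K H + H: ring H
  for K :: "('k, 'r) ring_scheme" and H :: "('k, 'h, 'm) hopf_scheme" +
  assumes smult_mult_left:
      "\<lbrakk>a \<in> carrier K; x \<in> carrier H; y \<in> carrier H\<rbrakk>
        \<Longrightarrow> (a \<odot>\<^bsub>H\<^esub> x) \<otimes>\<^bsub>H\<^esub> y = a \<odot>\<^bsub>H\<^esub> (x \<otimes>\<^bsub>H\<^esub> y)"
    and smult_mult_right:
      "\<lbrakk>a \<in> carrier K; x \<in> carrier H; y \<in> carrier H\<rbrakk>
        \<Longrightarrow> x \<otimes>\<^bsub>H\<^esub> (a \<odot>\<^bsub>H\<^esub> y) = a \<odot>\<^bsub>H\<^esub> (x \<otimes>\<^bsub>H\<^esub> y)"
    and comult_linear: "linear_map K H (tensor K H H) (comult H)"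
    and counit_linear: "linear_map K H (scalars K) (counit H)"
    and antipode_linear: "linear_map K H H (antipode H)"
    and coassoc:
      "x \<in> carrier H \<Longrightarrow>
        tensor_assoc K H H H (tensor_map K H H (tensor K H H) H (comult H) (\<lambda>y. y) (comult H x))
        = tensor_map K H H H (tensor K H H) (\<lambda>y. y) (comult H) (comult H x)"
    and counit_left:
      "x \<in> carrier H \<Longrightarrow> tensor_lift K H H H (\<lambda>a b. counit H a \<odot>\<^bsub>H\<^esub> b) (comult H x) = x"
    and counit_right:
      "x \<in> carrier H \<Longrightarrow> tensor_lift K H H H (\<lambda>a b. counit H b \<odot>\<^bsub>H\<^esub> a) (comult H x) = x"
    and comult_mult:
      "\<lbrakk>x \<in> carrier H; y \<in> carrier H\<rbrakk>
        \<Longrightarrow> comult H (x \<otimes>\<^bsub>H\<^esub> y) = tensor_mult K H (comult H x) (comult H y)"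
    and comult_one: "comult H \<one>\<^bsub>H\<^esub> = tens K H H \<one>\<^bsub>H\<^esub> \<one>\<^bsub>H\<^esub>"
    and counit_mult:
      "\<lbrakk>x \<in> carrier H; y \<in> carrier H\<rbrakk>
        \<Longrightarrow> counit H (x \<otimes>\<^bsub>H\<^esub> y) = counit H x \<otimes>\<^bsub>K\<^esub> counit H y"
    and counit_one: "counit H \<one>\<^bsub>H\<^esub> = \<one>\<^bsub>K\<^esub>"
    and antipode_left:
      "x \<in> carrier H \<Longrightarrow>
        tensor_lift K H H H (\<lambda>a b. antipode H a \<otimes>\<^bsub>H\<^esub> b) (comult H x) = counit H x \<odot>\<^bsub>H\<^esub> \<one>\<^bsub>H\<^esub>"
    and antipode_right:
      "x \<in> carrier H \<Longrightarrow>
        tensor_lift K H H H (\<lambda>a b. a \<otimes>\<^bsub>H\<^esub> antipode H b) (comult H x) = counit H x \<odot>\<^bsub>H\<^esub> \<one>\<^bsub>H\<^esub>"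

definition left_integral ::
  "('k, 'r) ring_scheme \<Rightarrow> ('k, 'h, 'm) hopf_scheme \<Rightarrow> ('h \<Rightarrow> 'k) \<Rightarrow> bool"
  where "left_integral K H I \<longleftrightarrow>
    linear_map K H (scalars K) I \<and> (\<exists>x \<in> carrier H. I x \<noteq> \<zero>\<^bsub>K\<^esub>) \<and>
    (\<forall>x \<in> carrier H. tensor_lift K H H H (\<lambda>a b. I b \<odot>\<^bsub>H\<^esub> a) (comult H x) = I x \<odot>\<^bsub>H\<^esub> \<one>\<^bsub>H\<^esub>)"

definition conv ::
  "('k, 'r) ring_scheme \<Rightarrow> ('k, 'h, 'm) hopf_scheme \<Rightarrow> ('h \<Rightarrow> 'k) \<Rightarrow> 'h \<Rightarrow> 'h \<Rightarrow> 'h"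
  where "conv K H I g f =
    tensor_lift K H H H (\<lambda>a b. I (f \<otimes>\<^bsub>H\<^esub> antipode H a) \<odot>\<^bsub>H\<^esub> b) (comult H g)"

section \<open>Internal direct sums\<close>

definition direct_sum_of :: "('k, 'u, 'm) module_scheme \<Rightarrow> 'u set set \<Rightarrow> bool"
  where "direct_sum_of V \<W> \<longleftrightarrow>
    (\<forall>v \<in> carrier V. \<exists>!x. x \<in> (\<Pi>\<^sub>E W\<in>\<W>. W) \<and> finite {W \<in> \<W>. x W \<noteq> \<zero>\<^bsub>V\<^esub>} \<and>
      v = (\<Oplus>\<^bsub>V\<^esub>W \<in> {W \<in> \<W>. x W \<noteq> \<zero>\<^bsub>V\<^esub>}. x W))"

section \<open>Right comodules\<close>

record ('k, 'h, 'u) comodule = "('k, 'u) module" +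
  coact :: "'u \<Rightarrow> ('u \<times> 'h \<Rightarrow> 'k) set"

definition right_comodule ::
  "('k, 'r) ring_scheme \<Rightarrow> ('k, 'h, 'm) hopf_scheme \<Rightarrow> ('k, 'h, 'u) comodule \<Rightarrow> bool"
  where "right_comodule K H V \<longleftrightarrow>
    module K V \<and> linear_map K V (tensor K V H) (coact V) \<and>
    (\<forall>v \<in> carrier V.
      tensor_assoc K V H H (tensor_map K V H (tensor K V H) H (coact V) (\<lambda>h. h) (coact V v))
      = tensor_map K V H V (tensor K H H) (\<lambda>u. u) (comult H) (coact V v)) \<and>
    (\<forall>v \<in> carrier V. tensor_lift K V H V (\<lambda>u h. counit H h \<odot>\<^bsub>V\<^esub> u) (coact V v) = v)"

definition comodule_homs ::
  "('k, 'r) ring_scheme \<Rightarrow> ('k, 'h, 'm) hopf_scheme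
    \<Rightarrow> ('k, 'h, 'u) comodule \<Rightarrow> ('k, 'h, 'u) comodule \<Rightarrow> ('u \<Rightarrow> 'u) set"
  where "comodule_homs K H V W =
    {f. f \<in> extensional (carrier V) \<and> linear_map K V W f \<and>
      (\<forall>v \<in> carrier V. coact W (f v) = tensor_map K V H W H f (\<lambda>h. h) (coact V v))}"

text \<open>The span below is the image of \<open>W \<otimes> H\<close> in \<open>V \<otimes> H\<close>; over a field it is a copy of \<open>W \<otimes> H\<close>. Hence the
  subcomodules of the comodule \<open>W\<close> are the subcomodules of \<open>V\<close> contained in \<open>W\<close>.\<close>

definition subcomodule ::
  "('k, 'r) ring_scheme \<Rightarrow> ('k, 'h, 'm) hopf_scheme \<Rightarrow> ('k, 'h, 'u) comodule \<Rightarrow> 'u set \<Rightarrow> bool"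
  where "subcomodule K H V W \<longleftrightarrow>
    submodule W K V \<and>
    (\<forall>w \<in> W. coact V w \<in> span_of K (tensor K V H) {tens K V H u h | u h. u \<in> W \<and> h \<in> carrier H})"

definition simple_subcomodule ::
  "('k, 'r) ring_scheme \<Rightarrow> ('k, 'h, 'm) hopf_scheme \<Rightarrow> ('k, 'h, 'u) comodule \<Rightarrow> 'u set \<Rightarrow> bool"
  where "simple_subcomodule K H V W \<longleftrightarrow>
    subcomodule K H V W \<and> W \<noteq> {\<zero>\<^bsub>V\<^esub>} \<and>
    (\<forall>U. subcomodule K H V U \<and> U \<subseteq> W \<longrightarrow> U = {\<zero>\<^bsub>V\<^esub>} \<or> U = W)"

definition completely_reducible_comodule ::
  "('k, 'r) ring_scheme \<Rightarrow> ('k, 'h, 'm) hopf_scheme \<Rightarrow> ('k, 'h, 'u) comodule \<Rightarrow> bool"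
  where "completely_reducible_comodule K H V \<longleftrightarrow>
    right_comodule K H V \<and>
    (\<exists>\<W>. (\<forall>W \<in> \<W>. simple_subcomodule K H V W) \<and> direct_sum_of V \<W>)"

section \<open>Left modules over the convolution algebra\<close>

record ('k, 'h, 'u) conv_module = "('k, 'u) module" +
  act :: "'h \<Rightarrow> 'u \<Rightarrow> 'u"

definition left_conv_module ::
  "('k, 'r) ring_scheme \<Rightarrow> ('k, 'h, 'm) hopf_scheme \<Rightarrow> ('h \<Rightarrow> 'k)
    \<Rightarrow> ('k, 'h, 'u) conv_module \<Rightarrow> bool"
  where "left_conv_module K H I V \<longleftrightarrow>
    module K V \<and>
    (\<forall>f \<in> carrier H. linear_map K V V (act V f)) \<and>
    (\<forall>v \<in> carrier V. linear_map K H V (\<lambda>f. act V f v)) \<and>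
    (\<forall>f \<in> carrier H. \<forall>g \<in> carrier H. \<forall>v \<in> carrier V.
      act V (conv K H I f g) v = act V f (act V g v))"

definition conv_module_homs ::
  "('k, 'r) ring_scheme \<Rightarrow> ('k, 'h, 'm) hopf_scheme
    \<Rightarrow> ('k, 'h, 'u) conv_module \<Rightarrow> ('k, 'h, 'u) conv_module \<Rightarrow> ('u \<Rightarrow> 'u) set"
  where "conv_module_homs K H V W =
    {\<phi>. \<phi> \<in> extensional (carrier V) \<and> linear_map K V W \<phi> \<and>
      (\<forall>f \<in> carrier H. \<forall>v \<in> carrier V. \<phi> (act V f v) = act W f (\<phi> v))}"

definition conv_submodule ::
  "('k, 'r) ring_scheme \<Rightarrow> ('k, 'h, 'm) hopf_scheme \<Rightarrow> ('k, 'h, 'u) conv_module \<Rightarrow> 'u set \<Rightarrow> bool"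
  where "conv_submodule K H V W \<longleftrightarrow>
    submodule W K V \<and> (\<forall>f \<in> carrier H. \<forall>w \<in> W. act V f w \<in> W)"

text \<open>The convolution algebra need not be unital, so a simple module is required to be of the form
  \<open>{f * v | f}\<close>; this excludes the one-dimensional module with zero action.\<close>

definition simple_conv_submodule ::
  "('k, 'r) ring_scheme \<Rightarrow> ('k, 'h, 'm) hopf_scheme \<Rightarrow> ('k, 'h, 'u) conv_module \<Rightarrow> 'u set \<Rightarrow> bool"
  where "simple_conv_submodule K H V W \<longleftrightarrow>
    conv_submodule K H V W \<and> W \<noteq> {\<zero>\<^bsub>V\<^esub>} \<and>
    (\<forall>U. conv_submodule K H V U \<and> U \<subseteq> W \<longrightarrow> U = {\<zero>\<^bsub>V\<^esub>} \<or> U = W) \<and>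
    (\<exists>v \<in> W. W = {act V f v | f. f \<in> carrier H})"

definition completely_reducible_conv_module ::
  "('k, 'r) ring_scheme \<Rightarrow> ('k, 'h, 'm) hopf_scheme \<Rightarrow> ('h \<Rightarrow> 'k)
    \<Rightarrow> ('k, 'h, 'u) conv_module \<Rightarrow> bool"
  where "completely_reducible_conv_module K H I V \<longleftrightarrow>
    left_conv_module K H I V \<and>
    (\<exists>\<W>. (\<forall>W \<in> \<W>. simple_conv_submodule K H V W) \<and> direct_sum_of V \<W>)"

section \<open>Categories and equivalences\<close>

text \<open>Hom-sets are indexed by their domain and codomain, so they need not be disjoint.\<close>

record ('o, 'm) cat =
  Obj :: "'o set"
  Hom :: "'o \<Rightarrow> 'o \<Rightarrow> 'm set"
  Idn :: "'o \<Rightarrow> 'm"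
  Cmp :: "'o \<Rightarrow> 'o \<Rightarrow> 'o \<Rightarrow> 'm \<Rightarrow> 'm \<Rightarrow> 'm"

definition is_category :: "('o, 'm) cat \<Rightarrow> bool"
  where "is_category C \<longleftrightarrow>
    (\<forall>a \<in> Obj C. Idn C a \<in> Hom C a a) \<and>
    (\<forall>a \<in> Obj C. \<forall>b \<in> Obj C. \<forall>c \<in> Obj C. \<forall>f \<in> Hom C a b. \<forall>g \<in> Hom C b c.
      Cmp C a b c g f \<in> Hom C a c) \<and>
    (\<forall>a \<in> Obj C. \<forall>b \<in> Obj C. \<forall>f \<in> Hom C a b.
      Cmp C a a b f (Idn C a) = f \<and> Cmp C a b b (Idn C b) f = f) \<and>
    (\<forall>a \<in> Obj C. \<forall>b \<in> Obj C. \<forall>c \<in> Obj C. \<forall>d \<in> Obj C.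
      \<forall>f \<in> Hom C a b. \<forall>g \<in> Hom C b c. \<forall>h \<in> Hom C c d.
      Cmp C a c d h (Cmp C a b c g f) = Cmp C a b d (Cmp C b c d h g) f)"

definition is_functor ::
  "('o, 'm) cat \<Rightarrow> ('p, 'n) cat \<Rightarrow> ('o \<Rightarrow> 'p) \<Rightarrow> ('o \<Rightarrow> 'o \<Rightarrow> 'm \<Rightarrow> 'n) \<Rightarrow> bool"
  where "is_functor C D F\<^sub>o F\<^sub>m \<longleftrightarrow>
    (\<forall>a \<in> Obj C. F\<^sub>o a \<in> Obj D) \<and>
    (\<forall>a \<in> Obj C. \<forall>b \<in> Obj C. \<forall>f \<in> Hom C a b. F\<^sub>m a b f \<in> Hom D (F\<^sub>o a) (F\<^sub>o b)) \<and>
    (\<forall>a \<in> Obj C. F\<^sub>m a a (Idn C a) = Idn D (F\<^sub>o a)) \<and>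
    (\<forall>a \<in> Obj C. \<forall>b \<in> Obj C. \<forall>c \<in> Obj C. \<forall>f \<in> Hom C a b. \<forall>g \<in> Hom C b c.
      F\<^sub>m a c (Cmp C a b c g f) = Cmp D (F\<^sub>o a) (F\<^sub>o b) (F\<^sub>o c) (F\<^sub>m b c g) (F\<^sub>m a b f))"

definition is_iso :: "('o, 'm) cat \<Rightarrow> 'o \<Rightarrow> 'o \<Rightarrow> 'm \<Rightarrow> bool"
  where "is_iso C a b f \<longleftrightarrow>
    f \<in> Hom C a b \<and>
    (\<exists>g \<in> Hom C b a. Cmp C a b a g f = Idn C a \<and> Cmp C b a b f g = Idn C b)"

definition natural_iso ::
  "('o, 'm) cat \<Rightarrow> ('p, 'n) cat \<Rightarrow> ('o \<Rightarrow> 'p) \<Rightarrow> ('o \<Rightarrow> 'o \<Rightarrow> 'm \<Rightarrow> 'n)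
    \<Rightarrow> ('o \<Rightarrow> 'p) \<Rightarrow> ('o \<Rightarrow> 'o \<Rightarrow> 'm \<Rightarrow> 'n) \<Rightarrow> ('o \<Rightarrow> 'n) \<Rightarrow> bool"
  where "natural_iso C D F\<^sub>o F\<^sub>m G\<^sub>o G\<^sub>m \<eta> \<longleftrightarrow>
    (\<forall>a \<in> Obj C. is_iso D (F\<^sub>o a) (G\<^sub>o a) (\<eta> a)) \<and>
    (\<forall>a \<in> Obj C. \<forall>b \<in> Obj C. \<forall>f \<in> Hom C a b.
      Cmp D (F\<^sub>o a) (F\<^sub>o b) (G\<^sub>o b) (\<eta> b) (F\<^sub>m a b f)
      = Cmp D (F\<^sub>o a) (G\<^sub>o a) (G\<^sub>o b) (G\<^sub>m a b f) (\<eta> a))"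

definition equivalent_categories :: "('o, 'm) cat \<Rightarrow> ('p, 'n) cat \<Rightarrow> bool"
  where "equivalent_categories C D \<longleftrightarrow>
    is_category C \<and> is_category D \<and>
    (\<exists>F\<^sub>o F\<^sub>m G\<^sub>o G\<^sub>m \<eta> \<theta>.
      is_functor C D F\<^sub>o F\<^sub>m \<and> is_functor D C G\<^sub>o G\<^sub>m \<and>
      natural_iso C C (\<lambda>a. a) (\<lambda>a b f. f)
        (\<lambda>a. G\<^sub>o (F\<^sub>o a)) (\<lambda>a b f. G\<^sub>m (F\<^sub>o a) (F\<^sub>o b) (F\<^sub>m a b f)) \<eta> \<and>
      natural_iso D D (\<lambda>a. F\<^sub>o (G\<^sub>o a)) (\<lambda>a b f. F\<^sub>m (G\<^sub>o a) (G\<^sub>o b) (G\<^sub>m a b f))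
        (\<lambda>a. a) (\<lambda>a b f. f) \<theta>)"

text \<open>The type \<open>'u\<close> plays the role of the set-theoretic universe: the objects are all
  structures whose underlying set is a subset of \<open>'u\<close>. The type is arbitrary.\<close>

definition cr_comodule_cat ::
  "('k, 'r) ring_scheme \<Rightarrow> ('k, 'h, 'm) hopf_scheme \<Rightarrow> (('k, 'h, 'u) comodule, 'u \<Rightarrow> 'u) cat"
  where "cr_comodule_cat K H =
    \<lparr>Obj = {V. completely_reducible_comodule K H V},
     Hom = comodule_homs K H,
     Idn = (\<lambda>V. \<lambda>v \<in> carrier V. v),
     Cmp = (\<lambda>U V W g f. compose (carrier U) g f)\<rparr>"

definition cr_conv_module_cat ::
  "('k, 'r) ring_scheme \<Rightarrow> ('k, 'h, 'm) hopf_scheme \<Rightarrow> ('h \<Rightarrow> 'k)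
    \<Rightarrow> (('k, 'h, 'u) conv_module, 'u \<Rightarrow> 'u) cat"
  where "cr_conv_module_cat K H I =
    \<lparr>Obj = {V. completely_reducible_conv_module K H I V},
     Hom = conv_module_homs K H,
     Idn = (\<lambda>V. \<lambda>v \<in> carrier V. v),
     Cmp = (\<lambda>U V W g f. compose (carrier U) g f)\<rparr>"

end

theory Submission
  imports Defs
begin

text \<open>A right comodule \<open>V\<close> becomes a module over the convolution algebra by
  \<open>f \<cdot> v = v\<^sub>0 \<integral>(v\<^sub>1 S(f))\<close>, where \<open>\<integral>\<close> is the left integral. Everything rests on the identity
  \<open>\<integral>(y S(h\<^sub>1)) h\<^sub>2 = y\<^sub>1 \<integral>(y\<^sub>2 S(h))\<close>, which gives \<open>f * g = g\<^sub>1 \<integral>(g\<^sub>2 S(f))\<close>, and on the fact that the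
  functionals \<open>\<integral>(\<cdot> S(f))\<close> separate the points of \<open>H\<close>. For the latter, the identity shows that
  \<open>\<integral>(f S(x)) = 0\<close> for all \<open>f\<close> forces \<open>x = 0\<close>, whence \<open>S\<close> is injective; the functionals \<open>\<integral>(u S(\<cdot>))\<close> are
  rational, so the structure theorem of Hopf modules provides a right integral \<open>R \<noteq> 0\<close>, and comparing
  \<open>\<integral>\<close> with \<open>R\<close> yields the claim.

  Since the functionals separate points, an element of \<open>V \<otimes> H\<close> is determined by its slices, so
  subcomodules are submodules and comodule maps are module maps. Conversely, if \<open>M\<close> is spanned by
  elements \<open>g \<cdot> w\<close>, as completely reducible modules are, then \<open>g \<cdot> w \<mapsto> g\<^sub>1 \<cdot> w \<otimes> g\<^sub>2\<close> is a coaction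
  with the required slices. Both functors are the identity on spaces and maps.\<close>

section \<open>Linear maps and sums over lists\<close>

text \<open>The obstacle is the side on which the integral separates points. That
  \<open>I(f S(x)) = 0\<close> for all \<open>f\<close> forces \<open>x = 0\<close> comes straight
  from the identity, but slices of tensors are taken with \<open>I(\<cdot> S(f))\<close>, where the
  other factor varies. A right integral is therefore taken from the coinvariants of a Hopf module,
  where the reconstruction formula shows that they do not all vanish. The second obstacle is the
  missing unit: an element of a module need not be \<open>1 \<cdot> v\<close>, so there is no
  evident formula for a coaction. It is instead prescribed through its slices. Then only existence
  has to be checked on elements \<open>g \<cdot> w\<close>; that the result is well defined and
  linear is the uniqueness of a tensor with given slices.\<close>

lemma linear_mapI:
  assumes "\<And>x. x \<in> carrier V \<Longrightarrow> f x \<in> carrier W"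
    and "\<And>x y. x \<in> carrier V \<Longrightarrow> y \<in> carrier V \<Longrightarrow> f (x \<oplus>\<^bsub>V\<^esub> y) = f x \<oplus>\<^bsub>W\<^esub> f y"
    and "\<And>a x. a \<in> carrier K \<Longrightarrow> x \<in> carrier V \<Longrightarrow> f (a \<odot>\<^bsub>V\<^esub> x) = a \<odot>\<^bsub>W\<^esub> f x"
  shows "linear_map K V W f"
  using assms by (auto simp: linear_map_def)

lemma linear_mapD:
  assumes "linear_map K V W f"
  shows "x \<in> carrier V \<Longrightarrow> f x \<in> carrier W"
    and "x \<in> carrier V \<Longrightarrow> y \<in> carrier V \<Longrightarrow> f (x \<oplus>\<^bsub>V\<^esub> y) = f x \<oplus>\<^bsub>W\<^esub> f y"
    and "a \<in> carrier K \<Longrightarrow> x \<in> carrier V \<Longrightarrow> f (a \<odot>\<^bsub>V\<^esub> x) = a \<odot>\<^bsub>W\<^esub> f x"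
  using assms by (auto simp: linear_map_def)

lemma linear_map_zero:
  assumes "module K V" "module K W" "linear_map K V W f"
  shows "f \<zero>\<^bsub>V\<^esub> = \<zero>\<^bsub>W\<^esub>"
proof -
  interpret V: module K V by fact
  interpret W: module K W by fact
  have "f (\<zero>\<^bsub>K\<^esub> \<odot>\<^bsub>V\<^esub> \<zero>\<^bsub>V\<^esub>) = \<zero>\<^bsub>K\<^esub> \<odot>\<^bsub>W\<^esub> f \<zero>\<^bsub>V\<^esub>"
    by (rule linear_mapD(3)[OF assms(3)]) auto
  then show ?thesis using linear_mapD(1)[OF assms(3)] by simp
qed

lemma linear_map_minus:
  assumes "module K V" "module K W" "linear_map K V W f" "x \<in> carrier V"
  shows "f (\<ominus>\<^bsub>V\<^esub> x) = \<ominus>\<^bsub>W\<^esub> f x"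
proof -
  interpret V: module K V by fact
  interpret W: module K W by fact
  have "f (\<ominus>\<^bsub>V\<^esub> x) \<oplus>\<^bsub>W\<^esub> f x = \<zero>\<^bsub>W\<^esub>"
    using linear_mapD(2)[OF assms(3), of "\<ominus>\<^bsub>V\<^esub> x" x] linear_map_zero[OF assms(1,2,3)] assms(4)
    by (simp add: V.l_neg)
  then show ?thesis
    using linear_mapD(1)[OF assms(3)] assms(4) by (intro W.minus_equality[symmetric]) auto
qed

lemma linear_map_kernel:
  assumes "module K V" "module K W" "linear_map K V W f"
  shows "submodule {x \<in> carrier V. f x = \<zero>\<^bsub>W\<^esub>} K V"
proof -
  interpret V: module K V by fact
  interpret W: module K W by fact
  show ?thesis
    by (rule V.submoduleI)
      (use linear_mapD[OF assms(3)] linear_map_zero[OF assms] linear_map_minus[OF assms] in auto)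
qed

lemma linear_map_equalizer:
  assumes "module K V" "module K W" "linear_map K V W f" "linear_map K V W g"
  shows "submodule {x \<in> carrier V. f x = g x} K V"
proof -
  interpret V: module K V by fact
  interpret W: module K W by fact
  show ?thesis
    by (rule V.submoduleI)
      (use linear_mapD[OF assms(3)] linear_map_zero[OF assms(1,2,3)] linear_map_minus[OF assms(1,2,3)]
         linear_mapD[OF assms(4)] linear_map_zero[OF assms(1,2,4)] linear_map_minus[OF assms(1,2,4)]
       in auto)
qed

lemma linear_map_id: "linear_map K V V (\<lambda>x. x)"
  by (rule linear_mapI) auto

lemma linear_map_comp:
  "linear_map K V W g \<Longrightarrow> linear_map K U V f \<Longrightarrow> linear_map K U W (\<lambda>x. g (f x))"
  by (auto simp: linear_map_def Pi_iff)

lemma linear_map_smult: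
  assumes "module K W" "linear_map K V W f" "c \<in> carrier K"
  shows "linear_map K V W (\<lambda>x. c \<odot>\<^bsub>W\<^esub> f x)"
proof -
  interpret W: module K W by fact
  have "c \<odot>\<^bsub>W\<^esub> (a \<odot>\<^bsub>W\<^esub> y) = a \<odot>\<^bsub>W\<^esub> (c \<odot>\<^bsub>W\<^esub> y)" if "a \<in> carrier K" "y \<in> carrier W" for a y
    using that assms(3) by (metis W.smult_assoc1 W.R.m_comm)
  then show ?thesis
    using linear_mapD[OF assms(2)] assms(3) by (intro linear_mapI) (auto simp: W.smult_r_distr)
qed

text \<open>Lists are used because a representation of a tensor may repeat a pair; with
  \<open>foldr\<close> the recursion equations hold without the membership conditions that
  \<open>finsum\<close> requires.\<close>

definition lsum :: "('k, 'u, 'm) module_scheme \<Rightarrow> ('a \<Rightarrow> 'u) \<Rightarrow> 'a list \<Rightarrow> 'u"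
  where "lsum U f ps = foldr (\<lambda>p s. f p \<oplus>\<^bsub>U\<^esub> s) ps \<zero>\<^bsub>U\<^esub>"

lemma lsum_simps [simp]:
  "lsum U f [] = \<zero>\<^bsub>U\<^esub>"
  "lsum U f (p # ps) = f p \<oplus>\<^bsub>U\<^esub> lsum U f ps"
  by (auto simp: lsum_def)

lemma lsum_cong: "(\<And>p. p \<in> set ps \<Longrightarrow> f p = g p) \<Longrightarrow> lsum U f ps = lsum U g ps"
  by (induction ps) auto

lemma lsum_map: "lsum U f (map g ps) = lsum U (\<lambda>p. f (g p)) ps"
  by (induction ps) auto

lemma lsum_submodule:
  assumes "module K U" "submodule Z K U" "\<And>p. p \<in> set ps \<Longrightarrow> f p \<in> Z"
  shows "lsum U f ps \<in> Z"
  using assms(3)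
proof (induction ps)
  case Nil
  then show ?case
    using submodule.axioms(1)[OF assms(2)] by (auto dest: subgroup.one_closed)
next
  case (Cons p ps)
  then show ?case using module.submoduleE(5)[OF assms(1,2)] by simp
qed

context module
begin

lemma lsum_closed [simp]:
  "(\<And>p. p \<in> set ps \<Longrightarrow> f p \<in> carrier M) \<Longrightarrow> lsum M f ps \<in> carrier M"
  by (induction ps) auto

lemma lsum_append:
  "(\<And>p. p \<in> set ps \<union> set qs \<Longrightarrow> f p \<in> carrier M)
    \<Longrightarrow> lsum M f (ps @ qs) = lsum M f ps \<oplus>\<^bsub>M\<^esub> lsum M f qs"
  by (induction ps) (auto simp: a_assoc)

lemma lsum_zero [simp]: "lsum M (\<lambda>p. \<zero>\<^bsub>M\<^esub>) ps = \<zero>\<^bsub>M\<^esub>"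
  by (induction ps) auto

lemma lsum_add:
  "(\<And>p. p \<in> set ps \<Longrightarrow> f p \<in> carrier M) \<Longrightarrow> (\<And>p. p \<in> set ps \<Longrightarrow> g p \<in> carrier M)
    \<Longrightarrow> lsum M (\<lambda>p. f p \<oplus>\<^bsub>M\<^esub> g p) ps = lsum M f ps \<oplus>\<^bsub>M\<^esub> lsum M g ps"
  by (induction ps) (auto simp: a_ac)

lemma lsum_swap:
  "(\<And>p q. p \<in> set ps \<Longrightarrow> q \<in> set qs \<Longrightarrow> f p q \<in> carrier M)
    \<Longrightarrow> lsum M (\<lambda>p. lsum M (\<lambda>q. f p q) qs) ps = lsum M (\<lambda>q. lsum M (\<lambda>p. f p q) ps) qs"
  by (induction ps) (auto simp: lsum_add)

end

lemma lsum_linear: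
  assumes "module K V" "module K U" "linear_map K V U h" "\<And>p. p \<in> set ps \<Longrightarrow> f p \<in> carrier V"
  shows "h (lsum V f ps) = lsum U (\<lambda>p. h (f p)) ps"
  using assms(4)
  by (induction ps)
    (auto simp: linear_map_zero[OF assms(1-3)] linear_mapD[OF assms(3)] module.lsum_closed[OF assms(1)])

section \<open>Bilinear maps and free vector spaces\<close>

definition bilinear ::
  "('k, 'r) ring_scheme \<Rightarrow> ('k, 'v, 'm) module_scheme \<Rightarrow> ('k, 'w, 'n) module_scheme
    \<Rightarrow> ('k, 'u, 'p) module_scheme \<Rightarrow> ('v \<Rightarrow> 'w \<Rightarrow> 'u) \<Rightarrow> bool"
  where "bilinear K V W U b \<longleftrightarrow>
    (\<forall>w \<in> carrier W. linear_map K V U (\<lambda>v. b v w)) \<and> (\<forall>v \<in> carrier V. linear_map K W U (b v))"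

lemma bilinearI:
  "(\<And>w. w \<in> carrier W \<Longrightarrow> linear_map K V U (\<lambda>v. b v w)) \<Longrightarrow>
   (\<And>v. v \<in> carrier V \<Longrightarrow> linear_map K W U (\<lambda>w. b v w)) \<Longrightarrow> bilinear K V W U b"
  by (auto simp: bilinear_def)

lemma bilinearD:
  assumes "bilinear K V W U b"
  shows "w \<in> carrier W \<Longrightarrow> linear_map K V U (\<lambda>v. b v w)"
    and "v \<in> carrier V \<Longrightarrow> linear_map K W U (b v)"
    and "v \<in> carrier V \<Longrightarrow> w \<in> carrier W \<Longrightarrow> b v w \<in> carrier U"
  using assms by (auto simp: bilinear_def linear_map_def Pi_iff)

lemma free_space_simps [simp]:
  "carrier (free_space K S) =
    {p. range p \<subseteq> carrier K \<and> (\<forall>s. s \<notin> S \<longrightarrow> p s = \<zero>\<^bsub>K\<^esub>) \<and> finite {s. p s \<noteq> \<zero>\<^bsub>K\<^esub>}}"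
  "\<zero>\<^bsub>free_space K S\<^esub> = (\<lambda>s. \<zero>\<^bsub>K\<^esub>)"
  "p \<oplus>\<^bsub>free_space K S\<^esub> q = (\<lambda>s. p s \<oplus>\<^bsub>K\<^esub> q s)"
  "a \<odot>\<^bsub>free_space K S\<^esub> p = (\<lambda>s. a \<otimes>\<^bsub>K\<^esub> p s)"
  by (auto simp: free_space_def)

lemma free_space_closed:
  "p \<in> carrier (free_space K S) \<Longrightarrow> p s \<in> carrier K"
  by auto

lemma free_space_module:
  assumes "cring K"
  shows "module K (free_space K S)"
proof -
  interpret K: cring K by fact
  let ?F = "free_space K S"
  have add: "(\<lambda>s. p s \<oplus>\<^bsub>K\<^esub> q s) \<in> carrier ?F" if "p \<in> carrier ?F" "q \<in> carrier ?F" for p q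
  proof -
    have "{s. p s \<oplus>\<^bsub>K\<^esub> q s \<noteq> \<zero>\<^bsub>K\<^esub>} \<subseteq> {s. p s \<noteq> \<zero>\<^bsub>K\<^esub>} \<union> {s. q s \<noteq> \<zero>\<^bsub>K\<^esub>}" by auto
    then show ?thesis using that by (auto intro: finite_subset simp: image_subset_iff)
  qed
  have smult: "(\<lambda>s. a \<otimes>\<^bsub>K\<^esub> p s) \<in> carrier ?F" if "a \<in> carrier K" "p \<in> carrier ?F" for p a
  proof -
    have "{s. a \<otimes>\<^bsub>K\<^esub> p s \<noteq> \<zero>\<^bsub>K\<^esub>} \<subseteq> {s. p s \<noteq> \<zero>\<^bsub>K\<^esub>}" using that by auto
    then show ?thesis using that by (auto intro: finite_subset simp: image_subset_iff)
  qed
  have neg: "\<exists>q \<in> carrier ?F. q \<oplus>\<^bsub>?F\<^esub> p = \<zero>\<^bsub>?F\<^esub>" if p: "p \<in> carrier ?F" for p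
  proof (rule bexI)
    show "(\<lambda>s. (\<ominus>\<^bsub>K\<^esub> \<one>\<^bsub>K\<^esub>) \<otimes>\<^bsub>K\<^esub> p s) \<in> carrier ?F"
      by (rule smult) (use p in auto)
    show "(\<lambda>s. (\<ominus>\<^bsub>K\<^esub> \<one>\<^bsub>K\<^esub>) \<otimes>\<^bsub>K\<^esub> p s) \<oplus>\<^bsub>?F\<^esub> p = \<zero>\<^bsub>?F\<^esub>"
      using free_space_closed[OF p] by (simp add: K.l_minus K.l_neg)
  qed
  have zero: "\<zero>\<^bsub>?F\<^esub> \<in> carrier ?F" by auto
  note cl = free_space_closed[of _ K S]
  have "abelian_group ?F"
  proof (rule abelian_groupI)
    show "p \<oplus>\<^bsub>?F\<^esub> q \<in> carrier ?F" if "p \<in> carrier ?F" "q \<in> carrier ?F" for p q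
      using add[OF that] by (simp only: free_space_simps(3))
    show "p \<oplus>\<^bsub>?F\<^esub> q \<oplus>\<^bsub>?F\<^esub> r = p \<oplus>\<^bsub>?F\<^esub> (q \<oplus>\<^bsub>?F\<^esub> r)"
      if "p \<in> carrier ?F" "q \<in> carrier ?F" "r \<in> carrier ?F" for p q r
      using that[THEN cl] by (simp add: K.a_assoc)
    show "p \<oplus>\<^bsub>?F\<^esub> q = q \<oplus>\<^bsub>?F\<^esub> p" if "p \<in> carrier ?F" "q \<in> carrier ?F" for p q
      using that[THEN cl] by (simp add: K.a_comm)
    show "\<zero>\<^bsub>?F\<^esub> \<oplus>\<^bsub>?F\<^esub> p = p" if "p \<in> carrier ?F" for p
      using that[THEN cl] by simp
  qed (fact zero neg)+
  then show ?thesis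
  proof (rule moduleI[OF assms])
    show "a \<odot>\<^bsub>?F\<^esub> p \<in> carrier ?F" if "a \<in> carrier K" "p \<in> carrier ?F" for a p
      using smult[OF that] by (simp only: free_space_simps(4))
    show "(a \<oplus>\<^bsub>K\<^esub> b) \<odot>\<^bsub>?F\<^esub> p = a \<odot>\<^bsub>?F\<^esub> p \<oplus>\<^bsub>?F\<^esub> b \<odot>\<^bsub>?F\<^esub> p"
      if "a \<in> carrier K" "b \<in> carrier K" "p \<in> carrier ?F" for a b p
      using that(1,2) that(3)[THEN cl] by (simp add: K.l_distr)
    show "a \<odot>\<^bsub>?F\<^esub> (p \<oplus>\<^bsub>?F\<^esub> q) = a \<odot>\<^bsub>?F\<^esub> p \<oplus>\<^bsub>?F\<^esub> a \<odot>\<^bsub>?F\<^esub> q"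
      if "a \<in> carrier K" "p \<in> carrier ?F" "q \<in> carrier ?F" for a p q
      using that(1) that(2,3)[THEN cl] by (simp add: K.r_distr)
    show "(a \<otimes>\<^bsub>K\<^esub> b) \<odot>\<^bsub>?F\<^esub> p = a \<odot>\<^bsub>?F\<^esub> (b \<odot>\<^bsub>?F\<^esub> p)"
      if "a \<in> carrier K" "b \<in> carrier K" "p \<in> carrier ?F" for a b p
      using that(1,2) that(3)[THEN cl] by (simp add: K.m_assoc)
    show "\<one>\<^bsub>K\<^esub> \<odot>\<^bsub>?F\<^esub> p = p" if "p \<in> carrier ?F" for p
      using that[THEN cl] by simp
  qed
qed

section \<open>Quotients and free spaces\<close>

lemma (in module) submoduleI':
  assumes "N \<subseteq> carrier M" "\<zero>\<^bsub>M\<^esub> \<in> N"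
    and "\<And>x y. x \<in> N \<Longrightarrow> y \<in> N \<Longrightarrow> x \<oplus>\<^bsub>M\<^esub> y \<in> N"
    and "\<And>a x. a \<in> carrier R \<Longrightarrow> x \<in> N \<Longrightarrow> a \<odot>\<^bsub>M\<^esub> x \<in> N"
  shows "submodule N R M"
proof (rule submoduleI)
  fix x assume x: "x \<in> N"
  then have "\<ominus>\<^bsub>M\<^esub> x = (\<ominus>\<^bsub>R\<^esub> \<one>\<^bsub>R\<^esub>) \<odot>\<^bsub>M\<^esub> x"
    using assms(1) by (subst smult_l_minus) auto
  then show "\<ominus>\<^bsub>M\<^esub> x \<in> N" using assms(4) x by simp
qed (use assms in auto)

lemma (in module) submodule_zero: "submodule N R M \<Longrightarrow> \<zero>\<^bsub>M\<^esub> \<in> N"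
  using subgroup.one_closed[OF submodule.axioms(1)] by fastforce

lemma linear_map_vimage:
  assumes "module K V" "module K W" "linear_map K V W f" "submodule N K W"
  shows "submodule {x \<in> carrier V. f x \<in> N} K V"
proof -
  interpret V: module K V by fact
  interpret W: module K W by fact
  show ?thesis
    by (rule V.submoduleI')
      (use linear_mapD[OF assms(3)] linear_map_zero[OF assms(1-3)] W.submoduleE[OF assms(4)]
         W.submodule_zero[OF assms(4)] in auto)
qed

lemma linear_map_image:
  assumes "module K V" "module K W" "linear_map K V W f" "submodule N K V"
  shows "submodule (f ` N) K W"
proof -
  interpret V: module K V by fact
  interpret W: module K W by fact
  have N: "N \<subseteq> carrier V" using V.submoduleE(1)[OF assms(4)] .
  show ?thesis
  proof (rule W.submoduleI')
    show "f ` N \<subseteq> carrier W" using N linear_mapD(1)[OF assms(3)] by auto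
    show "\<zero>\<^bsub>W\<^esub> \<in> f ` N"
      by (rule image_eqI[where x = "\<zero>\<^bsub>V\<^esub>"]) (simp_all add: linear_map_zero[OF assms(1-3)] V.submodule_zero[OF assms(4)])
    show "x \<oplus>\<^bsub>W\<^esub> y \<in> f ` N" if "x \<in> f ` N" "y \<in> f ` N" for x y
    proof -
      from that obtain u v where uv: "u \<in> N" "v \<in> N" "x = f u" "y = f v" by auto
      then have "f (u \<oplus>\<^bsub>V\<^esub> v) = x \<oplus>\<^bsub>W\<^esub> y" using linear_mapD(2)[OF assms(3)] N by auto
      moreover have "u \<oplus>\<^bsub>V\<^esub> v \<in> N" using V.submoduleE(5)[OF assms(4)] uv by auto
      ultimately show ?thesis by (intro image_eqI) auto
    qed
    show "a \<odot>\<^bsub>W\<^esub> x \<in> f ` N" if "a \<in> carrier K" "x \<in> f ` N" for a x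
    proof -
      from that obtain u where u: "u \<in> N" "x = f u" by auto
      then have "f (a \<odot>\<^bsub>V\<^esub> u) = a \<odot>\<^bsub>W\<^esub> x" using linear_mapD(3)[OF assms(3) that(1)] N by auto
      moreover have "a \<odot>\<^bsub>V\<^esub> u \<in> N" using V.submoduleE(4)[OF assms(4)] u that by auto
      ultimately show ?thesis by (intro image_eqI) auto
    qed
  qed
qed

lemma span_of_least: "submodule N K V \<Longrightarrow> S \<subseteq> N \<Longrightarrow> span_of K V S \<subseteq> N"
  by (auto simp: span_of_def)

lemma span_of_superset: "S \<subseteq> span_of K V S"
  by (auto simp: span_of_def)

lemma (in module) submodule_span_of:
  assumes "S \<subseteq> carrier M"
  shows "submodule (span_of R M S) R M"
proof (rule submoduleI')
  show "span_of R M S \<subseteq> carrier M"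
    by (rule span_of_least[OF carrier_is_submodule assms])
  show "\<zero>\<^bsub>M\<^esub> \<in> span_of R M S" by (auto simp: span_of_def intro: submodule_zero)
  show "x \<oplus>\<^bsub>M\<^esub> y \<in> span_of R M S" if "x \<in> span_of R M S" "y \<in> span_of R M S" for x y
    using that submoduleE(5) unfolding span_of_def by blast
  show "a \<odot>\<^bsub>M\<^esub> x \<in> span_of R M S" if "a \<in> carrier R" "x \<in> span_of R M S" for a x
    using that submoduleE(4) unfolding span_of_def by blast
qed

context
  fixes K V N
  assumes mod: "module K V" and sub: "submodule N K V"
begin

interpretation V: module K V by (rule mod)

interpretation N: abelian_subgroup N V
  by (rule abelian_subgroupI3[OF additive_subgroupI])
    (use submodule.axioms(1)[OF sub] V.M.abelian_group_axioms in auto)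

lemma quotient_space_carrier:
  "carrier (quotient_space V N) = (\<lambda>x. N +>\<^bsub>V\<^esub> x) ` carrier V"
  by (auto simp: quotient_space_def A_RCOSETS_def')

lemma quotient_space_add:
  "x \<in> carrier V \<Longrightarrow> y \<in> carrier V \<Longrightarrow>
    (N +>\<^bsub>V\<^esub> x) \<oplus>\<^bsub>quotient_space V N\<^esub> (N +>\<^bsub>V\<^esub> y) = N +>\<^bsub>V\<^esub> (x \<oplus>\<^bsub>V\<^esub> y)"
  by (simp add: quotient_space_def N.a_rcos_sum)

lemma quotient_space_zero: "\<zero>\<^bsub>quotient_space V N\<^esub> = N +>\<^bsub>V\<^esub> \<zero>\<^bsub>V\<^esub>"
  by (simp add: quotient_space_def N.a_rcos_const[OF N.zero_closed])

lemma coset_eq_iff: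
  assumes "x \<in> carrier V" "y \<in> carrier V"
  shows "N +>\<^bsub>V\<^esub> x = N +>\<^bsub>V\<^esub> y \<longleftrightarrow> x \<ominus>\<^bsub>V\<^esub> y \<in> N"
proof -
  have "x \<in> N +>\<^bsub>V\<^esub> y \<longleftrightarrow> x \<ominus>\<^bsub>V\<^esub> y \<in> N"
    unfolding a_minus_def by (rule N.a_rcos_module[OF assms(2,1)])
  moreover have "N +>\<^bsub>V\<^esub> x = N +>\<^bsub>V\<^esub> y \<longleftrightarrow> x \<in> N +>\<^bsub>V\<^esub> y"
    using N.a_repr_independence'[of x y] N.a_repr_independenceD[of x y] assms by metis
  ultimately show ?thesis by simp
qed

lemma quotient_space_smult:
  assumes a: "a \<in> carrier K" and x: "x \<in> carrier V"
  shows "a \<odot>\<^bsub>quotient_space V N\<^esub> (N +>\<^bsub>V\<^esub> x) = N +>\<^bsub>V\<^esub> (a \<odot>\<^bsub>V\<^esub> x)"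
proof -
  have Nc: "n \<in> carrier V" if "n \<in> N" for n using that N.a_subset by auto
  have "N <+>\<^bsub>V\<^esub> ((\<lambda>x. a \<odot>\<^bsub>V\<^esub> x) ` (N +>\<^bsub>V\<^esub> x)) = N +>\<^bsub>V\<^esub> (a \<odot>\<^bsub>V\<^esub> x)"
  proof (rule equalityI; rule subsetI)
    fix y assume "y \<in> N <+>\<^bsub>V\<^esub> ((\<lambda>x. a \<odot>\<^bsub>V\<^esub> x) ` (N +>\<^bsub>V\<^esub> x))"
    then obtain n m where nm: "n \<in> N" "m \<in> N" "y = n \<oplus>\<^bsub>V\<^esub> a \<odot>\<^bsub>V\<^esub> (m \<oplus>\<^bsub>V\<^esub> x)"
      by (auto simp: set_add_def' a_r_coset_def')
    then have "y = (n \<oplus>\<^bsub>V\<^esub> a \<odot>\<^bsub>V\<^esub> m) \<oplus>\<^bsub>V\<^esub> a \<odot>\<^bsub>V\<^esub> x"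
      using a x Nc by (simp add: V.smult_r_distr V.M.a_assoc)
    moreover have "n \<oplus>\<^bsub>V\<^esub> a \<odot>\<^bsub>V\<^esub> m \<in> N"
      using nm V.submoduleE(4,5)[OF sub] a by auto
    ultimately show "y \<in> N +>\<^bsub>V\<^esub> (a \<odot>\<^bsub>V\<^esub> x)" by (auto simp: a_r_coset_def')
  next
    fix y assume "y \<in> N +>\<^bsub>V\<^esub> (a \<odot>\<^bsub>V\<^esub> x)"
    then obtain n where n: "n \<in> N" "y = n \<oplus>\<^bsub>V\<^esub> a \<odot>\<^bsub>V\<^esub> x" by (auto simp: a_r_coset_def')
    then show "y \<in> N <+>\<^bsub>V\<^esub> ((\<lambda>x. a \<odot>\<^bsub>V\<^esub> x) ` (N +>\<^bsub>V\<^esub> x))"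
      using N.a_rcos_self[OF x] by (auto simp: set_add_def')
  qed
  then show ?thesis by (simp add: quotient_space_def)
qed

lemma quotient_space_module: "module K (quotient_space V N)"
proof (rule moduleI[OF V.R.cring_axioms abelian_groupI])
  have "\<exists>y \<in> carrier V. (N +>\<^bsub>V\<^esub> y) \<oplus>\<^bsub>quotient_space V N\<^esub> (N +>\<^bsub>V\<^esub> x) = \<zero>\<^bsub>quotient_space V N\<^esub>"
    if "x \<in> carrier V" for x
    by (rule bexI[of _ "\<ominus>\<^bsub>V\<^esub> x"])
      (use that in \<open>auto simp: quotient_space_add quotient_space_zero V.M.l_neg\<close>)
  then show "\<exists>y \<in> carrier (quotient_space V N). y \<oplus>\<^bsub>quotient_space V N\<^esub> x = \<zero>\<^bsub>quotient_space V N\<^esub>"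
    if "x \<in> carrier (quotient_space V N)" for x
    using that by (auto simp: quotient_space_carrier)
  let ?Q = "quotient_space V N"
  note simps = quotient_space_carrier quotient_space_add quotient_space_zero quotient_space_smult
  show "x \<oplus>\<^bsub>?Q\<^esub> y \<in> carrier ?Q" if "x \<in> carrier ?Q" "y \<in> carrier ?Q" for x y
    using that by (auto simp: simps)
  show "x \<oplus>\<^bsub>?Q\<^esub> y = y \<oplus>\<^bsub>?Q\<^esub> x" if "x \<in> carrier ?Q" "y \<in> carrier ?Q" for x y
    using that by (auto simp: simps V.M.a_comm)
  show "x \<oplus>\<^bsub>?Q\<^esub> y \<oplus>\<^bsub>?Q\<^esub> z = x \<oplus>\<^bsub>?Q\<^esub> (y \<oplus>\<^bsub>?Q\<^esub> z)"
    if "x \<in> carrier ?Q" "y \<in> carrier ?Q" "z \<in> carrier ?Q" for x y z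
    using that by (auto simp: simps V.M.a_assoc)
  show "\<zero>\<^bsub>?Q\<^esub> \<in> carrier ?Q" by (auto simp: simps)
  show "\<zero>\<^bsub>?Q\<^esub> \<oplus>\<^bsub>?Q\<^esub> x = x" if "x \<in> carrier ?Q" for x
    using that by (auto simp: simps)
  show "a \<odot>\<^bsub>?Q\<^esub> x \<in> carrier ?Q" if "a \<in> carrier K" "x \<in> carrier ?Q" for a x
    using that by (auto simp: simps)
  show "(a \<oplus>\<^bsub>K\<^esub> b) \<odot>\<^bsub>?Q\<^esub> x = a \<odot>\<^bsub>?Q\<^esub> x \<oplus>\<^bsub>?Q\<^esub> b \<odot>\<^bsub>?Q\<^esub> x"
    if "a \<in> carrier K" "b \<in> carrier K" "x \<in> carrier ?Q" for a b x
    using that by (auto simp: simps V.smult_l_distr)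
  show "a \<odot>\<^bsub>?Q\<^esub> (x \<oplus>\<^bsub>?Q\<^esub> y) = a \<odot>\<^bsub>?Q\<^esub> x \<oplus>\<^bsub>?Q\<^esub> a \<odot>\<^bsub>?Q\<^esub> y"
    if "a \<in> carrier K" "x \<in> carrier ?Q" "y \<in> carrier ?Q" for a x y
    using that by (auto simp: simps V.smult_r_distr)
  show "(a \<otimes>\<^bsub>K\<^esub> b) \<odot>\<^bsub>?Q\<^esub> x = a \<odot>\<^bsub>?Q\<^esub> (b \<odot>\<^bsub>?Q\<^esub> x)"
    if "a \<in> carrier K" "b \<in> carrier K" "x \<in> carrier ?Q" for a b x
    using that by (auto simp: simps V.smult_assoc1)
  show "\<one>\<^bsub>K\<^esub> \<odot>\<^bsub>?Q\<^esub> x = x" if "x \<in> carrier ?Q" for x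
    using that by (auto simp: simps)
qed

lemma linear_map_coset: "linear_map K V (quotient_space V N) (\<lambda>x. N +>\<^bsub>V\<^esub> x)"
  by (rule linear_mapI) (auto simp: quotient_space_carrier quotient_space_add quotient_space_smult)

end

lemma free_gen_closed:
  assumes "cring K" "s \<in> S"
  shows "free_gen K s \<in> carrier (free_space K S)"
proof -
  interpret K: cring K by fact
  have "{t. free_gen K s t \<noteq> \<zero>\<^bsub>K\<^esub>} \<subseteq> {s}" by (auto simp: free_gen_def)
  then show ?thesis using assms(2) by (auto simp: free_gen_def intro: finite_subset)
qed

lemma free_space_induct:
  assumes K: "cring K" and Z: "submodule Z K (free_space K S)"
    and gen: "\<And>s. s \<in> S \<Longrightarrow> free_gen K s \<in> Z"
    and p: "p \<in> carrier (free_space K S)"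
  shows "p \<in> Z"
proof -
  interpret K: cring K by fact
  interpret F: module K "free_space K S" by (rule free_space_module[OF K])
  \<comment> \<open>Inducting over a finite superset \<open>A\<close> of the support lets the step
    clear the coefficient at \<open>s\<close> without knowing whether it was zero.\<close>
  have "finite A \<Longrightarrow> p \<in> carrier (free_space K S) \<Longrightarrow> {s. p s \<noteq> \<zero>\<^bsub>K\<^esub>} \<subseteq> A \<Longrightarrow> p \<in> Z" for A
  proof (induction A arbitrary: p rule: finite_induct)
    case empty
    then have "p = \<zero>\<^bsub>free_space K S\<^esub>" by auto
    then show ?case using F.submodule_zero[OF Z] by simp
  next
    case (insert s A)
    show ?case
    proof (cases "s \<in> S")
      case True
      define q where "q = p(s := \<zero>\<^bsub>K\<^esub>)"
      have "{t. q t \<noteq> \<zero>\<^bsub>K\<^esub>} \<subseteq> {t. p t \<noteq> \<zero>\<^bsub>K\<^esub>}" by (auto simp: q_def)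
      then have "q \<in> carrier (free_space K S)"
        using insert.prems(1) by (auto simp: q_def image_subset_iff intro: finite_subset)
      then have q: "q \<in> Z" using insert.prems(2) by (intro insert.IH) (auto simp: q_def)
      have ps: "p s \<in> carrier K" "\<And>t. p t \<in> carrier K" using insert.prems(1) by auto
      have "p s \<odot>\<^bsub>free_space K S\<^esub> free_gen K s \<in> Z"
        using F.submoduleE(4)[OF Z ps(1) gen[OF True]] .
      then have "q \<oplus>\<^bsub>free_space K S\<^esub> (p s \<odot>\<^bsub>free_space K S\<^esub> free_gen K s) \<in> Z"
        using F.submoduleE(5)[OF Z] q by blast
      moreover have "q \<oplus>\<^bsub>free_space K S\<^esub> (p s \<odot>\<^bsub>free_space K S\<^esub> free_gen K s) = p"
        using ps by (auto simp: q_def free_gen_def)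
      ultimately show ?thesis by simp
    next
      case False
      then have "p s = \<zero>\<^bsub>K\<^esub>" using insert.prems(1) by auto
      then show ?thesis using insert.prems by (intro insert.IH) auto
    qed
  qed
  from this[of "{s. p s \<noteq> \<zero>\<^bsub>K\<^esub>}"] p show ?thesis by auto
qed

definition free_ext ::
  "('k, 'u, 'm) module_scheme \<Rightarrow> 'k \<Rightarrow> ('s \<Rightarrow> 'u) \<Rightarrow> ('s \<Rightarrow> 'k) \<Rightarrow> 'u"
  where "free_ext U z f p = (\<Oplus>\<^bsub>U\<^esub>s \<in> {s. p s \<noteq> z}. p s \<odot>\<^bsub>U\<^esub> f s)"

context
  fixes K U S f
  assumes U: "module K U" and f: "\<And>s. s \<in> S \<Longrightarrow> f s \<in> carrier U"
begin

interpretation U: module K U by (rule U)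

text \<open>\<open>free_ext\<close> sums over the support, which changes under addition; any finite
  superset of it inside \<open>S\<close> can serve as a common index set.\<close>

lemma free_ext_eq:
  assumes p: "p \<in> carrier (free_space K S)" and A: "finite A" "{s. p s \<noteq> \<zero>\<^bsub>K\<^esub>} \<subseteq> A" "A \<subseteq> S"
  shows "free_ext U \<zero>\<^bsub>K\<^esub> f p = (\<Oplus>\<^bsub>U\<^esub>s \<in> A. p s \<odot>\<^bsub>U\<^esub> f s)"
  unfolding free_ext_def
  by (rule U.M.add.finprod_mono_neutral_cong_left) (use assms f in \<open>auto simp: image_subset_iff\<close>)

lemma linear_map_free_ext: "linear_map K (free_space K S) U (free_ext U \<zero>\<^bsub>K\<^esub> f)"
proof (rule linear_mapI)
  interpret F: module K "free_space K S" by (rule free_space_module[OF U.R.cring_axioms])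
  have S: "{s. p s \<noteq> \<zero>\<^bsub>K\<^esub>} \<subseteq> S" "finite {s. p s \<noteq> \<zero>\<^bsub>K\<^esub>}" "\<And>s. p s \<in> carrier K"
    if "p \<in> carrier (free_space K S)" for p
    using that by auto
  fix p assume p: "p \<in> carrier (free_space K S)"
  show "free_ext U \<zero>\<^bsub>K\<^esub> f p \<in> carrier U"
    unfolding free_ext_def using S[OF p] f by (intro U.M.finsum_closed) auto
  {
    fix q assume q: "q \<in> carrier (free_space K S)"
    let ?A = "{s. p s \<noteq> \<zero>\<^bsub>K\<^esub>} \<union> {s. q s \<noteq> \<zero>\<^bsub>K\<^esub>}"
    have A: "finite ?A" "?A \<subseteq> S" using S(1,2)[OF p] S(1,2)[OF q] by auto
    have "free_ext U \<zero>\<^bsub>K\<^esub> f (p \<oplus>\<^bsub>free_space K S\<^esub> q)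
        = (\<Oplus>\<^bsub>U\<^esub>s \<in> ?A. (p \<oplus>\<^bsub>free_space K S\<^esub> q) s \<odot>\<^bsub>U\<^esub> f s)"
      by (rule free_ext_eq[OF F.M.a_closed[OF p q] A(1) _ A(2)]) auto
    also have "\<dots> = (\<Oplus>\<^bsub>U\<^esub>s \<in> ?A. p s \<odot>\<^bsub>U\<^esub> f s \<oplus>\<^bsub>U\<^esub> q s \<odot>\<^bsub>U\<^esub> f s)"
      using A S(3)[OF p] S(3)[OF q] f by (intro U.M.finsum_cong) (auto simp: U.smult_l_distr simp_implies_def)
    also have "\<dots> = (\<Oplus>\<^bsub>U\<^esub>s \<in> ?A. p s \<odot>\<^bsub>U\<^esub> f s) \<oplus>\<^bsub>U\<^esub> (\<Oplus>\<^bsub>U\<^esub>s \<in> ?A. q s \<odot>\<^bsub>U\<^esub> f s)"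
      using A S(3)[OF p] S(3)[OF q] f by (intro U.M.finsum_addf) auto
    also have "\<dots> = free_ext U \<zero>\<^bsub>K\<^esub> f p \<oplus>\<^bsub>U\<^esub> free_ext U \<zero>\<^bsub>K\<^esub> f q"
      using free_ext_eq[OF p A(1) _ A(2)] free_ext_eq[OF q A(1) _ A(2)] by simp
    finally show "free_ext U \<zero>\<^bsub>K\<^esub> f (p \<oplus>\<^bsub>free_space K S\<^esub> q)
      = free_ext U \<zero>\<^bsub>K\<^esub> f p \<oplus>\<^bsub>U\<^esub> free_ext U \<zero>\<^bsub>K\<^esub> f q" .
  }
  fix a assume a: "a \<in> carrier K"
  let ?A = "{s. p s \<noteq> \<zero>\<^bsub>K\<^esub>}"
  have "free_ext U \<zero>\<^bsub>K\<^esub> f (a \<odot>\<^bsub>free_space K S\<^esub> p)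
      = (\<Oplus>\<^bsub>U\<^esub>s \<in> ?A. (a \<odot>\<^bsub>free_space K S\<^esub> p) s \<odot>\<^bsub>U\<^esub> f s)"
    by (rule free_ext_eq[OF F.smult_closed[OF a p] S(2)[OF p] _ S(1)[OF p]]) (use a in auto)
  also have "\<dots> = (\<Oplus>\<^bsub>U\<^esub>s \<in> ?A. a \<odot>\<^bsub>U\<^esub> (p s \<odot>\<^bsub>U\<^esub> f s))"
    using S[OF p] a f by (intro U.M.finsum_cong) (auto simp: U.smult_assoc1 simp_implies_def)
  also have "\<dots> = a \<odot>\<^bsub>U\<^esub> free_ext U \<zero>\<^bsub>K\<^esub> f p"
    unfolding free_ext_def
    using S[OF p] a f by (intro U.finsum_smult_ldistr[symmetric]) auto
  finally show "free_ext U \<zero>\<^bsub>K\<^esub> f (a \<odot>\<^bsub>free_space K S\<^esub> p) = a \<odot>\<^bsub>U\<^esub> free_ext U \<zero>\<^bsub>K\<^esub> f p" .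
qed

lemma free_ext_gen:
  assumes "s \<in> S"
  shows "free_ext U \<zero>\<^bsub>K\<^esub> f (free_gen K s) = f s"
proof -
  have "free_ext U \<zero>\<^bsub>K\<^esub> f (free_gen K s) = (\<Oplus>\<^bsub>U\<^esub>t \<in> {s}. free_gen K s t \<odot>\<^bsub>U\<^esub> f t)"
    by (rule free_ext_eq[OF free_gen_closed[OF U.R.cring_axioms assms]])
      (use assms in \<open>auto simp: free_gen_def\<close>)
  also have "\<dots> = f s" using f[OF assms] by (simp add: free_gen_def)
  finally show ?thesis .
qed

end

section \<open>The universal property of the tensor product\<close>

lemma (in abelian_group) minus_eq_zero_iff:
  assumes "x \<in> carrier G" "y \<in> carrier G"
  shows "x \<ominus> y = \<zero> \<longleftrightarrow> x = y"
  using add.inv_solve_right[of \<zero> x y] assms by (auto simp: a_minus_def)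

context
  fixes K V W
  assumes V: "module K V" and W: "module K W"
begin

interpretation V: module K V by (rule V)

interpretation W: module K W by (rule W)

interpretation F: module K "free_space K (carrier V \<times> carrier W)"
  by (rule free_space_module[OF V.R.cring_axioms])

lemma tensor_rels_closed: "tensor_rels K V W \<subseteq> carrier (free_space K (carrier V \<times> carrier W))"
  unfolding tensor_rels_def Let_def
  by (intro Un_least subsetI; elim CollectE exE conjE; simp only:)
    (intro F.minus_closed F.M.a_closed F.smult_closed free_gen_closed V.R.cring_axioms; simp)+

lemma submodule_tensor_null:
  "submodule (tensor_null K V W) K (free_space K (carrier V \<times> carrier W))"
  unfolding tensor_null_def by (rule F.submodule_span_of[OF tensor_rels_closed])

lemma tensor_module: "module K (tensor K V W)"
  unfolding tensor_def by (rule quotient_space_module[OF F.module_axioms submodule_tensor_null])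

lemma tens_closed:
  "v \<in> carrier V \<Longrightarrow> w \<in> carrier W \<Longrightarrow> tens K V W v w \<in> carrier (tensor K V W)"
  unfolding tens_def tensor_def
  by (rule linear_mapD(1)[OF linear_map_coset[OF F.module_axioms submodule_tensor_null]])
    (auto intro!: free_gen_closed V.R.cring_axioms simp del: free_space_simps)

lemma tens_bilinear: "bilinear K V W (tensor K V W) (tens K V W)"
proof -
  let ?F = "free_space K (carrier V \<times> carrier W)" and ?N = "tensor_null K V W"
  let ?e = "\<lambda>v w. free_gen K (v, w)"
  note cl = linear_mapD[OF linear_map_coset[OF F.module_axioms submodule_tensor_null], folded tensor_def]
  have e: "?e v w \<in> carrier ?F" if "v \<in> carrier V" "w \<in> carrier W" for v w
    using that by (intro free_gen_closed V.R.cring_axioms) simp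
  have eq: "?N +>\<^bsub>?F\<^esub> p = ?N +>\<^bsub>?F\<^esub> q"
    if "p \<ominus>\<^bsub>?F\<^esub> q \<in> tensor_rels K V W" "p \<in> carrier ?F" "q \<in> carrier ?F" for p q
    unfolding coset_eq_iff[OF F.module_axioms submodule_tensor_null that(2,3)]
    unfolding tensor_null_def by (rule subsetD[OF span_of_superset that(1)])
  show ?thesis
  proof (intro bilinearI linear_mapI tens_closed)
    show "tens K V W (v \<oplus>\<^bsub>V\<^esub> v') w = tens K V W v w \<oplus>\<^bsub>tensor K V W\<^esub> tens K V W v' w"
      if that: "w \<in> carrier W" "v \<in> carrier V" "v' \<in> carrier V" for v v' w
    proof -
      have "?e (v \<oplus>\<^bsub>V\<^esub> v') w \<ominus>\<^bsub>?F\<^esub> (?e v w \<oplus>\<^bsub>?F\<^esub> ?e v' w) \<in> tensor_rels K V W"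
        unfolding tensor_rels_def Let_def using that by blast
      from eq[OF this e F.M.a_closed[OF e e]] show ?thesis
        using that cl(2)[OF e e] by (simp add: tens_def del: free_space_simps)
    qed
    show "tens K V W v (w \<oplus>\<^bsub>W\<^esub> w') = tens K V W v w \<oplus>\<^bsub>tensor K V W\<^esub> tens K V W v w'"
      if that: "v \<in> carrier V" "w \<in> carrier W" "w' \<in> carrier W" for v w' w
    proof -
      have "?e v (w \<oplus>\<^bsub>W\<^esub> w') \<ominus>\<^bsub>?F\<^esub> (?e v w \<oplus>\<^bsub>?F\<^esub> ?e v w') \<in> tensor_rels K V W"
        unfolding tensor_rels_def Let_def using that by blast
      from eq[OF this e F.M.a_closed[OF e e]] show ?thesis
        using that cl(2)[OF e e] by (simp add: tens_def del: free_space_simps)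
    qed
    show "tens K V W (a \<odot>\<^bsub>V\<^esub> v) w = a \<odot>\<^bsub>tensor K V W\<^esub> tens K V W v w"
      if that: "w \<in> carrier W" "a \<in> carrier K" "v \<in> carrier V" for a v w
    proof -
      have "?e (a \<odot>\<^bsub>V\<^esub> v) w \<ominus>\<^bsub>?F\<^esub> (a \<odot>\<^bsub>?F\<^esub> ?e v w) \<in> tensor_rels K V W"
        unfolding tensor_rels_def Let_def using that by blast
      from eq[OF this e F.smult_closed[OF _ e]] show ?thesis
        using that cl(3)[OF _ e] by (simp add: tens_def del: free_space_simps)
    qed
    show "tens K V W v (a \<odot>\<^bsub>W\<^esub> w) = a \<odot>\<^bsub>tensor K V W\<^esub> tens K V W v w"
      if that: "v \<in> carrier V" "a \<in> carrier K" "w \<in> carrier W" for a v w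
    proof -
      have "?e v (a \<odot>\<^bsub>W\<^esub> w) \<ominus>\<^bsub>?F\<^esub> (a \<odot>\<^bsub>?F\<^esub> ?e v w) \<in> tensor_rels K V W"
        unfolding tensor_rels_def Let_def using that by blast
      from eq[OF this e F.smult_closed[OF _ e]] show ?thesis
        using that cl(3)[OF _ e] by (simp add: tens_def del: free_space_simps)
    qed
  qed
qed

text \<open>The preimage of \<open>Z\<close> under the quotient map is a submodule of the free space
  that contains the generators.\<close>

lemma tensor_induct:
  assumes Z: "submodule Z K (tensor K V W)"
    and gen: "\<And>v w. v \<in> carrier V \<Longrightarrow> w \<in> carrier W \<Longrightarrow> tens K V W v w \<in> Z"
    and t: "t \<in> carrier (tensor K V W)"
  shows "t \<in> Z"
proof -
  let ?F = "free_space K (carrier V \<times> carrier W)" and ?N = "tensor_null K V W"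
  have "submodule {p \<in> carrier ?F. ?N +>\<^bsub>?F\<^esub> p \<in> Z} K ?F"
    by (rule linear_map_vimage[OF F.module_axioms tensor_module _ Z])
      (unfold tensor_def, rule linear_map_coset[OF F.module_axioms submodule_tensor_null])
  then have "p \<in> {p \<in> carrier ?F. ?N +>\<^bsub>?F\<^esub> p \<in> Z}" if "p \<in> carrier ?F" for p
    by (rule free_space_induct[OF V.R.cring_axioms _ _ that])
      (use gen in \<open>auto simp: tens_def simp del: free_space_simps intro!: free_gen_closed V.R.cring_axioms\<close>)
  then show ?thesis
    using t quotient_space_carrier[OF F.module_axioms submodule_tensor_null] by (auto simp: tensor_def)
qed

text \<open>A scalar can be absorbed into the first factor of a pure tensor, so sums of pure tensors
  without coefficients already form a submodule.\<close>

lemma tensor_rep: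
  assumes "t \<in> carrier (tensor K V W)"
  shows "\<exists>ps. set ps \<subseteq> carrier V \<times> carrier W \<and> t = lsum (tensor K V W) (\<lambda>(v, w). tens K V W v w) ps"
proof -
  interpret T: module K "tensor K V W" by (rule tensor_module)
  let ?P = "\<lambda>t ps. set ps \<subseteq> carrier V \<times> carrier W \<and> t = lsum (tensor K V W) (\<lambda>(v, w). tens K V W v w) ps"
  let ?Z = "{t. \<exists>ps. ?P t ps}"
  have cl: "lsum (tensor K V W) (\<lambda>(v, w). tens K V W v w) ps \<in> carrier (tensor K V W)"
    if "set ps \<subseteq> carrier V \<times> carrier W" for ps
    using that by (intro T.lsum_closed) (auto intro: tens_closed)
  have "submodule ?Z K (tensor K V W)"
  proof (rule T.submoduleI')
    show "?Z \<subseteq> carrier (tensor K V W)" using cl by auto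
    show "\<zero>\<^bsub>tensor K V W\<^esub> \<in> ?Z" by (auto intro!: exI[of _ "[]"])
    show "x \<oplus>\<^bsub>tensor K V W\<^esub> y \<in> ?Z" if "x \<in> ?Z" "y \<in> ?Z" for x y
    proof -
      from that obtain ps qs where "?P x ps" "?P y qs" by auto
      then have "?P (x \<oplus>\<^bsub>tensor K V W\<^esub> y) (ps @ qs)"
        by (subst T.lsum_append) (auto intro: tens_closed)
      then show ?thesis by blast
    qed
    show "a \<odot>\<^bsub>tensor K V W\<^esub> x \<in> ?Z" if "a \<in> carrier K" "x \<in> ?Z" for a x
    proof -
      from that obtain ps where ps: "?P x ps" by auto
      have "a \<odot>\<^bsub>tensor K V W\<^esub> x
          = lsum (tensor K V W) (\<lambda>p. a \<odot>\<^bsub>tensor K V W\<^esub> (case p of (v, w) \<Rightarrow> tens K V W v w)) ps"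
        using ps that
        by (simp, intro lsum_linear[OF T.module_axioms T.module_axioms
            linear_map_smult[OF T.module_axioms linear_map_id that(1)]]) (auto intro: tens_closed)
      also have "\<dots> = lsum (tensor K V W) (\<lambda>(v, w). tens K V W v w) (map (\<lambda>(v, w). (a \<odot>\<^bsub>V\<^esub> v, w)) ps)"
        unfolding lsum_map using ps that(1)
        by (intro lsum_cong) (auto simp: linear_mapD(3)[OF bilinearD(1)[OF tens_bilinear]])
      finally have "?P (a \<odot>\<^bsub>tensor K V W\<^esub> x) (map (\<lambda>(v, w). (a \<odot>\<^bsub>V\<^esub> v, w)) ps)"
        using ps that(1) by auto
      then show ?thesis by blast
    qed
  qed
  moreover have "tens K V W v w \<in> ?Z" if "v \<in> carrier V" "w \<in> carrier W" for v w
    using that tens_closed[OF that] by (auto intro!: exI[of _ "[(v, w)]"])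
  ultimately show ?thesis using tensor_induct[OF _ _ assms] by blast
qed

lemma tensor_map_eqI:
  assumes U: "module K U" and h: "linear_map K (tensor K V W) U h" and g: "linear_map K (tensor K V W) U g"
    and eq: "\<And>v w. v \<in> carrier V \<Longrightarrow> w \<in> carrier W \<Longrightarrow> h (tens K V W v w) = g (tens K V W v w)"
    and t: "t \<in> carrier (tensor K V W)"
  shows "h t = g t"
  using tensor_induct[OF linear_map_equalizer[OF tensor_module U h g] _ t] eq tens_closed by auto

text \<open>The linear extension of \<open>b\<close> to the free space kills the relations, hence
  their span \<open>tensor_null\<close>, and so is constant on cosets.\<close>

lemma tensor_lift_exists:
  assumes U: "module K U" and b: "bilinear K V W U b"
  shows "\<exists>h. linear_map K (tensor K V W) U h \<and>
    (\<forall>v \<in> carrier V. \<forall>w \<in> carrier W. h (tens K V W v w) = b v w)"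
proof -
  interpret U: module K U by (rule U)
  let ?F = "free_space K (carrier V \<times> carrier W)" and ?N = "tensor_null K V W"
  let ?g = "free_ext U \<zero>\<^bsub>K\<^esub> (\<lambda>(v, w). b v w)"
  let ?e = "\<lambda>v w. free_gen K (v, w)"
  have bcl: "(\<lambda>(v, w). b v w) s \<in> carrier U" if "s \<in> carrier V \<times> carrier W" for s
    using that bilinearD(3)[OF b] by auto
  have g: "linear_map K ?F U ?g"
    by (rule linear_map_free_ext[OF U]) (rule bcl)
  have gen: "?g (?e v w) = b v w" if "v \<in> carrier V" "w \<in> carrier W" for v w
    by (subst free_ext_gen[OF U bcl, where S = "carrier V \<times> carrier W"]) (use that in auto)
  have e: "?e v w \<in> carrier ?F" if "v \<in> carrier V" "w \<in> carrier W" for v w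
    using that by (intro free_gen_closed V.R.cring_axioms) simp
  have diff: "?g (p \<ominus>\<^bsub>?F\<^esub> q) = ?g p \<ominus>\<^bsub>U\<^esub> ?g q" if "p \<in> carrier ?F" "q \<in> carrier ?F" for p q
    unfolding a_minus_def
    using that linear_mapD(2)[OF g that(1), where y = "\<ominus>\<^bsub>?F\<^esub> q"]
    by (simp add: linear_map_minus[OF F.module_axioms U g] del: free_space_simps)
  have zero: "?g (p \<ominus>\<^bsub>?F\<^esub> q) = \<zero>\<^bsub>U\<^esub>"
    if "?g p = ?g q" "p \<in> carrier ?F" "q \<in> carrier ?F" for p q
    using linear_mapD(1)[OF g that(3)]
    by (simp only: diff[OF that(2,3)] that(1)) (simp only: a_minus_def U.M.r_neg)
  note gs = linear_mapD(2,3)[OF g] gen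
  have "tensor_rels K V W \<subseteq> {p \<in> carrier ?F. ?g p = \<zero>\<^bsub>U\<^esub>}"
  proof
    fix r assume r: "r \<in> tensor_rels K V W"
    then have "?g r = \<zero>\<^bsub>U\<^esub>"
      unfolding tensor_rels_def Let_def
      by (elim UnE CollectE exE conjE; simp only:)
        (rule zero; simp add: gs e linear_mapD(2,3)[OF bilinearD(1)[OF b]]
          linear_mapD(2,3)[OF bilinearD(2)[OF b]] F.M.a_closed F.smult_closed del: free_space_simps)+
    then show "r \<in> {p \<in> carrier ?F. ?g p = \<zero>\<^bsub>U\<^esub>}" using r tensor_rels_closed by blast
  qed
  then have null: "?N \<subseteq> {p \<in> carrier ?F. ?g p = \<zero>\<^bsub>U\<^esub>}"
    unfolding tensor_null_def
    by (rule span_of_least[OF linear_map_kernel[OF F.module_axioms U g]])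
  \<comment> \<open>The value is taken at an arbitrary representative of the coset; the next claim
    shows that the choice does not matter.\<close>
  define h where "h A = ?g (SOME p. p \<in> carrier ?F \<and> A = ?N +>\<^bsub>?F\<^esub> p)" for A
  have h: "h (?N +>\<^bsub>?F\<^esub> p) = ?g p" if p: "p \<in> carrier ?F" for p
  proof -
    define q where "q = (SOME q. q \<in> carrier ?F \<and> ?N +>\<^bsub>?F\<^esub> p = ?N +>\<^bsub>?F\<^esub> q)"
    have q: "q \<in> carrier ?F \<and> ?N +>\<^bsub>?F\<^esub> p = ?N +>\<^bsub>?F\<^esub> q"
      unfolding q_def by (rule someI[of _ p]) (use p in simp)
    then have "p \<ominus>\<^bsub>?F\<^esub> q \<in> ?N"
      using coset_eq_iff[OF F.module_axioms submodule_tensor_null p] by blast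
    then have "?g p \<ominus>\<^bsub>U\<^esub> ?g q = \<zero>\<^bsub>U\<^esub>" using null diff p q by auto
    then have "?g p = ?g q"
      using linear_mapD(1)[OF g] p q by (simp add: U.M.minus_eq_zero_iff del: free_space_simps)
    then show ?thesis by (simp add: h_def q_def)
  qed
  note cl = linear_mapD(2,3)[OF linear_map_coset[OF F.module_axioms submodule_tensor_null], folded tensor_def, symmetric]
  have car: "carrier (tensor K V W) = (\<lambda>p. ?N +>\<^bsub>?F\<^esub> p) ` carrier ?F"
    unfolding tensor_def by (rule quotient_space_carrier[OF F.module_axioms submodule_tensor_null])
  have "linear_map K (tensor K V W) U h"
    by (rule linear_mapI; (unfold car)?; elim imageE)
      (simp_all only: cl(1,2) h F.M.a_closed F.smult_closed linear_mapD[OF g])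
  moreover have "h (tens K V W v w) = b v w" if "v \<in> carrier V" "w \<in> carrier W" for v w
    using that by (simp add: tens_def h e gen del: free_space_simps)
  ultimately show ?thesis by blast
qed

lemma tensor_lift:
  assumes U: "module K U" and b: "bilinear K V W U b"
  shows tensor_lift_linear: "linear_map K (tensor K V W) U (tensor_lift K V W U b)"
    and tensor_lift_tens: "v \<in> carrier V \<Longrightarrow> w \<in> carrier W \<Longrightarrow>
      tensor_lift K V W U b (tens K V W v w) = b v w"
proof -
  let ?P = "\<lambda>h. h \<in> extensional (carrier (tensor K V W)) \<and> linear_map K (tensor K V W) U h \<and>
    (\<forall>v \<in> carrier V. \<forall>w \<in> carrier W. h (tens K V W v w) = b v w)"
  interpret T: module K "tensor K V W" by (rule tensor_module)
  obtain h where h: "linear_map K (tensor K V W) U h"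
    "\<forall>v \<in> carrier V. \<forall>w \<in> carrier W. h (tens K V W v w) = b v w"
    using tensor_lift_exists[OF assms] by blast
  \<comment> \<open>The values outside the carrier must be fixed, since otherwise the description in
    \<open>tensor_lift\<close> has no unique solution for \<open>THE\<close>.\<close>
  have "?P (restrict h (carrier (tensor K V W)))"
    using h by (auto simp: linear_map_def tens_closed Pi_iff)
  moreover have "h1 = h2" if "?P h1" "?P h2" for h1 h2
    by (rule extensionalityI[of _ "carrier (tensor K V W)"])
      (use that in \<open>auto intro: tensor_map_eqI[OF U]\<close>)
  ultimately have "\<exists>!h. ?P h" by - (rule ex1I, assumption, blast)
  then have "?P (tensor_lift K V W U b)"
    unfolding tensor_lift_def by (rule theI')
  then show "linear_map K (tensor K V W) U (tensor_lift K V W U b)"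
    and "v \<in> carrier V \<Longrightarrow> w \<in> carrier W \<Longrightarrow> tensor_lift K V W U b (tens K V W v w) = b v w"
    by blast+
qed

end

section \<open>Sums over representations of tensors\<close>

definition trep ::
  "('k, 'r) ring_scheme \<Rightarrow> ('k, 'v, 'm) module_scheme \<Rightarrow> ('k, 'w, 'n) module_scheme
    \<Rightarrow> ('v \<times> 'w \<Rightarrow> 'k) set \<Rightarrow> ('v \<times> 'w) list"
  where "trep K V W t = (SOME ps. set ps \<subseteq> carrier V \<times> carrier W \<and>
    t = lsum (tensor K V W) (\<lambda>(v, w). tens K V W v w) ps)"

text \<open>For bilinear \<open>b\<close> this is \<open>tensor_lift\<close>; working with a fixed representation of \<open>t\<close> as a sum
  of pure tensors makes congruence and interchange of sums available for arbitrary \<open>b\<close>.\<close>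

definition tsum ::
  "('k, 'r) ring_scheme \<Rightarrow> ('k, 'v, 'm) module_scheme \<Rightarrow> ('k, 'w, 'n) module_scheme
    \<Rightarrow> ('k, 'u, 'p) module_scheme \<Rightarrow> ('v \<Rightarrow> 'w \<Rightarrow> 'u) \<Rightarrow> ('v \<times> 'w \<Rightarrow> 'k) set \<Rightarrow> 'u"
  where "tsum K V W U b t = lsum U (\<lambda>p. b (fst p) (snd p)) (trep K V W t)"

lemma scalars_simps [simp]:
  "carrier (scalars K) = carrier K" "\<zero>\<^bsub>scalars K\<^esub> = \<zero>\<^bsub>K\<^esub>"
  "x \<oplus>\<^bsub>scalars K\<^esub> y = x \<oplus>\<^bsub>K\<^esub> y" "a \<odot>\<^bsub>scalars K\<^esub> x = a \<otimes>\<^bsub>K\<^esub> x"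
  by (auto simp: scalars_def)

lemma scalars_module:
  assumes "cring K"
  shows "module K (scalars K)"
proof -
  interpret K: cring K by fact
  show ?thesis
    by (rule moduleI[OF assms abelian_groupI])
      (auto simp: K.a_ac K.m_assoc K.l_distr K.r_distr intro: K.l_neg)
qed

lemma linear_map_smult_left:
  assumes "module K U" "linear_map K V (scalars K) f" "u \<in> carrier U"
  shows "linear_map K V U (\<lambda>x. f x \<odot>\<^bsub>U\<^esub> u)"
proof -
  interpret U: module K U by fact
  show ?thesis
    using linear_mapD[OF assms(2)] assms(3)
    by (intro linear_mapI) (auto simp: U.smult_l_distr U.smult_assoc1)
qed

lemma linear_map_lsum:
  assumes V: "module K V" and U: "module K U" and f: "\<And>p. p \<in> set ps \<Longrightarrow> linear_map K V U (\<lambda>x. f x p)"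
  shows "linear_map K V U (\<lambda>x. lsum U (f x) ps)"
proof -
  interpret V: module K V by fact
  interpret U: module K U by fact
  note fD = linear_mapD[OF f]
  show ?thesis
  proof (rule linear_mapI)
    show "lsum U (f x) ps \<in> carrier U" if "x \<in> carrier V" for x
      using that fD by (intro U.lsum_closed) auto
    show "lsum U (f (x \<oplus>\<^bsub>V\<^esub> y)) ps = lsum U (f x) ps \<oplus>\<^bsub>U\<^esub> lsum U (f y) ps"
      if "x \<in> carrier V" "y \<in> carrier V" for x y
      using that fD(1,2) by (subst U.lsum_add[symmetric]) (auto intro: lsum_cong)
    show "lsum U (f (a \<odot>\<^bsub>V\<^esub> x)) ps = a \<odot>\<^bsub>U\<^esub> lsum U (f x) ps"
      if "a \<in> carrier K" "x \<in> carrier V" for a x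
      using that fD(1,3)
      by (subst lsum_linear[OF U U linear_map_smult[OF U linear_map_id that(1)]]) (auto intro: lsum_cong)
  qed
qed

context
  fixes K V W
  assumes V: "module K V" and W: "module K W"
begin

interpretation V: module K V by (rule V)

interpretation W: module K W by (rule W)

lemma trep_closed:
  assumes "t \<in> carrier (tensor K V W)" "p \<in> set (trep K V W t)"
  shows "fst p \<in> carrier V" "snd p \<in> carrier W"
  using someI_ex[OF tensor_rep[OF V W assms(1)], folded trep_def] assms(2) by auto

lemma lsum_trep:
  assumes "t \<in> carrier (tensor K V W)"
  shows "lsum (tensor K V W) (\<lambda>p. tens K V W (fst p) (snd p)) (trep K V W t) = t"
  using someI_ex[OF tensor_rep[OF V W assms(1)], folded trep_def] by (simp add: case_prod_unfold)

lemma tsum_cong: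
  assumes "t \<in> carrier (tensor K V W)"
    and "\<And>v w. v \<in> carrier V \<Longrightarrow> w \<in> carrier W \<Longrightarrow> b v w = b' v w"
  shows "tsum K V W U b t = tsum K V W U b' t"
  unfolding tsum_def using trep_closed[OF assms(1)] assms(2) by (intro lsum_cong) auto

lemma tsum_submodule:
  assumes t: "t \<in> carrier (tensor K V W)" and "module K U" "submodule Z K U"
    and "\<And>v w. v \<in> carrier V \<Longrightarrow> w \<in> carrier W \<Longrightarrow> b v w \<in> Z"
  shows "tsum K V W U b t \<in> Z"
  unfolding tsum_def using trep_closed[OF t] assms(2-4) by (intro lsum_submodule) auto

lemma tsum_closed:
  assumes t: "t \<in> carrier (tensor K V W)" and "module K U"
    and "\<And>v w. v \<in> carrier V \<Longrightarrow> w \<in> carrier W \<Longrightarrow> b v w \<in> carrier U"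
  shows "tsum K V W U b t \<in> carrier U"
  by (rule tsum_submodule[OF t assms(2) module.carrier_is_submodule[OF assms(2)] assms(3)])

lemma tsum_zero:
  assumes "module K U"
  shows "tsum K V W U (\<lambda>v w. \<zero>\<^bsub>U\<^esub>) t = \<zero>\<^bsub>U\<^esub>"
  by (simp add: tsum_def module.lsum_zero[OF assms])

lemma linear_map_tsum_out:
  assumes t: "t \<in> carrier (tensor K V W)" and "module K U" "module K U'" "linear_map K U U' h"
    and "\<And>v w. v \<in> carrier V \<Longrightarrow> w \<in> carrier W \<Longrightarrow> b v w \<in> carrier U"
  shows "h (tsum K V W U b t) = tsum K V W U' (\<lambda>v w. h (b v w)) t"
  unfolding tsum_def using trep_closed[OF t] assms(5) by (intro lsum_linear[OF assms(2-4)]) auto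

lemma linear_map_tsum_body:
  assumes t: "t \<in> carrier (tensor K V W)" and "module K S" "module K U"
    and "\<And>v w. v \<in> carrier V \<Longrightarrow> w \<in> carrier W \<Longrightarrow> linear_map K S U (\<lambda>x. f x v w)"
  shows "linear_map K S U (\<lambda>x. tsum K V W U (f x) t)"
  unfolding tsum_def using trep_closed[OF t] assms(4) by (intro linear_map_lsum[OF assms(2,3)]) auto

lemma tsum_eq_lift:
  assumes t: "t \<in> carrier (tensor K V W)" and U: "module K U" and b: "bilinear K V W U b"
  shows "tsum K V W U b t = tensor_lift K V W U b t"
proof -
  have "tensor_lift K V W U b t
      = tensor_lift K V W U b (lsum (tensor K V W) (\<lambda>p. tens K V W (fst p) (snd p)) (trep K V W t))"
    by (simp add: lsum_trep[OF t])
  also have "\<dots> = lsum U (\<lambda>p. tensor_lift K V W U b (tens K V W (fst p) (snd p))) (trep K V W t)"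
    using trep_closed[OF t]
    by (intro lsum_linear[OF tensor_module[OF V W] U tensor_lift_linear[OF V W U b]])
      (auto intro: tens_closed[OF V W])
  also have "\<dots> = tsum K V W U b t"
    unfolding tsum_def using trep_closed[OF t]
    by (intro lsum_cong) (auto simp: tensor_lift_tens[OF V W U b])
  finally show ?thesis by simp
qed

text \<open>\<open>trep\<close> is an arbitrary choice and not additive in the tensor; linearity
  comes from agreement with \<open>tensor_lift\<close>, and this is where bilinearity
  enters.\<close>

lemma linear_map_tsum:
  assumes U: "module K U" and b: "bilinear K V W U b"
  shows "linear_map K (tensor K V W) U (tsum K V W U b)"
proof -
  interpret T: module K "tensor K V W" by (rule tensor_module[OF V W])
  show ?thesis
    using linear_mapD[OF tensor_lift_linear[OF V W U b]]
    by (intro linear_mapI) (simp_all add: tsum_eq_lift[OF _ U b])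
qed

lemma tsum_tens:
  assumes "module K U" "bilinear K V W U b" "v \<in> carrier V" "w \<in> carrier W"
  shows "tsum K V W U b (tens K V W v w) = b v w"
  using tsum_eq_lift[OF tens_closed[OF V W] assms(1,2)] tensor_lift_tens[OF V W assms(1,2)] assms(3,4)
  by simp

lemma tsum_tens_id:
  "t \<in> carrier (tensor K V W) \<Longrightarrow> tsum K V W (tensor K V W) (tens K V W) t = t"
  by (simp add: tsum_def lsum_trep)

end

lemma tsum_swap:
  assumes "module K V" "module K W" "module K V'" "module K W'" "module K U"
    and s: "s \<in> carrier (tensor K V W)" and t: "t \<in> carrier (tensor K V' W')"
    and cl: "\<And>v w v' w'. \<lbrakk>v \<in> carrier V; w \<in> carrier W; v' \<in> carrier V'; w' \<in> carrier W'\<rbrakk>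
      \<Longrightarrow> f v w v' w' \<in> carrier U"
  shows "tsum K V W U (\<lambda>v w. tsum K V' W' U (\<lambda>v' w'. f v w v' w') t) s
    = tsum K V' W' U (\<lambda>v' w'. tsum K V W U (\<lambda>v w. f v w v' w') s) t"
  unfolding tsum_def
  by (rule module.lsum_swap[OF assms(5)])
    (use trep_closed[OF assms(1,2) s] trep_closed[OF assms(3,4) t] cl in auto)

text \<open>The pivot step of Gaussian elimination on a sum of pure tensors.\<close>

lemma lsum_bilinear_pivot:
  assumes V: "module K V" and W: "module K W" and U: "module K U" and b: "bilinear K V W U b"
    and q: "v q \<in> carrier V" "h q \<in> carrier W"
    and ps: "\<And>p. p \<in> set ps \<Longrightarrow> v p \<in> carrier V \<and> h p \<in> carrier W \<and> k p \<in> carrier K"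
  shows "lsum U (\<lambda>p. b (v p) (h p)) (q # ps)
    = b (v q \<oplus>\<^bsub>V\<^esub> lsum V (\<lambda>p. k p \<odot>\<^bsub>V\<^esub> v p) ps) (h q)
      \<oplus>\<^bsub>U\<^esub> lsum U (\<lambda>p. b (v p) (h p \<oplus>\<^bsub>W\<^esub> (\<ominus>\<^bsub>K\<^esub> k p) \<odot>\<^bsub>W\<^esub> h q)) ps"
proof -
  interpret V: module K V by (rule V)
  interpret W: module K W by (rule W)
  interpret U: module K U by (rule U)
  let ?h = "\<lambda>p. h p \<oplus>\<^bsub>W\<^esub> (\<ominus>\<^bsub>K\<^esub> k p) \<odot>\<^bsub>W\<^esub> h q"
  note bl = linear_mapD[OF bilinearD(1)[OF b]] and br = linear_mapD[OF bilinearD(2)[OF b]]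
  have "lsum U (\<lambda>p. b (v p) (h p)) ps = lsum U (\<lambda>p. b (k p \<odot>\<^bsub>V\<^esub> v p) (h q) \<oplus>\<^bsub>U\<^esub> b (v p) (?h p)) ps"
  proof (rule lsum_cong)
    fix p assume "p \<in> set ps"
    then have p: "v p \<in> carrier V" "h p \<in> carrier W" "k p \<in> carrier K" using ps by auto
    let ?x = "k p \<odot>\<^bsub>U\<^esub> b (v p) (h q)"
    have x: "?x \<in> carrier U" "b (v p) (h p) \<in> carrier U" using p q br(1) by auto
    have "b (k p \<odot>\<^bsub>V\<^esub> v p) (h q) \<oplus>\<^bsub>U\<^esub> b (v p) (?h p)
        = ?x \<oplus>\<^bsub>U\<^esub> (b (v p) (h p) \<oplus>\<^bsub>U\<^esub> \<ominus>\<^bsub>U\<^esub> ?x)"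
      using p q br(1) by (simp add: bl(3) br(2,3) U.smult_l_minus)
    also have "\<dots> = b (v p) (h p) \<oplus>\<^bsub>U\<^esub> (?x \<oplus>\<^bsub>U\<^esub> \<ominus>\<^bsub>U\<^esub> ?x)"
      using x by (simp only: U.M.a_lcomm U.M.a_inv_closed)
    also have "\<dots> = b (v p) (h p)" using x by (simp add: U.M.r_neg)
    finally show "b (v p) (h p) = b (k p \<odot>\<^bsub>V\<^esub> v p) (h q) \<oplus>\<^bsub>U\<^esub> b (v p) (?h p)" by simp
  qed
  also have "\<dots> = lsum U (\<lambda>p. b (k p \<odot>\<^bsub>V\<^esub> v p) (h q)) ps \<oplus>\<^bsub>U\<^esub> lsum U (\<lambda>p. b (v p) (?h p)) ps"
    using ps q br(1) by (intro U.lsum_add) auto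
  also have "lsum U (\<lambda>p. b (k p \<odot>\<^bsub>V\<^esub> v p) (h q)) ps = b (lsum V (\<lambda>p. k p \<odot>\<^bsub>V\<^esub> v p) ps) (h q)"
    using ps by (intro lsum_linear[OF V U bilinearD(1)[OF b q(2)], symmetric]) auto
  finally show ?thesis
    using ps q by (simp add: bl br U.M.a_assoc)
qed

text \<open>In terms of tensors: if \<open>\<Sum> g(h\<^sub>p) v\<^sub>p \<in> W\<^sub>0\<close> for all \<open>g \<in> G\<close>, then \<open>\<Sum> v\<^sub>p \<otimes> h\<^sub>p\<close> lies in
  \<open>W\<^sub>0 \<otimes> W + V \<otimes> \<Inter>ker g\<close>. Testing with bilinear maps \<open>b\<close> into \<open>U\<close> modulo \<open>Z\<close> makes the statement
  symmetric in the two factors.\<close>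

lemma lsum_bilinear_mem:
  assumes K: "field K" and V: "module K V" and W: "module K W" and U: "module K U"
    and b: "bilinear K V W U b"
    and W0: "submodule W0 K V" and Z: "submodule Z K U"
    and G: "\<And>g. g \<in> G \<Longrightarrow> linear_map K W (scalars K) g"
    and bW0: "\<And>x y. x \<in> W0 \<Longrightarrow> y \<in> carrier W \<Longrightarrow> b x y \<in> Z"
    and bG: "\<And>x y. x \<in> carrier V \<Longrightarrow> y \<in> carrier W \<Longrightarrow> (\<And>g. g \<in> G \<Longrightarrow> g y = \<zero>\<^bsub>K\<^esub>) \<Longrightarrow> b x y \<in> Z"
    and ps: "\<And>p. p \<in> set ps \<Longrightarrow> v p \<in> carrier V \<and> h p \<in> carrier W"
    and mem: "\<And>g. g \<in> G \<Longrightarrow> lsum V (\<lambda>p. g (h p) \<odot>\<^bsub>V\<^esub> v p) ps \<in> W0"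
  shows "lsum U (\<lambda>p. b (v p) (h p)) ps \<in> Z"
  using ps mem
\<comment> \<open>The pivot step changes the right entries of the remaining pairs and leaves the
  left ones alone, so \<open>h\<close> is generalized and \<open>v\<close> is not.\<close>
proof (induction ps arbitrary: h)
  case Nil
  then show ?case using module.submodule_zero[OF U Z] by simp
next
  case (Cons q ps)
  interpret K: field K by (rule K)
  interpret V: module K V by (rule V)
  interpret W: module K W by (rule W)
  interpret U: module K U by (rule U)
  have q: "v q \<in> carrier V" "h q \<in> carrier W" using Cons.prems(1)[of q] by auto
  have Gc: "g y \<in> carrier K" if "g \<in> G" "y \<in> carrier W" for g y
    using linear_mapD(1)[OF G[OF that(1)] that(2)] by simp
  show ?case
  proof (cases "\<forall>g \<in> G. g (h q) = \<zero>\<^bsub>K\<^esub>")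
    case True
    \<comment> \<open>The first pair contributes nothing to the sums of the hypothesis, and its own
      value lies in \<open>Z\<close> by \<open>bG\<close>; the rest is left to the
      induction.\<close>
    have "lsum V (\<lambda>p. g (h p) \<odot>\<^bsub>V\<^esub> v p) ps \<in> W0" if "g \<in> G" for g
    proof -
      have "lsum V (\<lambda>p. g (h p) \<odot>\<^bsub>V\<^esub> v p) ps \<in> carrier V"
        using Cons.prems(1) Gc[OF that] by (intro V.lsum_closed) auto
      moreover have "g (h q) = \<zero>\<^bsub>K\<^esub>" using True that by blast
      ultimately show ?thesis using Cons.prems(2)[OF that] q by simp
    qed
    then have "lsum U (\<lambda>p. b (v p) (h p)) ps \<in> Z" using Cons.prems(1) by (intro Cons.IH) auto
    moreover have "b (v q) (h q) \<in> Z" using bG q True by blast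
    ultimately show ?thesis using U.submoduleE(5)[OF Z] by simp
  next
    case False
    then obtain g where g: "g \<in> G" "g (h q) \<noteq> \<zero>\<^bsub>K\<^esub>" by auto
    \<comment> \<open>\<open>c\<close> normalizes the pivot to \<open>k q = 1\<close>. Then
      \<open>w\<close> below is \<open>c\<close> times the sum that the hypothesis for
      \<open>g\<close> places in \<open>W0\<close>.\<close>
    define c where "c = inv\<^bsub>K\<^esub> g (h q)"
    have gq: "g (h q) \<in> carrier K" using Gc g q by auto
    then have c: "c \<in> carrier K" "c \<otimes>\<^bsub>K\<^esub> g (h q) = \<one>\<^bsub>K\<^esub>"
      using g(2) K.field_Units by (auto simp: c_def)
    define k where "k p = c \<otimes>\<^bsub>K\<^esub> g (h p)" for p
    define w where "w = v q \<oplus>\<^bsub>V\<^esub> lsum V (\<lambda>p. k p \<odot>\<^bsub>V\<^esub> v p) ps"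
    let ?h = "\<lambda>p. h p \<oplus>\<^bsub>W\<^esub> (\<ominus>\<^bsub>K\<^esub> k p) \<odot>\<^bsub>W\<^esub> h q"
    have pk: "v p \<in> carrier V \<and> h p \<in> carrier W \<and> k p \<in> carrier K" if "p \<in> set ps" for p
      using Cons.prems(1)[of p] that c Gc g by (auto simp: k_def)
    note pivot = lsum_bilinear_pivot[where v = v and q = q and h = h and k = k and ps = ps,
      OF V W _ _ q pk, folded w_def]
    have "w = c \<odot>\<^bsub>V\<^esub> lsum V (\<lambda>p. g (h p) \<odot>\<^bsub>V\<^esub> v p) (q # ps)"
    proof -
      have "c \<odot>\<^bsub>V\<^esub> lsum V (\<lambda>p. g (h p) \<odot>\<^bsub>V\<^esub> v p) (q # ps)
          = lsum V (\<lambda>p. c \<odot>\<^bsub>V\<^esub> (g (h p) \<odot>\<^bsub>V\<^esub> v p)) (q # ps)"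
        using Cons.prems(1) Gc g
        by (intro lsum_linear[OF V V linear_map_smult[OF V linear_map_id c(1)]]) auto
      also have "\<dots> = lsum V (\<lambda>p. k p \<odot>\<^bsub>V\<^esub> v p) (q # ps)"
        using Cons.prems(1) Gc g c by (intro lsum_cong) (auto simp: k_def V.smult_assoc1)
      also have "\<dots> = w" using c q by (simp add: w_def k_def)
      finally show ?thesis by simp
    qed
    then have w: "w \<in> W0" using V.submoduleE(4)[OF W0 c(1) Cons.prems(2)[OF g(1)]] by simp
    have "lsum V (\<lambda>p. g' (?h p) \<odot>\<^bsub>V\<^esub> v p) ps \<in> W0" if g': "g' \<in> G" for g'
    proof -
      \<comment> \<open>The pivot identity for this bilinear map shows that the sums with the
        modified entries differ from those of the hypothesis by a multiple of \<open>w\<close>,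
        which lies in \<open>W0\<close>.\<close>
      have bil: "bilinear K V W V (\<lambda>x y. g' y \<odot>\<^bsub>V\<^esub> x)"
        using Gc[OF g']
        by (intro bilinearI linear_map_smult[OF V linear_map_id] linear_map_smult_left[OF V G[OF g']]) auto
      let ?s = "lsum V (\<lambda>p. g' (?h p) \<odot>\<^bsub>V\<^esub> v p) ps"
      have s: "?s \<in> carrier V" using pk q Gc[OF g'] by (intro V.lsum_closed) auto
      have gw: "g' (h q) \<odot>\<^bsub>V\<^esub> w \<in> W0" using V.submoduleE(4)[OF W0 Gc[OF g' q(2)] w] .
      then have gwc: "g' (h q) \<odot>\<^bsub>V\<^esub> w \<in> carrier V" using V.submoduleE(1)[OF W0] by auto
      have "g' (h q) \<odot>\<^bsub>V\<^esub> w \<oplus>\<^bsub>V\<^esub> ?s \<in> W0"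
        using Cons.prems(2)[OF g'] pivot[OF V bil] by simp
      then have "\<ominus>\<^bsub>V\<^esub> (g' (h q) \<odot>\<^bsub>V\<^esub> w) \<oplus>\<^bsub>V\<^esub> (g' (h q) \<odot>\<^bsub>V\<^esub> w \<oplus>\<^bsub>V\<^esub> ?s) \<in> W0"
        using V.submoduleE(3,5)[OF W0] gw by blast
      then show ?thesis using s gwc by (simp add: V.M.r_neg1)
    qed
    then have "lsum U (\<lambda>p. b (v p) (?h p)) ps \<in> Z" using pk q by (intro Cons.IH) auto
    then have "b w (h q) \<oplus>\<^bsub>U\<^esub> lsum U (\<lambda>p. b (v p) (?h p)) ps \<in> Z"
      by (rule U.submoduleE(5)[OF Z bW0[OF w q(2)]])
    then show ?thesis by (simp only: pivot[OF U b])
  qed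
qed

lemma zero_submodule:
  assumes "module K V"
  shows "submodule {\<zero>\<^bsub>V\<^esub>} K V"
proof -
  interpret V: module K V by fact
  show ?thesis by (rule V.submoduleI') auto
qed

lemma tsum_mem_right:
  assumes K: "field K" and V: "module K V" and W: "module K W" and U: "module K U"
    and t: "t \<in> carrier (tensor K V W)"
    and b: "bilinear K V W U b" and W0: "submodule W0 K V" and Z: "submodule Z K U"
    and G: "\<And>g. g \<in> G \<Longrightarrow> linear_map K W (scalars K) g"
    and mem: "\<And>g. g \<in> G \<Longrightarrow> tsum K V W V (\<lambda>x y. g y \<odot>\<^bsub>V\<^esub> x) t \<in> W0"
    and "\<And>x y. x \<in> W0 \<Longrightarrow> y \<in> carrier W \<Longrightarrow> b x y \<in> Z"
    and "\<And>x y. x \<in> carrier V \<Longrightarrow> y \<in> carrier W \<Longrightarrow> (\<And>g. g \<in> G \<Longrightarrow> g y = \<zero>\<^bsub>K\<^esub>) \<Longrightarrow> b x y \<in> Z"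
  shows "tsum K V W U b t \<in> Z"
  unfolding tsum_def
  by (rule lsum_bilinear_mem[OF K V W U b W0 Z G])
    (use assms(11,12) trep_closed[OF V W t] mem in \<open>auto simp: tsum_def\<close>)

lemma tsum_mem_left:
  assumes K: "field K" and V: "module K V" and W: "module K W" and U: "module K U"
    and t: "t \<in> carrier (tensor K V W)"
    and b: "bilinear K V W U b" and W0: "submodule W0 K W" and Z: "submodule Z K U"
    and G: "\<And>g. g \<in> G \<Longrightarrow> linear_map K V (scalars K) g"
    and mem: "\<And>g. g \<in> G \<Longrightarrow> tsum K V W W (\<lambda>x y. g x \<odot>\<^bsub>W\<^esub> y) t \<in> W0"
    and "\<And>x y. x \<in> carrier V \<Longrightarrow> y \<in> W0 \<Longrightarrow> b x y \<in> Z"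
    and "\<And>x y. x \<in> carrier V \<Longrightarrow> y \<in> carrier W \<Longrightarrow> (\<And>g. g \<in> G \<Longrightarrow> g x = \<zero>\<^bsub>K\<^esub>) \<Longrightarrow> b x y \<in> Z"
  shows "tsum K V W U b t \<in> Z"
proof -
  have "bilinear K W V U (\<lambda>y x. b x y)" using b by (auto simp: bilinear_def)
  then show ?thesis
    unfolding tsum_def
    by (rule lsum_bilinear_mem[OF K W V U _ W0 Z G])
      (use assms(11,12) trep_closed[OF V W t] mem in \<open>auto simp: tsum_def\<close>)
qed

lemma linear_map_cong:
  assumes "module K V" "linear_map K V U f" "\<And>x. x \<in> carrier V \<Longrightarrow> f x = g x"
  shows "linear_map K V U g"
proof -
  interpret V: module K V by fact
  show ?thesis using linear_mapD[OF assms(2)] by (intro linear_mapI) (simp_all flip: assms(3))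
qed

lemma bilinear_cong:
  assumes "module K V" "module K W" "bilinear K V W U b"
    and eq: "\<And>x y. x \<in> carrier V \<Longrightarrow> y \<in> carrier W \<Longrightarrow> b x y = b' x y"
  shows "bilinear K V W U b'"
proof (rule bilinearI)
  show "linear_map K V U (\<lambda>v. b' v w)" if "w \<in> carrier W" for w
    by (rule linear_map_cong[OF assms(1) bilinearD(1)[OF assms(3) that]]) (simp add: eq that)
  show "linear_map K W U (\<lambda>w. b' v w)" if "v \<in> carrier V" for v
    by (rule linear_map_cong[OF assms(2) bilinearD(2)[OF assms(3) that]]) (simp add: eq that)
qed

section \<open>Trilinear maps and the coassociativity axiom\<close>

definition trilinear ::
  "('k, 'r) ring_scheme \<Rightarrow> ('k, 'v, 'm) module_scheme \<Rightarrow> ('k, 'w, 'n) module_scheme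
    \<Rightarrow> ('k, 'z, 'q) module_scheme \<Rightarrow> ('k, 'u, 'p) module_scheme \<Rightarrow> ('v \<Rightarrow> 'w \<Rightarrow> 'z \<Rightarrow> 'u) \<Rightarrow> bool"
  where "trilinear K V W Z U t \<longleftrightarrow>
    (\<forall>v \<in> carrier V. bilinear K W Z U (t v)) \<and>
    (\<forall>w \<in> carrier W. \<forall>z \<in> carrier Z. linear_map K V U (\<lambda>v. t v w z))"

lemma trilinearI:
  "(\<And>w z. w \<in> carrier W \<Longrightarrow> z \<in> carrier Z \<Longrightarrow> linear_map K V U (\<lambda>v. t v w z)) \<Longrightarrow>
   (\<And>v z. v \<in> carrier V \<Longrightarrow> z \<in> carrier Z \<Longrightarrow> linear_map K W U (\<lambda>w. t v w z)) \<Longrightarrow>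
   (\<And>v w. v \<in> carrier V \<Longrightarrow> w \<in> carrier W \<Longrightarrow> linear_map K Z U (\<lambda>z. t v w z)) \<Longrightarrow>
   trilinear K V W Z U t"
  by (auto simp: trilinear_def bilinear_def)

lemma trilinearD:
  assumes "trilinear K V W Z U t"
  shows "w \<in> carrier W \<Longrightarrow> z \<in> carrier Z \<Longrightarrow> linear_map K V U (\<lambda>v. t v w z)"
    and "v \<in> carrier V \<Longrightarrow> z \<in> carrier Z \<Longrightarrow> linear_map K W U (\<lambda>w. t v w z)"
    and "v \<in> carrier V \<Longrightarrow> w \<in> carrier W \<Longrightarrow> linear_map K Z U (\<lambda>z. t v w z)"
    and "v \<in> carrier V \<Longrightarrow> bilinear K W Z U (t v)"
    and "v \<in> carrier V \<Longrightarrow> w \<in> carrier W \<Longrightarrow> z \<in> carrier Z \<Longrightarrow> t v w z \<in> carrier U"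
  using assms by (auto simp: trilinear_def bilinear_def linear_map_def Pi_iff)

context
  fixes K V H \<rho> \<Delta>
  assumes V: "module K V" and H: "module K H"
    and rho: "linear_map K V (tensor K V H) \<rho>" and Delta: "linear_map K H (tensor K H H) \<Delta>"
begin

abbreviation (input) "VH \<equiv> tensor K V H"
abbreviation (input) "HH \<equiv> tensor K H H"
abbreviation (input) "VHH \<equiv> tensor K V (tensor K H H)"

lemma tensor_module3:
  "module K VH" "module K HH" "module K VHH" "module K (tensor K VH H)"
  by (intro tensor_module V H)+

lemma tens_linear:
  "x \<in> carrier V \<Longrightarrow> linear_map K H VH (tens K V H x)"
  "y \<in> carrier H \<Longrightarrow> linear_map K V VH (\<lambda>x. tens K V H x y)"
  "x \<in> carrier V \<Longrightarrow> linear_map K HH VHH (tens K V HH x)"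
  "z \<in> carrier HH \<Longrightarrow> linear_map K V VHH (\<lambda>x. tens K V HH x z)"
  "y \<in> carrier H \<Longrightarrow> linear_map K H HH (tens K H H y)"
  "y \<in> carrier H \<Longrightarrow> linear_map K H HH (\<lambda>w. tens K H H w y)"
  "y \<in> carrier H \<Longrightarrow> linear_map K VH (tensor K VH H) (\<lambda>s. tens K VH H s y)"
  "s \<in> carrier VH \<Longrightarrow> linear_map K H (tensor K VH H) (tens K VH H s)"
  by (intro bilinearD[OF tens_bilinear] V H tensor_module; assumption)+

lemma trilinear_tens: "trilinear K V H H VHH (\<lambda>x y z. tens K V HH x (tens K H H y z))"
  by (intro trilinearI linear_map_comp[OF tens_linear(3)] tens_linear tens_closed H)

lemma tensor_map_comult:
  assumes t: "t \<in> carrier VH"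
  shows "tensor_map K V H V HH (\<lambda>x. x) \<Delta> t = tsum K V H VHH (\<lambda>x y. tens K V HH x (\<Delta> y)) t"
  unfolding tensor_map_def
  by (intro tsum_eq_lift[symmetric] V H t tensor_module bilinearI tens_linear
      linear_mapD(1)[OF Delta] linear_map_comp[OF tens_linear(3) Delta])

text \<open>The outer lift in \<open>tensor_assoc\<close> is meaningful only if the inner one is
  bilinear. For \<open>tsum\<close> this follows from linearity in each argument, and the two agree
  on the carriers.\<close>

lemma tensor_assoc_bilinear:
  "bilinear K VH H VHH (\<lambda>s y. tensor_lift K V H VHH (\<lambda>u w. tens K V HH u (tens K H H w y)) s)"
proof -
  have "bilinear K VH H VHH (\<lambda>s y. tsum K V H VHH (\<lambda>u w. tens K V HH u (tens K H H w y)) s)"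
    by (intro bilinearI linear_map_tsum linear_map_tsum_body V H tensor_module trilinearD[OF trilinear_tens])
  then show ?thesis
    by (rule bilinear_cong[OF tensor_module3(1) H])
      (intro tsum_eq_lift V H tensor_module bilinearI trilinearD[OF trilinear_tens])
qed

lemma tensor_assoc_tens:
  assumes "s \<in> carrier VH" "y \<in> carrier H"
  shows "tensor_assoc K V H H (tens K VH H s y) = tsum K V H VHH (\<lambda>u w. tens K V HH u (tens K H H w y)) s"
  unfolding tensor_assoc_def
    tensor_lift_tens[OF tensor_module3(1) H tensor_module3(3) tensor_assoc_bilinear assms]
  by (intro tsum_eq_lift[symmetric] V H tensor_module assms bilinearI trilinearD[OF trilinear_tens])

lemma linear_map_tensor_assoc: "linear_map K (tensor K VH H) VHH (tensor_assoc K V H H)"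
  unfolding tensor_assoc_def
  by (rule tensor_lift_linear[OF tensor_module3(1) H tensor_module3(3) tensor_assoc_bilinear])

lemma tensor_assoc_map:
  assumes t: "t \<in> carrier VH"
  shows "tensor_assoc K V H H (tensor_map K V H VH H \<rho> (\<lambda>h. h) t)
    = tsum K V H VHH (\<lambda>x y. tsum K V H VHH (\<lambda>u w. tens K V HH u (tens K H H w y)) (\<rho> x)) t"
proof -
  have "tensor_map K V H VH H \<rho> (\<lambda>h. h) t = tsum K V H (tensor K VH H) (\<lambda>x y. tens K VH H (\<rho> x) y) t"
    unfolding tensor_map_def
    by (intro tsum_eq_lift[symmetric] V H t tensor_module bilinearI tens_linear
        linear_mapD(1)[OF rho] linear_map_comp[OF tens_linear(7) rho])
  also have "tensor_assoc K V H H \<dots> = tsum K V H VHH (\<lambda>x y. tensor_assoc K V H H (tens K VH H (\<rho> x) y)) t"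
    by (intro linear_map_tsum_out V H t tensor_module linear_map_tensor_assoc tens_closed linear_mapD(1)[OF rho])
  also have "\<dots> = tsum K V H VHH (\<lambda>x y. tsum K V H VHH (\<lambda>u w. tens K V HH u (tens K H H w y)) (\<rho> x)) t"
    by (intro tsum_cong V H t tensor_assoc_tens linear_mapD(1)[OF rho])
  finally show ?thesis .
qed

text \<open>\<open>f\<close> is the restriction to pure tensors of the linear map \<open>?T\<close>
  on \<open>V \<otimes> (H \<otimes> H)\<close>; applying \<open>?T\<close> to both sides of the
  tensor equation yields the two nested sums. The lemma serves comodules and, with
  \<open>V = H\<close>, the comultiplication.\<close>

lemma coassoc_tsum:
  assumes t: "t \<in> carrier VH" and U: "module K U" and f: "trilinear K V H H U f"
    and eq: "tensor_assoc K V H H (tensor_map K V H VH H \<rho> (\<lambda>h. h) t)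
      = tensor_map K V H V HH (\<lambda>x. x) \<Delta> t"
  shows "tsum K V H U (\<lambda>x y. tsum K V H U (\<lambda>u w. f u w y) (\<rho> x)) t
    = tsum K V H U (\<lambda>x y. tsum K H H U (f x) (\<Delta> y)) t"
proof -
  let ?T = "tsum K V HH U (\<lambda>v z. tsum K H H U (f v) z)"
  have bil: "bilinear K V HH U (\<lambda>v z. tsum K H H U (f v) z)"
    by (intro bilinearI linear_map_tsum linear_map_tsum_body V H U tensor_module trilinearD[OF f])
  have T: "linear_map K VHH U ?T"
    by (intro linear_map_tsum V U tensor_module H bil)
  have Tt: "?T (tens K V HH x z) = tsum K H H U (f x) z" if "x \<in> carrier V" "z \<in> carrier HH" for x z
    by (intro tsum_tens V U tensor_module H bil that)
  have Ttt: "?T (tens K V HH x (tens K H H y z)) = f x y z"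
    if "x \<in> carrier V" "y \<in> carrier H" "z \<in> carrier H" for x y z
    unfolding Tt[OF that(1) tens_closed[OF H H that(2,3)]]
    by (intro tsum_tens H U trilinearD(4)[OF f] that)
  have "tsum K V H U (\<lambda>x y. tsum K V H U (\<lambda>u w. f u w y) (\<rho> x)) t
      = tsum K V H U (\<lambda>x y. tsum K V H U (\<lambda>u w. ?T (tens K V HH u (tens K H H w y))) (\<rho> x)) t"
    by (intro tsum_cong V H t linear_mapD(1)[OF rho] Ttt[symmetric])
  also have "\<dots> = tsum K V H U (\<lambda>x y. ?T (tsum K V H VHH (\<lambda>u w. tens K V HH u (tens K H H w y)) (\<rho> x))) t"
    by (intro tsum_cong[OF V H t] linear_map_tsum_out[symmetric] V H U tensor_module T tens_closed
        linear_mapD(1)[OF rho])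
  also have "\<dots> = ?T (tensor_assoc K V H H (tensor_map K V H VH H \<rho> (\<lambda>h. h) t))"
    unfolding tensor_assoc_map[OF t]
    by (intro linear_map_tsum_out[symmetric] V H U t tensor_module T tens_closed tsum_closed
        linear_mapD(1)[OF rho])
  also have "\<dots> = tsum K V H U (\<lambda>x y. ?T (tens K V HH x (\<Delta> y))) t"
    unfolding eq tensor_map_comult[OF t]
    by (intro linear_map_tsum_out V H U t tensor_module T tens_closed linear_mapD(1)[OF Delta])
  also have "\<dots> = tsum K V H U (\<lambda>x y. tsum K H H U (f x) (\<Delta> y)) t"
    by (intro tsum_cong V H t Tt linear_mapD(1)[OF Delta])
  finally show ?thesis .
qed

end

section \<open>Sweedler calculus in a Hopf algebra\<close>

text \<open>The lift is a \<open>THE\<close>-term that sees \<open>b\<close> only on the carriers,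
  so a lift nested in another one, as in \<open>tensor_mult\<close>, can be rewritten.\<close>

lemma tensor_lift_cong:
  assumes "\<And>v w. v \<in> carrier V \<Longrightarrow> w \<in> carrier W \<Longrightarrow> b v w = b' v w"
  shows "tensor_lift K V W U b = tensor_lift K V W U b'"
  unfolding tensor_lift_def using assms by (simp cong: ball_cong)

context hopf_algebra
begin

text \<open>In Sweedler's notation, \<open>sw U x b\<close> is \<open>b x\<^sub>1 x\<^sub>2\<close>.\<close>

definition sw :: "('k, 'u, 'p) module_scheme \<Rightarrow> 'h \<Rightarrow> ('h \<Rightarrow> 'h \<Rightarrow> 'u) \<Rightarrow> 'u"
  where "sw U x b = tsum K H H U b (comult H x)"

lemma H_mod: "module K H" and S_mod: "module K (scalars K)"
  by (rule mod.module_axioms, rule scalars_module[OF K.cring_axioms])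

lemma comult_closed: "x \<in> carrier H \<Longrightarrow> comult H x \<in> carrier (tensor K H H)"
  by (rule linear_mapD(1)[OF comult_linear])

lemma antipode_closed [simp]: "x \<in> carrier H \<Longrightarrow> antipode H x \<in> carrier H"
  by (rule linear_mapD(1)[OF antipode_linear])

lemma counit_closed [simp]: "x \<in> carrier H \<Longrightarrow> counit H x \<in> carrier K"
  using linear_mapD(1)[OF counit_linear] by simp

lemma linear_map_mult_left:
  "linear_map K V H f \<Longrightarrow> c \<in> carrier H \<Longrightarrow> linear_map K V H (\<lambda>x. f x \<otimes>\<^bsub>H\<^esub> c)"
  by (auto simp: linear_map_def Pi_iff smult_mult_left H.l_distr)

lemma linear_map_mult_right:
  "linear_map K V H f \<Longrightarrow> c \<in> carrier H \<Longrightarrow> linear_map K V H (\<lambda>x. c \<otimes>\<^bsub>H\<^esub> f x)"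
  by (auto simp: linear_map_def Pi_iff smult_mult_right H.r_distr)

lemma linear_map_scalar_mult_left:
  "linear_map K V (scalars K) f \<Longrightarrow> c \<in> carrier K \<Longrightarrow> linear_map K V (scalars K) (\<lambda>x. f x \<otimes>\<^bsub>K\<^esub> c)"
  by (auto simp: linear_map_def Pi_iff K.l_distr K.m_assoc)

lemma linear_map_scalar_mult_right:
  "linear_map K V (scalars K) f \<Longrightarrow> c \<in> carrier K \<Longrightarrow> linear_map K V (scalars K) (\<lambda>x. c \<otimes>\<^bsub>K\<^esub> f x)"
  by (auto simp: linear_map_def Pi_iff K.r_distr K.m_lcomm)

lemma sw_cong:
  "x \<in> carrier H \<Longrightarrow> (\<And>a b. a \<in> carrier H \<Longrightarrow> b \<in> carrier H \<Longrightarrow> f a b = g a b) \<Longrightarrow> sw U x f = sw U x g"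
  unfolding sw_def by (intro tsum_cong H_mod comult_closed)

lemma sw_closed [simp]:
  "module K U \<Longrightarrow> x \<in> carrier H \<Longrightarrow> (\<And>a b. a \<in> carrier H \<Longrightarrow> b \<in> carrier H \<Longrightarrow> f a b \<in> carrier U)
    \<Longrightarrow> sw U x f \<in> carrier U"
  unfolding sw_def by (intro tsum_closed H_mod comult_closed)

lemma sw_scalars_closed [simp]:
  "x \<in> carrier H \<Longrightarrow> (\<And>a b. a \<in> carrier H \<Longrightarrow> b \<in> carrier H \<Longrightarrow> f a b \<in> carrier K)
    \<Longrightarrow> sw (scalars K) x f \<in> carrier K"
  using sw_closed[OF S_mod] by simp

lemma sw_zero: "module K U \<Longrightarrow> sw U x (\<lambda>a b. \<zero>\<^bsub>U\<^esub>) = \<zero>\<^bsub>U\<^esub>"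
  unfolding sw_def by (intro tsum_zero H_mod)

lemma sw_scalars_zero: "sw (scalars K) x (\<lambda>a b. \<zero>\<^bsub>K\<^esub>) = \<zero>\<^bsub>K\<^esub>"
  using sw_zero[OF S_mod] by (simp only: scalars_simps)

lemma sw_swap:
  "module K U \<Longrightarrow> x \<in> carrier H \<Longrightarrow> y \<in> carrier H \<Longrightarrow>
    (\<And>a b c d. \<lbrakk>a \<in> carrier H; b \<in> carrier H; c \<in> carrier H; d \<in> carrier H\<rbrakk> \<Longrightarrow> f a b c d \<in> carrier U) \<Longrightarrow>
    sw U x (\<lambda>a b. sw U y (\<lambda>c d. f a b c d)) = sw U y (\<lambda>c d. sw U x (\<lambda>a b. f a b c d))"
  unfolding sw_def by (intro tsum_swap[OF H_mod H_mod H_mod H_mod] comult_closed)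

lemma linear_map_sw_out:
  "linear_map K U U' h \<Longrightarrow> module K U \<Longrightarrow> module K U' \<Longrightarrow> x \<in> carrier H \<Longrightarrow>
    (\<And>a b. a \<in> carrier H \<Longrightarrow> b \<in> carrier H \<Longrightarrow> f a b \<in> carrier U) \<Longrightarrow>
    h (sw U x f) = sw U' x (\<lambda>a b. h (f a b))"
  unfolding sw_def by (intro linear_map_tsum_out H_mod comult_closed)

lemma linear_map_sw:
  "module K U \<Longrightarrow> bilinear K H H U f \<Longrightarrow> linear_map K V H g \<Longrightarrow> linear_map K V U (\<lambda>x. sw U (g x) f)"
  unfolding sw_def
  by (rule linear_map_comp[OF linear_map_comp[OF linear_map_tsum[OF H_mod H_mod] comult_linear]])

lemma linear_map_sw_body:
  "module K V \<Longrightarrow> module K U \<Longrightarrow> y \<in> carrier H \<Longrightarrow>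
    (\<And>a b. a \<in> carrier H \<Longrightarrow> b \<in> carrier H \<Longrightarrow> linear_map K V U (\<lambda>x. f x a b)) \<Longrightarrow>
    linear_map K V U (\<lambda>x. sw U y (f x))"
  unfolding sw_def by (intro linear_map_tsum_body H_mod comult_closed)

text \<open>Linearity in one Sweedler component is read off from the shape of the expression;
  together with simplification of the membership conditions, these rules discharge the
  multilinearity premises of the calculations below.\<close>

lemmas linear_intros = linear_map_id linear_map_mult_left linear_map_mult_right
  linear_map_comp[OF antipode_linear] linear_map_comp[OF counit_linear]
  linear_map_scalar_mult_left linear_map_scalar_mult_right linear_map_smult linear_map_smult_left
  linear_map_sw linear_map_sw_body bilinearI trilinearI H_mod S_mod

lemma sw_eq_lift:
  "module K U \<Longrightarrow> bilinear K H H U b \<Longrightarrow> x \<in> carrier H \<Longrightarrow> sw U x b = tensor_lift K H H U b (comult H x)"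
  unfolding sw_def by (intro tsum_eq_lift H_mod comult_closed)

lemma sw_coassoc:
  assumes "module K U" "trilinear K H H H U f" "x \<in> carrier H"
  shows "sw U x (\<lambda>s c. sw U s (\<lambda>a b. f a b c)) = sw U x (\<lambda>a t. sw U t (\<lambda>b c. f a b c))"
  unfolding sw_def
  by (rule coassoc_tsum[OF H_mod H_mod comult_linear comult_linear comult_closed[OF assms(3)] assms(1,2)
      coassoc[OF assms(3)]])

text \<open>The axiom has values in \<open>H\<close>. Composing it with a linear \<open>g\<close>
  allows the counit to be cancelled in the middle of a larger expression; the next three lemmas do
  the same for the other axioms.\<close>

lemma sw_counit_left:
  assumes U: "module K U" and g: "linear_map K H U g" and x: "x \<in> carrier H"
  shows "sw U x (\<lambda>a b. counit H a \<odot>\<^bsub>U\<^esub> g b) = g x"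
proof -
  have "sw H x (\<lambda>a b. counit H a \<odot>\<^bsub>H\<^esub> b) = x"
    using counit_left[OF x] by (subst sw_eq_lift) (intro linear_intros x; simp)+
  then have "g x = sw U x (\<lambda>a b. g (counit H a \<odot>\<^bsub>H\<^esub> b))"
    using linear_map_sw_out[OF g H_mod U x, of "\<lambda>a b. counit H a \<odot>\<^bsub>H\<^esub> b"] by simp
  also have "\<dots> = sw U x (\<lambda>a b. counit H a \<odot>\<^bsub>U\<^esub> g b)"
    by (intro sw_cong x) (simp add: linear_mapD(3)[OF g])
  finally show ?thesis by simp
qed

lemma sw_counit_right:
  assumes U: "module K U" and g: "linear_map K H U g" and x: "x \<in> carrier H"
  shows "sw U x (\<lambda>a b. counit H b \<odot>\<^bsub>U\<^esub> g a) = g x"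
proof -
  have "sw H x (\<lambda>a b. counit H b \<odot>\<^bsub>H\<^esub> a) = x"
    using counit_right[OF x] by (subst sw_eq_lift) (intro linear_intros x; simp)+
  then have "g x = sw U x (\<lambda>a b. g (counit H b \<odot>\<^bsub>H\<^esub> a))"
    using linear_map_sw_out[OF g H_mod U x, of "\<lambda>a b. counit H b \<odot>\<^bsub>H\<^esub> a"] by simp
  also have "\<dots> = sw U x (\<lambda>a b. counit H b \<odot>\<^bsub>U\<^esub> g a)"
    by (intro sw_cong x) (simp add: linear_mapD(3)[OF g])
  finally show ?thesis by simp
qed

lemma sw_antipode_left:
  assumes U: "module K U" and g: "linear_map K H U g" and x: "x \<in> carrier H"
  shows "sw U x (\<lambda>a b. g (antipode H a \<otimes>\<^bsub>H\<^esub> b)) = counit H x \<odot>\<^bsub>U\<^esub> g \<one>\<^bsub>H\<^esub>"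
proof -
  have "sw H x (\<lambda>a b. antipode H a \<otimes>\<^bsub>H\<^esub> b) = counit H x \<odot>\<^bsub>H\<^esub> \<one>\<^bsub>H\<^esub>"
    using antipode_left[OF x] by (subst sw_eq_lift) (intro linear_intros x; simp)+
  then show ?thesis
    using linear_map_sw_out[OF g H_mod U x, of "\<lambda>a b. antipode H a \<otimes>\<^bsub>H\<^esub> b"] x
    by (simp add: linear_mapD(3)[OF g])
qed

lemma sw_antipode_right:
  assumes U: "module K U" and g: "linear_map K H U g" and x: "x \<in> carrier H"
  shows "sw U x (\<lambda>a b. g (a \<otimes>\<^bsub>H\<^esub> antipode H b)) = counit H x \<odot>\<^bsub>U\<^esub> g \<one>\<^bsub>H\<^esub>"
proof -
  have "sw H x (\<lambda>a b. a \<otimes>\<^bsub>H\<^esub> antipode H b) = counit H x \<odot>\<^bsub>H\<^esub> \<one>\<^bsub>H\<^esub>"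
    using antipode_right[OF x] by (subst sw_eq_lift) (intro linear_intros x; simp)+
  then show ?thesis
    using linear_map_sw_out[OF g H_mod U x, of "\<lambda>a b. a \<otimes>\<^bsub>H\<^esub> antipode H b"] x
    by (simp add: linear_mapD(3)[OF g])
qed

section \<open>Products, coproducts and the antipode\<close>

lemma sw_one:
  assumes "module K U" "bilinear K H H U b"
  shows "sw U \<one>\<^bsub>H\<^esub> b = b \<one>\<^bsub>H\<^esub> \<one>\<^bsub>H\<^esub>"
  unfolding sw_def comult_one by (intro tsum_tens H_mod assms) simp_all

lemma antipode_one: "antipode H \<one>\<^bsub>H\<^esub> = \<one>\<^bsub>H\<^esub>"
proof -
  have "sw H \<one>\<^bsub>H\<^esub> (\<lambda>a b. antipode H a \<otimes>\<^bsub>H\<^esub> b) = antipode H \<one>\<^bsub>H\<^esub> \<otimes>\<^bsub>H\<^esub> \<one>\<^bsub>H\<^esub>"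
    by (rule sw_one) (intro linear_intros; simp)+
  then show ?thesis
    using sw_antipode_left[OF H_mod linear_map_id, of "\<one>\<^bsub>H\<^esub>"] by (simp add: counit_one)
qed

text \<open>\<open>tensor_mult\<close> is a double lift. It is first identified with a double
  Sweedler sum, and the linear map induced by \<open>f\<close> is then moved inside both
  sums.\<close>

lemma sw_mult:
  assumes U: "module K U" and b: "bilinear K H H U f" and x: "x \<in> carrier H" and y: "y \<in> carrier H"
  shows "sw U (x \<otimes>\<^bsub>H\<^esub> y) f = sw U x (\<lambda>a b. sw U y (\<lambda>c d. f (a \<otimes>\<^bsub>H\<^esub> c) (b \<otimes>\<^bsub>H\<^esub> d)))"
proof -
  let ?HH = "tensor K H H"
  have HH: "module K ?HH" by (rule tensor_module[OF H_mod H_mod])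
  have bil: "bilinear K H H ?HH (\<lambda>c d. tens K H H (a \<otimes>\<^bsub>H\<^esub> c) (b \<otimes>\<^bsub>H\<^esub> d))"
    if "a \<in> carrier H" "b \<in> carrier H" for a b
    using that
    by (intro bilinearI linear_map_comp[OF bilinearD(1)[OF tens_bilinear[OF H_mod H_mod]]]
        linear_map_comp[OF bilinearD(2)[OF tens_bilinear[OF H_mod H_mod]]] linear_intros; simp)
  have lift: "tensor_lift K H H ?HH (\<lambda>c d. tens K H H (a \<otimes>\<^bsub>H\<^esub> c) (b \<otimes>\<^bsub>H\<^esub> d)) (comult H y)
      = sw ?HH y (\<lambda>c d. tens K H H (a \<otimes>\<^bsub>H\<^esub> c) (b \<otimes>\<^bsub>H\<^esub> d))"
    if "a \<in> carrier H" "b \<in> carrier H" for a b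
    using that by (intro sw_eq_lift[symmetric] HH bil y)
  have bil2: "bilinear K H H ?HH (\<lambda>a b. sw ?HH y (\<lambda>c d. tens K H H (a \<otimes>\<^bsub>H\<^esub> c) (b \<otimes>\<^bsub>H\<^esub> d)))"
    using y
    by (intro bilinearI linear_map_comp[OF bilinearD(1)[OF tens_bilinear[OF H_mod H_mod]]]
        linear_map_comp[OF bilinearD(2)[OF tens_bilinear[OF H_mod H_mod]]] HH linear_intros; simp)
  have "comult H (x \<otimes>\<^bsub>H\<^esub> y)
      = sw ?HH x (\<lambda>a b. sw ?HH y (\<lambda>c d. tens K H H (a \<otimes>\<^bsub>H\<^esub> c) (b \<otimes>\<^bsub>H\<^esub> d)))"
    unfolding comult_mult[OF x y] tensor_mult_def sw_eq_lift[OF HH bil2 x]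
    by (rule fun_cong[OF tensor_lift_cong]) (rule lift)
  then have "sw U (x \<otimes>\<^bsub>H\<^esub> y) f = tsum K H H U f
      (sw ?HH x (\<lambda>a b. sw ?HH y (\<lambda>c d. tens K H H (a \<otimes>\<^bsub>H\<^esub> c) (b \<otimes>\<^bsub>H\<^esub> d))))"
    by (simp add: sw_def)
  also have "\<dots> = sw U x (\<lambda>a b. tsum K H H U f (sw ?HH y (\<lambda>c d. tens K H H (a \<otimes>\<^bsub>H\<^esub> c) (b \<otimes>\<^bsub>H\<^esub> d))))"
    by (intro linear_map_sw_out linear_map_tsum H_mod U HH b x sw_closed y tens_closed) simp_all
  also have "\<dots> = sw U x (\<lambda>a b. sw U y (\<lambda>c d. tsum K H H U f (tens K H H (a \<otimes>\<^bsub>H\<^esub> c) (b \<otimes>\<^bsub>H\<^esub> d))))"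
    by (intro sw_cong x linear_map_sw_out linear_map_tsum H_mod U HH b y tens_closed) simp_all
  also have "\<dots> = sw U x (\<lambda>a b. sw U y (\<lambda>c d. f (a \<otimes>\<^bsub>H\<^esub> c) (b \<otimes>\<^bsub>H\<^esub> d)))"
    by (intro sw_cong x y tsum_tens H_mod U b) simp_all
  finally show ?thesis .
qed

text \<open>The expression \<open>S(x\<^sub>1 y\<^sub>1) x\<^sub>2 y\<^sub>2 S(y\<^sub>3)
  S(x\<^sub>3)\<close> reduces to \<open>S(x y)\<close> if its right end is cancelled first and to
  \<open>S(y) S(x)\<close> if its left end is. This is uniqueness of the convolution inverse of the
  multiplication \<open>H \<otimes> H \<rightarrow> H\<close>.\<close>

lemma antipode_mult:
  assumes x: "x \<in> carrier H" and y: "y \<in> carrier H"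
  shows "antipode H (x \<otimes>\<^bsub>H\<^esub> y) = antipode H y \<otimes>\<^bsub>H\<^esub> antipode H x"
proof -
  note [simp] = H_mod x y
  let ?S = "antipode H" and ?m = "\<lambda>a b. a \<otimes>\<^bsub>H\<^esub> b"
  let ?E = "\<lambda>a b b' c d d'. ?m (?S (?m a c)) (?m b (?m (?m d (?S d')) (?S b')))"
  let ?P = "sw H x (\<lambda>a t. sw H t (\<lambda>b b'. sw H y (\<lambda>c s. sw H s (\<lambda>d d'. ?E a b b' c d d'))))"
  have 1: "sw H s (\<lambda>d d'. ?E a b b' c d d') = counit H s \<odot>\<^bsub>H\<^esub> ?m (?S (?m a c)) (?m b (?S b'))"
    if "s \<in> carrier H" "a \<in> carrier H" "b \<in> carrier H" "b' \<in> carrier H" "c \<in> carrier H" for s a b b' c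
  proof -
    have "sw H s (\<lambda>d d'. ?E a b b' c d d')
        = counit H s \<odot>\<^bsub>H\<^esub> ?m (?S (?m a c)) (?m b (?m \<one>\<^bsub>H\<^esub> (?S b')))"
      by (rule sw_antipode_right) (intro linear_intros | simp add: that)+
    then show ?thesis using that by simp
  qed
  have 2: "sw H y (\<lambda>c s. counit H s \<odot>\<^bsub>H\<^esub> ?m (?S (?m a c)) (?m b (?S b'))) = ?m (?S (?m a y)) (?m b (?S b'))"
    if "a \<in> carrier H" "b \<in> carrier H" "b' \<in> carrier H" for a b b'
    by (rule sw_counit_right) (intro linear_intros | simp add: that)+
  have 3: "sw H t (\<lambda>b b'. ?m (?S (?m a y)) (?m b (?S b'))) = counit H t \<odot>\<^bsub>H\<^esub> ?S (?m a y)"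
    if "a \<in> carrier H" "t \<in> carrier H" for a t
  proof -
    have "sw H t (\<lambda>b b'. ?m (?S (?m a y)) (?m b (?S b'))) = counit H t \<odot>\<^bsub>H\<^esub> ?m (?S (?m a y)) \<one>\<^bsub>H\<^esub>"
      by (rule sw_antipode_right) (intro linear_intros | simp add: that)+
    then show ?thesis using that by simp
  qed
  have "?P = sw H x (\<lambda>a t. counit H t \<odot>\<^bsub>H\<^esub> ?S (?m a y))"
    by (simp add: 1 2 3 cong: sw_cong)
  also have "\<dots> = ?S (?m x y)"
    by (rule sw_counit_right) (intro linear_intros | simp)+
  finally have P1: "?P = ?S (?m x y)" .
  let ?Q = "\<lambda>d' b'. ?m (?S d') (?S b')"
  \<comment> \<open>Regrouping turns the first two components of \<open>x\<close> and
    \<open>y\<close> into coproducts of \<open>s\<close> and \<open>t\<close>, which combine to the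
    coproduct of the product \<open>s t\<close>.\<close>
  have "?P = sw H x (\<lambda>s b'. sw H s (\<lambda>a b. sw H y (\<lambda>c s. sw H s (\<lambda>d d'. ?E a b b' c d d'))))"
    by (rule sw_coassoc[symmetric]) (intro linear_intros | simp)+
  also have "\<dots> = sw H x (\<lambda>s b'. sw H s (\<lambda>a b. sw H y (\<lambda>t d'. sw H t (\<lambda>c d. ?E a b b' c d d'))))"
    by (intro sw_cong sw_coassoc[symmetric]) (intro linear_intros | simp)+
  also have "\<dots> = sw H x (\<lambda>s b'. sw H y (\<lambda>t d'. sw H s (\<lambda>a b. sw H t (\<lambda>c d. ?E a b b' c d d'))))"
    by (intro sw_cong sw_swap) simp_all
  also have "\<dots> = sw H x (\<lambda>s b'. sw H y (\<lambda>t d'. sw H (?m s t) (\<lambda>a b. ?m (?m (?S a) b) (?Q d' b'))))"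
  proof (intro sw_cong)
    fix s t b' d' assume *: "s \<in> carrier H" "b' \<in> carrier H" "t \<in> carrier H" "d' \<in> carrier H"
    have "sw H (?m s t) (\<lambda>a b. ?m (?m (?S a) b) (?Q d' b'))
      = sw H s (\<lambda>a b. sw H t (\<lambda>c d. ?m (?m (?S (?m a c)) (?m b d)) (?Q d' b')))"
      by (rule sw_mult) (intro linear_intros | simp add: *)+
    also have "\<dots> = sw H s (\<lambda>a b. sw H t (\<lambda>c d. ?E a b b' c d d'))"
      using * by (simp add: H.m_assoc cong: sw_cong)
    finally show "sw H s (\<lambda>a b. sw H t (\<lambda>c d. ?E a b b' c d d'))
      = sw H (?m s t) (\<lambda>a b. ?m (?m (?S a) b) (?Q d' b'))" by simp
  qed simp_all
  also have "\<dots> = sw H x (\<lambda>s b'. sw H y (\<lambda>t d'. counit H (?m s t) \<odot>\<^bsub>H\<^esub> ?m \<one>\<^bsub>H\<^esub> (?Q d' b')))"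
    by (intro sw_cong sw_antipode_left) (intro linear_intros | simp)+
  also have "\<dots> = sw H x (\<lambda>s b'. sw H y (\<lambda>t d'. counit H t \<odot>\<^bsub>H\<^esub> (counit H s \<odot>\<^bsub>H\<^esub> ?Q d' b')))"
    by (intro sw_cong) (simp_all add: counit_mult mod.smult_assoc1[symmetric] K.m_comm)
  also have "\<dots> = sw H x (\<lambda>s b'. counit H s \<odot>\<^bsub>H\<^esub> ?Q y b')"
    by (intro sw_cong sw_counit_left) (intro linear_intros | simp)+
  also have "\<dots> = ?Q y x"
    by (rule sw_counit_left) (intro linear_intros | simp)+
  finally show ?thesis using P1 by simp
qed

text \<open>In components this is
  \<open>t\<^sub>1 S(t\<^sub>4) \<otimes> t\<^sub>2 S(t\<^sub>3)\<close>: the inner pair is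
  cancelled first, after which the outer one becomes adjacent. It makes
  \<open>t \<mapsto> S(t\<^sub>2) \<otimes> S(t\<^sub>1)\<close> a right convolution inverse of the
  comultiplication.\<close>

lemma sw_antipode_nested:
  assumes U: "module K U" and b: "bilinear K H H U f" and t: "t \<in> carrier H"
  shows "sw U t (\<lambda>v w. sw U v (\<lambda>p q. sw U w (\<lambda>c d.
      f (p \<otimes>\<^bsub>H\<^esub> antipode H d) (q \<otimes>\<^bsub>H\<^esub> antipode H c)))) = counit H t \<odot>\<^bsub>U\<^esub> f \<one>\<^bsub>H\<^esub> \<one>\<^bsub>H\<^esub>"
proof -
  note [simp] = H_mod U t bilinearD(3)[OF b]
  note intros = linear_intros linear_map_comp[OF bilinearD(1)[OF b]] linear_map_comp[OF bilinearD(2)[OF b]]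
  let ?S = "antipode H" and ?m = "\<lambda>a b. a \<otimes>\<^bsub>H\<^esub> b"
  have "sw U t (\<lambda>v w. sw U v (\<lambda>p q. sw U w (\<lambda>c d. f (?m p (?S d)) (?m q (?S c)))))
      = sw U t (\<lambda>p r. sw U r (\<lambda>q w. sw U w (\<lambda>c d. f (?m p (?S d)) (?m q (?S c)))))"
    by (rule sw_coassoc) (intro intros | simp)+
  also have "\<dots> = sw U t (\<lambda>p r. sw U r (\<lambda>s d. sw U s (\<lambda>q c. f (?m p (?S d)) (?m q (?S c)))))"
    by (intro sw_cong sw_coassoc[symmetric]) (intro intros | simp)+
  also have "\<dots> = sw U t (\<lambda>p r. sw U r (\<lambda>s d. counit H s \<odot>\<^bsub>U\<^esub> f (?m p (?S d)) \<one>\<^bsub>H\<^esub>))"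
    by (intro sw_cong sw_antipode_right) (intro intros | simp)+
  also have "\<dots> = sw U t (\<lambda>p r. f (?m p (?S r)) \<one>\<^bsub>H\<^esub>)"
    by (intro sw_cong sw_counit_left) (intro intros | simp)+
  also have "\<dots> = counit H t \<odot>\<^bsub>U\<^esub> f \<one>\<^bsub>H\<^esub> \<one>\<^bsub>H\<^esub>"
    by (rule sw_antipode_right) (intro intros | simp)+
  finally show ?thesis .
qed

text \<open>\<open>\<Delta> \<circ> S\<close> is a left convolution inverse of
  \<open>\<Delta>\<close>, and \<open>sw_antipode_nested\<close> provides a right one. Evaluating
  \<open>?Q\<close> in the two possible orders shows that they coincide.\<close>

lemma sw_antipode:
  assumes U: "module K U" and b: "bilinear K H H U f" and x: "x \<in> carrier H"
  shows "sw U (antipode H x) f = sw U x (\<lambda>a c. f (antipode H c) (antipode H a))"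
proof -
  note [simp] = H_mod U x bilinearD(3)[OF b]
  interpret U: module K U by (rule U)
  note intros = linear_intros linear_map_comp[OF bilinearD(1)[OF b]] linear_map_comp[OF bilinearD(2)[OF b]]
  let ?S = "antipode H" and ?m = "\<lambda>a b. a \<otimes>\<^bsub>H\<^esub> b"
  \<comment> \<open>\<open>?G y w\<close> is \<open>f\<close> applied to the product of
    \<open>\<Delta> y\<close> with \<open>S(w\<^sub>2) \<otimes> S(w\<^sub>1)\<close>.\<close>
  let ?G = "\<lambda>y w. sw U y (\<lambda>p q. sw U w (\<lambda>c d. f (?m p (?S d)) (?m q (?S c))))"
  let ?Q = "sw U x (\<lambda>s t. sw U s (\<lambda>a b. ?G (?m (?S a) b) t))"
  have "?Q = sw U x (\<lambda>s t. counit H s \<odot>\<^bsub>U\<^esub> ?G \<one>\<^bsub>H\<^esub> t)"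
    by (intro sw_cong sw_antipode_left) (intro intros | simp)+
  also have "\<dots> = ?G \<one>\<^bsub>H\<^esub> x"
    by (rule sw_counit_left) (intro intros | simp)+
  also have "\<dots> = sw U x (\<lambda>c d. f (?m \<one>\<^bsub>H\<^esub> (?S d)) (?m \<one>\<^bsub>H\<^esub> (?S c)))"
    by (rule sw_one) (intro intros | simp)+
  also have "\<dots> = sw U x (\<lambda>a c. f (?S c) (?S a))"
    by (simp cong: sw_cong)
  finally have Q: "?Q = sw U x (\<lambda>a c. f (?S c) (?S a))" .
  have G: "sw U t (\<lambda>v w. ?G (?m (?S s) v) w) = counit H t \<odot>\<^bsub>U\<^esub> sw U (?S s) f"
    if s: "s \<in> carrier H" "t \<in> carrier H" for s t
  proof -
    note [simp] = s
    let ?M = "\<lambda>k l v w. sw U v (\<lambda>p q. sw U w (\<lambda>c d. f (?m k (?m p (?S d))) (?m l (?m q (?S c)))))"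
    have "sw U t (\<lambda>v w. ?G (?m (?S s) v) w)
        = sw U t (\<lambda>v w. sw U (?S s) (\<lambda>k l. sw U v (\<lambda>p q.
            sw U w (\<lambda>c d. f (?m (?m k p) (?S d)) (?m (?m l q) (?S c))))))"
      by (intro sw_cong sw_mult) (intro intros | simp)+
    also have "\<dots> = sw U t (\<lambda>v w. sw U (?S s) (\<lambda>k l. ?M k l v w))"
      by (simp add: H.m_assoc cong: sw_cong)
    also have "\<dots> = sw U (?S s) (\<lambda>k l. sw U t (\<lambda>v w. ?M k l v w))"
      by (rule sw_swap) simp_all
    also have "\<dots> = sw U (?S s) (\<lambda>k l. counit H t \<odot>\<^bsub>U\<^esub> f (?m k \<one>\<^bsub>H\<^esub>) (?m l \<one>\<^bsub>H\<^esub>))"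
      by (intro sw_cong sw_antipode_nested[where f = "\<lambda>u v. f (?m _ u) (?m _ v)"]) (intro intros | simp)+
    also have "\<dots> = sw U (?S s) (\<lambda>k l. counit H t \<odot>\<^bsub>U\<^esub> f k l)"
      by (simp cong: sw_cong)
    also have "\<dots> = counit H t \<odot>\<^bsub>U\<^esub> sw U (?S s) f"
      by (rule linear_map_sw_out[symmetric]) (intro linear_intros | simp)+
    finally show ?thesis .
  qed
  have "?Q = sw U x (\<lambda>s t. sw U t (\<lambda>v w. ?G (?m (?S s) v) w))"
    by (rule sw_coassoc) (intro intros | simp)+
  also have "\<dots> = sw U x (\<lambda>s t. counit H t \<odot>\<^bsub>U\<^esub> sw U (?S s) f)"
    by (simp add: G cong: sw_cong)
  also have "\<dots> = sw U (?S x) f"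
    by (rule sw_counit_right) (intro intros b | simp)+
  finally show ?thesis using Q by simp
qed

end

section \<open>Hopf algebras with a left integral\<close>

locale hopf_integral = hopf_algebra K H for K :: "('k, 'r) ring_scheme" and H :: "('k, 'h, 'm) hopf_scheme" +
  fixes I :: "'h \<Rightarrow> 'k"
  assumes integral: "left_integral K H I"
begin

lemma I_linear: "linear_map K H (scalars K) I"
  using integral by (simp add: left_integral_def)

lemma I_closed [simp]: "x \<in> carrier H \<Longrightarrow> I x \<in> carrier K"
  using linear_mapD(1)[OF I_linear] by simp

lemma I_nonzero: obtains x where "x \<in> carrier H" "I x \<noteq> \<zero>\<^bsub>K\<^esub>"
  using integral by (auto simp: left_integral_def)

lemmas I_intros = linear_intros linear_map_comp[OF I_linear]

lemma sw_integral:
  assumes U: "module K U" and g: "linear_map K H U g" and x: "x \<in> carrier H"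
  shows "sw U x (\<lambda>a b. I b \<odot>\<^bsub>U\<^esub> g a) = I x \<odot>\<^bsub>U\<^esub> g \<one>\<^bsub>H\<^esub>"
proof -
  have "sw H x (\<lambda>a b. I b \<odot>\<^bsub>H\<^esub> a) = I x \<odot>\<^bsub>H\<^esub> \<one>\<^bsub>H\<^esub>"
    using integral x
    by (subst sw_eq_lift) (intro I_intros | simp add: left_integral_def)+
  then have "I x \<odot>\<^bsub>U\<^esub> g \<one>\<^bsub>H\<^esub> = sw U x (\<lambda>a b. g (I b \<odot>\<^bsub>H\<^esub> a))"
    using linear_map_sw_out[OF g H_mod U x, of "\<lambda>a b. I b \<odot>\<^bsub>H\<^esub> a"] x
    by (simp add: linear_mapD(3)[OF g])
  also have "\<dots> = sw U x (\<lambda>a b. I b \<odot>\<^bsub>U\<^esub> g a)"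
    by (intro sw_cong x) (simp add: linear_mapD(3)[OF g])
  finally show ?thesis by simp
qed

text \<open>Invariance of \<open>I\<close> applied to \<open>y S(a)\<close> gives \<open>I(y S(a)) b
  = I(y\<^sub>2 S(a\<^sub>1)) y\<^sub>1 S(a\<^sub>2) b\<close>, because \<open>S\<close> reverses
  coproducts; with \<open>a\<close>, \<open>b\<close> the components of \<open>h\<close>, the factor
  \<open>S(h\<^sub>2) h\<^sub>3\<close> cancels.\<close>

lemma integral_antipode_slide:
  assumes y: "y \<in> carrier H" and h: "h \<in> carrier H"
  shows "sw H h (\<lambda>a b. I (y \<otimes>\<^bsub>H\<^esub> antipode H a) \<odot>\<^bsub>H\<^esub> b) = sw H y (\<lambda>c d. I (d \<otimes>\<^bsub>H\<^esub> antipode H h) \<odot>\<^bsub>H\<^esub> c)"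
proof -
  note [simp] = H_mod y h
  let ?S = "antipode H" and ?m = "\<lambda>a b. a \<otimes>\<^bsub>H\<^esub> b"
  have 1: "I (?m y (?S a)) \<odot>\<^bsub>H\<^esub> b
      = sw H y (\<lambda>v w. sw H a (\<lambda>c d. I (?m w (?S c)) \<odot>\<^bsub>H\<^esub> ?m v (?m (?S d) b)))"
    if ab: "a \<in> carrier H" "b \<in> carrier H" for a b
  proof -
    note [simp] = ab
    have "I (?m y (?S a)) \<odot>\<^bsub>H\<^esub> b = sw H (?m y (?S a)) (\<lambda>p q. I q \<odot>\<^bsub>H\<^esub> ?m p b)"
      by (subst sw_integral) (intro I_intros | simp)+
    also have "\<dots> = sw H y (\<lambda>v w. sw H (?S a) (\<lambda>p q. I (?m w q) \<odot>\<^bsub>H\<^esub> ?m (?m v p) b))"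
      by (rule sw_mult) (intro I_intros | simp)+
    also have "\<dots> = sw H y (\<lambda>v w. sw H a (\<lambda>c d. I (?m w (?S c)) \<odot>\<^bsub>H\<^esub> ?m (?m v (?S d)) b))"
      by (intro sw_cong sw_antipode) (intro I_intros | simp)+
    finally show ?thesis by (simp add: H.m_assoc cong: sw_cong)
  qed
  have "sw H h (\<lambda>a b. I (?m y (?S a)) \<odot>\<^bsub>H\<^esub> b)
      = sw H h (\<lambda>a b. sw H y (\<lambda>v w. sw H a (\<lambda>c d. I (?m w (?S c)) \<odot>\<^bsub>H\<^esub> ?m v (?m (?S d) b))))"
    by (intro sw_cong 1) simp_all
  also have "\<dots> = sw H y (\<lambda>v w. sw H h (\<lambda>a b. sw H a (\<lambda>c d. I (?m w (?S c)) \<odot>\<^bsub>H\<^esub> ?m v (?m (?S d) b))))"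
    by (rule sw_swap) simp_all
  also have "\<dots> = sw H y (\<lambda>v w. sw H h (\<lambda>c r. sw H r (\<lambda>d b. I (?m w (?S c)) \<odot>\<^bsub>H\<^esub> ?m v (?m (?S d) b))))"
    by (intro sw_cong sw_coassoc) (intro I_intros | simp)+
  also have "\<dots> = sw H y (\<lambda>v w. sw H h (\<lambda>c r. counit H r \<odot>\<^bsub>H\<^esub> (I (?m w (?S c)) \<odot>\<^bsub>H\<^esub> ?m v \<one>\<^bsub>H\<^esub>)))"
    by (intro sw_cong sw_antipode_left) (intro I_intros | simp)+
  also have "\<dots> = sw H y (\<lambda>v w. I (?m w (?S h)) \<odot>\<^bsub>H\<^esub> ?m v \<one>\<^bsub>H\<^esub>)"
    by (intro sw_cong sw_counit_right) (intro I_intros | simp)+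
  also have "\<dots> = sw H y (\<lambda>c d. I (?m d (?S h)) \<odot>\<^bsub>H\<^esub> c)"
    by (simp cong: sw_cong)
  finally show ?thesis .
qed

end

section \<open>Faithfulness of the integral\<close>

lemma (in module) smult_eq_zero_cancel:
  assumes "field R" "a \<in> carrier R" "x \<in> carrier M" "a \<odot>\<^bsub>M\<^esub> x = \<zero>\<^bsub>M\<^esub>" "a \<noteq> \<zero>\<^bsub>R\<^esub>"
  shows "x = \<zero>\<^bsub>M\<^esub>"
proof -
  have a: "a \<in> Units R" using field.field_Units[OF assms(1)] assms(2,5) by auto
  have "x = (inv\<^bsub>R\<^esub> a \<otimes>\<^bsub>R\<^esub> a) \<odot>\<^bsub>M\<^esub> x" using a assms(3) by simp
  also have "\<dots> = inv\<^bsub>R\<^esub> a \<odot>\<^bsub>M\<^esub> (a \<odot>\<^bsub>M\<^esub> x)"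
    using a assms(2,3) by (intro smult_assoc1) auto
  also have "\<dots> = \<zero>\<^bsub>M\<^esub>" using a assms(4) by simp
  finally show ?thesis .
qed

context hopf_algebra
begin

text \<open>The premises say that \<open>\<Delta> x\<close> lies in \<open>N \<otimes> H\<close>,
  where \<open>N\<close> is the common kernel of the functionals \<open>g i\<close>; the conclusion
  tests this with a bilinear map that vanishes on \<open>N \<times> H\<close>.\<close>

lemma sw_vanish_left:
  assumes U: "module K U" and b: "bilinear K H H U f" and x: "x \<in> carrier H"
    and "\<And>i. i \<in> J \<Longrightarrow> linear_map K H (scalars K) (g i)"
    and "\<And>i. i \<in> J \<Longrightarrow> sw H x (\<lambda>a b. g i a \<odot>\<^bsub>H\<^esub> b) = \<zero>\<^bsub>H\<^esub>"
    and "\<And>a b. a \<in> carrier H \<Longrightarrow> b \<in> carrier H \<Longrightarrow> (\<And>i. i \<in> J \<Longrightarrow> g i a = \<zero>\<^bsub>K\<^esub>) \<Longrightarrow> f a b = \<zero>\<^bsub>U\<^esub>"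
  shows "sw U x f = \<zero>\<^bsub>U\<^esub>"
proof -
  have "sw U x f \<in> {\<zero>\<^bsub>U\<^esub>}"
    unfolding sw_def
    by (rule tsum_mem_left[OF K.field_axioms H_mod H_mod U comult_closed[OF x] b
          zero_submodule[OF H_mod] zero_submodule[OF U], where G = "g ` J"])
      (use assms(4-6) linear_map_zero[OF H_mod U bilinearD(2)[OF b]] in \<open>auto simp: sw_def\<close>)
  then show ?thesis by simp
qed

lemma sw_vanish_right:
  assumes U: "module K U" and b: "bilinear K H H U f" and x: "x \<in> carrier H"
    and "\<And>i. i \<in> J \<Longrightarrow> linear_map K H (scalars K) (g i)"
    and "\<And>i. i \<in> J \<Longrightarrow> sw H x (\<lambda>a b. g i b \<odot>\<^bsub>H\<^esub> a) = \<zero>\<^bsub>H\<^esub>"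
    and "\<And>a b. a \<in> carrier H \<Longrightarrow> b \<in> carrier H \<Longrightarrow> (\<And>i. i \<in> J \<Longrightarrow> g i b = \<zero>\<^bsub>K\<^esub>) \<Longrightarrow> f a b = \<zero>\<^bsub>U\<^esub>"
  shows "sw U x f = \<zero>\<^bsub>U\<^esub>"
proof -
  have "sw U x f \<in> {\<zero>\<^bsub>U\<^esub>}"
    unfolding sw_def
    by (rule tsum_mem_right[OF K.field_axioms H_mod H_mod U comult_closed[OF x] b
          zero_submodule[OF H_mod] zero_submodule[OF U], where G = "g ` J"])
      (use assms(4-6) linear_map_zero[OF H_mod U bilinearD(1)[OF b]] in \<open>auto simp: sw_def\<close>)
  then show ?thesis by simp
qed

end

context hopf_integral
begin

lemma sw_integral_slide:
  assumes U: "module K U" and g: "linear_map K H U g" and y: "y \<in> carrier H" and h: "h \<in> carrier H"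
  shows "sw U h (\<lambda>a b. I (y \<otimes>\<^bsub>H\<^esub> antipode H a) \<odot>\<^bsub>U\<^esub> g b) = sw U y (\<lambda>c d. I (d \<otimes>\<^bsub>H\<^esub> antipode H h) \<odot>\<^bsub>U\<^esub> g c)"
proof -
  have "sw U h (\<lambda>a b. I (y \<otimes>\<^bsub>H\<^esub> antipode H a) \<odot>\<^bsub>U\<^esub> g b)
      = sw U h (\<lambda>a b. g (I (y \<otimes>\<^bsub>H\<^esub> antipode H a) \<odot>\<^bsub>H\<^esub> b))"
    using y h by (intro sw_cong) (simp_all add: linear_mapD(3)[OF g])
  also have "\<dots> = g (sw H h (\<lambda>a b. I (y \<otimes>\<^bsub>H\<^esub> antipode H a) \<odot>\<^bsub>H\<^esub> b))"
    using y h by (intro linear_map_sw_out[OF g H_mod U, symmetric]) simp_all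
  also have "\<dots> = g (sw H y (\<lambda>c d. I (d \<otimes>\<^bsub>H\<^esub> antipode H h) \<odot>\<^bsub>H\<^esub> c))"
    by (simp add: integral_antipode_slide[OF y h])
  also have "\<dots> = sw U y (\<lambda>c d. g (I (d \<otimes>\<^bsub>H\<^esub> antipode H h) \<odot>\<^bsub>H\<^esub> c))"
    using y h by (intro linear_map_sw_out[OF g H_mod U]) simp_all
  also have "\<dots> = sw U y (\<lambda>c d. I (d \<otimes>\<^bsub>H\<^esub> antipode H h) \<odot>\<^bsub>U\<^esub> g c)"
    using y h by (intro sw_cong) (simp_all add: linear_mapD(3)[OF g])
  finally show ?thesis .
qed

text \<open>By \<open>sw_integral_slide\<close> the coproduct of \<open>x\<close> lies in \<open>N \<otimes> H\<close>, where \<open>N\<close> is the right ideal of all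
  \<open>x\<close> as in the assumption; hence \<open>x\<^sub>1 S(x\<^sub>2) \<otimes> x\<^sub>3 = 1 \<otimes> x\<close> lies in \<open>N \<otimes> H\<close> as well.\<close>

lemma integral_antipode_faithful:
  assumes x: "x \<in> carrier H" and zero: "\<And>f. f \<in> carrier H \<Longrightarrow> I (f \<otimes>\<^bsub>H\<^esub> antipode H x) = \<zero>\<^bsub>K\<^esub>"
  shows "x = \<zero>\<^bsub>H\<^esub>"
proof -
  note [simp] = H_mod x
  let ?S = "antipode H" and ?m = "\<lambda>a b. a \<otimes>\<^bsub>H\<^esub> b"
  obtain f where f [simp]: "f \<in> carrier H" "I f \<noteq> \<zero>\<^bsub>K\<^esub>" by (rule I_nonzero)
  \<comment> \<open>The sum is \<open>I(f S(x\<^sub>1 S(x\<^sub>2))) x\<^sub>3\<close>. It vanishes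
    because, with \<open>g = f S(S(c))\<close>, each coefficient is a value of the functional
    \<open>I(g S(\<cdot>))\<close>; this is the right ideal property of \<open>N\<close>.\<close>
  have "sw H x (\<lambda>a b. sw H b (\<lambda>c d. I (?m (?m f (?S (?S c))) (?S a)) \<odot>\<^bsub>H\<^esub> d)) = \<zero>\<^bsub>H\<^esub>"
  proof (rule sw_vanish_left[where J = "carrier H" and g = "\<lambda>g a. I (?m g (?S a))"])
    show "sw H x (\<lambda>a b. I (?m g (?S a)) \<odot>\<^bsub>H\<^esub> b) = \<zero>\<^bsub>H\<^esub>" if "g \<in> carrier H" for g
      using that by (simp add: integral_antipode_slide zero sw_zero cong: sw_cong)
    show "sw H b (\<lambda>c d. I (?m (?m f (?S (?S c))) (?S a)) \<odot>\<^bsub>H\<^esub> d) = \<zero>\<^bsub>H\<^esub>"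
      if "a \<in> carrier H" "b \<in> carrier H" "\<And>g. g \<in> carrier H \<Longrightarrow> I (?m g (?S a)) = \<zero>\<^bsub>K\<^esub>" for a b
      using that by (simp add: sw_zero cong: sw_cong)
  qed (intro I_intros | simp)+
  also have "sw H x (\<lambda>a b. sw H b (\<lambda>c d. I (?m (?m f (?S (?S c))) (?S a)) \<odot>\<^bsub>H\<^esub> d))
      = sw H x (\<lambda>s d. sw H s (\<lambda>a c. I (?m (?m f (?S (?S c))) (?S a)) \<odot>\<^bsub>H\<^esub> d))"
    by (rule sw_coassoc[symmetric]) (intro I_intros | simp)+
  also have "\<dots> = sw H x (\<lambda>s d. sw H s (\<lambda>a c. I (?m f (?S (?m a (?S c)))) \<odot>\<^bsub>H\<^esub> d))"
    by (simp add: antipode_mult H.m_assoc cong: sw_cong)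
  also have "\<dots> = sw H x (\<lambda>s d. counit H s \<odot>\<^bsub>H\<^esub> (I (?m f (?S \<one>\<^bsub>H\<^esub>)) \<odot>\<^bsub>H\<^esub> d))"
    by (intro sw_cong sw_antipode_right) (intro I_intros | simp)+
  also have "\<dots> = I (?m f (?S \<one>\<^bsub>H\<^esub>)) \<odot>\<^bsub>H\<^esub> x"
    by (rule sw_counit_left) (intro I_intros | simp)+
  finally have "I f \<odot>\<^bsub>H\<^esub> x = \<zero>\<^bsub>H\<^esub>" by (simp add: antipode_one)
  then show ?thesis using mod.smult_eq_zero_cancel[OF K.field_axioms I_closed[OF f(1)] x] f(2) by blast
qed

lemma antipode_injective:
  assumes "x \<in> carrier H" "antipode H x = \<zero>\<^bsub>H\<^esub>"
  shows "x = \<zero>\<^bsub>H\<^esub>"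
  using assms linear_map_zero[OF H_mod S_mod I_linear]
  by (intro integral_antipode_faithful) simp_all

text \<open>A right integral: the projection of \<open>I(u S(\<cdot>))\<close> to the coinvariants of the Hopf module of
  rational functionals.\<close>

definition right_int :: "'h \<Rightarrow> 'h \<Rightarrow> 'k" where
  "right_int u h = sw (scalars K) u (\<lambda>c d.
    I (d \<otimes>\<^bsub>H\<^esub> (antipode H h \<otimes>\<^bsub>H\<^esub> antipode H (antipode H (antipode H c)))))"

lemma right_int_linear: "u \<in> carrier H \<Longrightarrow> linear_map K H (scalars K) (right_int u)"
  unfolding right_int_def by (intro I_intros | simp)+

text \<open>With \<open>\<phi> u h = I(u S(h))\<close>, the definition reads
  \<open>right_int u h = \<phi> u\<^sub>2 (S\<^sup>2(u\<^sub>1) h)\<close>. The slide identity for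
  the argument \<open>S\<^sup>2(u\<^sub>1) h\<close> needs both components of its coproduct, while
  only the first is present; the second is supplied by inserting a factor that cancels to
  one.\<close>

lemma right_int_invariant:
  assumes u: "u \<in> carrier H" and h: "h \<in> carrier H"
  shows "sw H h (\<lambda>a b. right_int u a \<odot>\<^bsub>H\<^esub> b) = right_int u h \<odot>\<^bsub>H\<^esub> \<one>\<^bsub>H\<^esub>"
proof -
  note [simp] = H_mod S_mod u h
  let ?S = "antipode H" and ?m = "\<lambda>a b. a \<otimes>\<^bsub>H\<^esub> b"
  \<comment> \<open>\<open>S(g) S(S(g'))\<close> is the inserted factor: it equals
    \<open>S(S(g') g)\<close>, which for consecutive components \<open>g'\<close>, \<open>g\<close>
    cancels to the counit.\<close>
  let ?W = "\<lambda>a b d e g' g. I (?m d (?S (?m (?S (?S e)) a))) \<odot>\<^bsub>H\<^esub> ?m (?S g) (?m (?S (?S g')) b)"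
  have smult_out: "sw (scalars K) z f \<odot>\<^bsub>H\<^esub> b = sw H z (\<lambda>c d. f c d \<odot>\<^bsub>H\<^esub> b)"
    if "b \<in> carrier H" "z \<in> carrier H" "\<And>c d. c \<in> carrier H \<Longrightarrow> d \<in> carrier H \<Longrightarrow> f c d \<in> carrier K" for b f z
    using that by (intro linear_map_sw_out linear_map_smult_left linear_map_id) simp_all
  have 1: "I (?m d (?m (?S a) (?S (?S (?S c))))) \<odot>\<^bsub>H\<^esub> b = sw H c (\<lambda>z g. sw H z (\<lambda>e g'. ?W a b d e g' g))"
    if abcd: "a \<in> carrier H" "b \<in> carrier H" "c \<in> carrier H" "d \<in> carrier H" for a b c d
  proof -
    note [simp] = abcd
    have "sw H c (\<lambda>z g. sw H z (\<lambda>e g'. ?W a b d e g' g)) = sw H c (\<lambda>e t. sw H t (\<lambda>g' g. ?W a b d e g' g))"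
      by (rule sw_coassoc) (intro I_intros | simp)+
    also have "\<dots> = sw H c (\<lambda>e t. sw H t (\<lambda>g' g.
        I (?m d (?S (?m (?S (?S e)) a))) \<odot>\<^bsub>H\<^esub> ?m (?S (?m (?S g') g)) b))"
      by (simp add: antipode_mult H.m_assoc cong: sw_cong)
    also have "\<dots> = sw H c (\<lambda>e t. counit H t \<odot>\<^bsub>H\<^esub> (I (?m d (?S (?m (?S (?S e)) a))) \<odot>\<^bsub>H\<^esub> ?m (?S \<one>\<^bsub>H\<^esub>) b))"
      by (intro sw_cong sw_antipode_left) (intro I_intros | simp)+
    also have "\<dots> = I (?m d (?S (?m (?S (?S c)) a))) \<odot>\<^bsub>H\<^esub> ?m (?S \<one>\<^bsub>H\<^esub>) b"
      by (rule sw_counit_right) (intro I_intros | simp)+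
    finally show ?thesis by (simp add: antipode_mult antipode_one)
  qed
  \<comment> \<open>\<open>S\<^sup>2\<close> preserves coproducts, so \<open>e\<close>,
    \<open>g'\<close>, \<open>a\<close>, \<open>b\<close> assemble into the coproduct of
    \<open>S\<^sup>2(z) h\<close>, and the slide trades it for the coproduct of \<open>d\<close>.
    Afterwards \<open>S(g)\<close> meets the component \<open>d1\<close> that follows it in
    \<open>u\<close>, and the two cancel.\<close>
  have 2: "sw H h (\<lambda>a b. sw H z (\<lambda>e g'. ?W a b d e g' g))
      = sw H d (\<lambda>d1 d2. I (?m d2 (?S (?m (?S (?S z)) h))) \<odot>\<^bsub>H\<^esub> ?m (?S g) d1)"
    if zdg: "z \<in> carrier H" "d \<in> carrier H" "g \<in> carrier H" for z d g
  proof -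
    note [simp] = zdg
    let ?k = "?m (?S (?S z)) h"
    have "sw H ?k (\<lambda>p q. I (?m d (?S p)) \<odot>\<^bsub>H\<^esub> ?m (?S g) q)
        = sw H (?S (?S z)) (\<lambda>p q. sw H h (\<lambda>a b. I (?m d (?S (?m p a))) \<odot>\<^bsub>H\<^esub> ?m (?S g) (?m q b)))"
      by (rule sw_mult) (intro I_intros | simp)+
    also have "\<dots> = sw H (?S z) (\<lambda>q p. sw H h (\<lambda>a b. I (?m d (?S (?m (?S p) a))) \<odot>\<^bsub>H\<^esub> ?m (?S g) (?m (?S q) b)))"
      by (rule sw_antipode) (intro I_intros | simp)+
    also have "\<dots> = sw H z (\<lambda>e g'. sw H h (\<lambda>a b. ?W a b d e g' g))"
      by (rule sw_antipode) (intro I_intros | simp)+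
    also have "\<dots> = sw H h (\<lambda>a b. sw H z (\<lambda>e g'. ?W a b d e g' g))"
      by (rule sw_swap) simp_all
    finally show ?thesis
      by (subst (asm) sw_integral_slide) (intro I_intros | simp)+
  qed
  have "sw H h (\<lambda>a b. right_int u a \<odot>\<^bsub>H\<^esub> b)
      = sw H h (\<lambda>a b. sw H u (\<lambda>c d. I (?m d (?m (?S a) (?S (?S (?S c))))) \<odot>\<^bsub>H\<^esub> b))"
    by (simp add: right_int_def smult_out cong: sw_cong)
  also have "\<dots> = sw H h (\<lambda>a b. sw H u (\<lambda>c d. sw H c (\<lambda>z g. sw H z (\<lambda>e g'. ?W a b d e g' g))))"
    by (intro sw_cong 1) simp_all
  also have "\<dots> = sw H u (\<lambda>c d. sw H h (\<lambda>a b. sw H c (\<lambda>z g. sw H z (\<lambda>e g'. ?W a b d e g' g))))"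
    by (rule sw_swap) simp_all
  also have "\<dots> = sw H u (\<lambda>c d. sw H c (\<lambda>z g. sw H h (\<lambda>a b. sw H z (\<lambda>e g'. ?W a b d e g' g))))"
    by (intro sw_cong sw_swap) simp_all
  also have "\<dots> = sw H u (\<lambda>c d. sw H c (\<lambda>z g.
      sw H d (\<lambda>d1 d2. I (?m d2 (?S (?m (?S (?S z)) h))) \<odot>\<^bsub>H\<^esub> ?m (?S g) d1)))"
    by (intro sw_cong 2) simp_all
  also have "\<dots> = sw H u (\<lambda>z r. sw H r (\<lambda>g d.
      sw H d (\<lambda>d1 d2. I (?m d2 (?S (?m (?S (?S z)) h))) \<odot>\<^bsub>H\<^esub> ?m (?S g) d1)))"
    by (rule sw_coassoc) (intro I_intros | simp)+
  also have "\<dots> = sw H u (\<lambda>z r. sw H r (\<lambda>s d2.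
      sw H s (\<lambda>g d1. I (?m d2 (?S (?m (?S (?S z)) h))) \<odot>\<^bsub>H\<^esub> ?m (?S g) d1)))"
    by (intro sw_cong sw_coassoc[symmetric]) (intro I_intros | simp)+
  also have "\<dots> = sw H u (\<lambda>z r. sw H r (\<lambda>s d2.
      counit H s \<odot>\<^bsub>H\<^esub> (I (?m d2 (?S (?m (?S (?S z)) h))) \<odot>\<^bsub>H\<^esub> \<one>\<^bsub>H\<^esub>)))"
    by (intro sw_cong sw_antipode_left) (intro I_intros | simp)+
  also have "\<dots> = sw H u (\<lambda>z r. I (?m r (?S (?m (?S (?S z)) h))) \<odot>\<^bsub>H\<^esub> \<one>\<^bsub>H\<^esub>)"
    by (intro sw_cong sw_counit_left) (intro I_intros | simp)+
  also have "\<dots> = right_int u h \<odot>\<^bsub>H\<^esub> \<one>\<^bsub>H\<^esub>"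
    by (simp add: right_int_def smult_out antipode_mult cong: sw_cong)
  finally show ?thesis .
qed

text \<open>In a Hopf module the coaction components, acting on the projections to the coinvariants,
  give back the element. This is that formula for the functional \<open>I(u S(\<cdot>))\<close>,
  evaluated at the unit; it prevents the functionals \<open>right_int u\<close> from all being
  zero.\<close>

lemma right_int_recover:
  assumes u: "u \<in> carrier H"
  shows "sw (scalars K) u (\<lambda>c d. right_int d (antipode H c)) = I u"
proof -
  note [simp] = H_mod S_mod u
  let ?S = "antipode H" and ?m = "\<lambda>a b. a \<otimes>\<^bsub>H\<^esub> b"
  have "sw (scalars K) u (\<lambda>c d. right_int d (?S c))
      = sw (scalars K) u (\<lambda>c d. sw (scalars K) d (\<lambda>e g. I (?m g (?m (?S (?S c)) (?S (?S (?S e)))))))"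
    by (simp add: right_int_def)
  also have "\<dots> = sw (scalars K) u (\<lambda>s g. sw (scalars K) s (\<lambda>c e. I (?m g (?m (?S (?S c)) (?S (?S (?S e)))))))"
    by (rule sw_coassoc[symmetric]) (intro I_intros | simp)+
  also have "\<dots> = sw (scalars K) u (\<lambda>s g. sw (scalars K) s (\<lambda>c e. I (?m g (?S (?S (?m c (?S e)))))))"
    by (simp add: antipode_mult cong: sw_cong)
  also have "\<dots> = sw (scalars K) u (\<lambda>s g. counit H s \<odot>\<^bsub>scalars K\<^esub> I (?m g (?S (?S \<one>\<^bsub>H\<^esub>))))"
    by (intro sw_cong sw_antipode_right) (intro I_intros | simp)+
  also have "\<dots> = I (?m u (?S (?S \<one>\<^bsub>H\<^esub>)))"
    by (rule sw_counit_left) (intro I_intros | simp)+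
  finally show ?thesis by (simp add: antipode_one)
qed

lemma right_int_nonzero: "\<exists>u \<in> carrier H. \<exists>h \<in> carrier H. right_int u h \<noteq> \<zero>\<^bsub>K\<^esub>"
proof (rule ccontr)
  assume "\<not> ?thesis"
  then have zero: "right_int u h = \<zero>\<^bsub>K\<^esub>" if "u \<in> carrier H" "h \<in> carrier H" for u h
    using that by blast
  obtain x where x: "x \<in> carrier H" "I x \<noteq> \<zero>\<^bsub>K\<^esub>" by (rule I_nonzero)
  have "sw (scalars K) x (\<lambda>c d. right_int d (antipode H c)) = sw (scalars K) x (\<lambda>c d. \<zero>\<^bsub>scalars K\<^esub>)"
    using x zero by (intro sw_cong) simp_all
  then show False
    using right_int_recover[OF x(1)] x(2) by (simp only: sw_zero[OF S_mod]) simp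
qed

section \<open>Comparing the left integral with a right integral\<close>

context
  fixes R
  assumes R_linear: "linear_map K H (scalars K) R"
    and R_invariant: "\<And>x. x \<in> carrier H \<Longrightarrow> sw H x (\<lambda>a b. R a \<odot>\<^bsub>H\<^esub> b) = R x \<odot>\<^bsub>H\<^esub> \<one>\<^bsub>H\<^esub>"
    and R_nonzero: "\<exists>x \<in> carrier H. R x \<noteq> \<zero>\<^bsub>K\<^esub>"
begin

lemma R_closed: "x \<in> carrier H \<Longrightarrow> R x \<in> carrier K"
  using linear_mapD(1)[OF R_linear] by simp

lemmas R_intros = I_intros linear_map_comp[OF R_linear]

lemma sw_right_integral:
  assumes U: "module K U" and g: "linear_map K H U g" and x: "x \<in> carrier H"
  shows "sw U x (\<lambda>a b. R a \<odot>\<^bsub>U\<^esub> g b) = R x \<odot>\<^bsub>U\<^esub> g \<one>\<^bsub>H\<^esub>"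
proof -
  have "R x \<odot>\<^bsub>U\<^esub> g \<one>\<^bsub>H\<^esub> = sw U x (\<lambda>a b. g (R a \<odot>\<^bsub>H\<^esub> b))"
    using linear_map_sw_out[OF g H_mod U x, of "\<lambda>a b. R a \<odot>\<^bsub>H\<^esub> b"] x R_closed
    by (simp add: linear_mapD(3)[OF g] R_invariant)
  also have "\<dots> = sw U x (\<lambda>a b. R a \<odot>\<^bsub>U\<^esub> g b)"
    by (intro sw_cong x) (simp add: linear_mapD(3)[OF g] R_closed)
  finally show ?thesis by simp
qed

text \<open>The mirror image of \<open>integral_antipode_slide\<close>: invariance of
  \<open>R\<close> applied to \<open>x b\<^sub>1\<close> and multiplied by the antipode of the
  remaining component leaves \<open>b\<^sub>2 S(b\<^sub>3)\<close> to cancel.\<close>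

lemma right_integral_slide:
  assumes x: "x \<in> carrier H" and b: "b \<in> carrier H"
  shows "sw H x (\<lambda>a c. R (a \<otimes>\<^bsub>H\<^esub> b) \<odot>\<^bsub>H\<^esub> c) = sw H b (\<lambda>c d. R (x \<otimes>\<^bsub>H\<^esub> c) \<odot>\<^bsub>H\<^esub> antipode H d)"
proof -
  note [simp] = H_mod x b R_closed
  let ?S = "antipode H" and ?m = "\<lambda>a b. a \<otimes>\<^bsub>H\<^esub> b"
  have 1: "R (?m x c) \<odot>\<^bsub>H\<^esub> ?S d = sw H x (\<lambda>a a'. sw H c (\<lambda>p q. R (?m a p) \<odot>\<^bsub>H\<^esub> ?m a' (?m q (?S d))))"
    if cd: "c \<in> carrier H" "d \<in> carrier H" for c d
  proof -
    note [simp] = cd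
    have "R (?m x c) \<odot>\<^bsub>H\<^esub> ?S d = sw H (?m x c) (\<lambda>p q. R p \<odot>\<^bsub>H\<^esub> ?m q (?S d))"
      by (subst sw_right_integral) (intro R_intros | simp)+
    also have "\<dots> = sw H x (\<lambda>a a'. sw H c (\<lambda>p q. R (?m a p) \<odot>\<^bsub>H\<^esub> ?m (?m a' q) (?S d)))"
      by (rule sw_mult) (intro R_intros | simp)+
    finally show ?thesis by (simp add: H.m_assoc cong: sw_cong)
  qed
  have "sw H b (\<lambda>c d. R (?m x c) \<odot>\<^bsub>H\<^esub> ?S d)
      = sw H b (\<lambda>c d. sw H x (\<lambda>a a'. sw H c (\<lambda>p q. R (?m a p) \<odot>\<^bsub>H\<^esub> ?m a' (?m q (?S d)))))"
    by (intro sw_cong 1) simp_all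
  also have "\<dots> = sw H x (\<lambda>a a'. sw H b (\<lambda>c d. sw H c (\<lambda>p q. R (?m a p) \<odot>\<^bsub>H\<^esub> ?m a' (?m q (?S d)))))"
    by (rule sw_swap) simp_all
  also have "\<dots> = sw H x (\<lambda>a a'. sw H b (\<lambda>p r. sw H r (\<lambda>q d. R (?m a p) \<odot>\<^bsub>H\<^esub> ?m a' (?m q (?S d)))))"
    by (intro sw_cong sw_coassoc) (intro R_intros | simp)+
  also have "\<dots> = sw H x (\<lambda>a a'. sw H b (\<lambda>p r. counit H r \<odot>\<^bsub>H\<^esub> (R (?m a p) \<odot>\<^bsub>H\<^esub> ?m a' \<one>\<^bsub>H\<^esub>)))"
    by (intro sw_cong sw_antipode_right) (intro R_intros | simp)+
  also have "\<dots> = sw H x (\<lambda>a a'. R (?m a b) \<odot>\<^bsub>H\<^esub> ?m a' \<one>\<^bsub>H\<^esub>)"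
    by (intro sw_cong sw_counit_right) (intro R_intros | simp)+
  finally show ?thesis by (simp cong: sw_cong)
qed

text \<open>The argument of \<open>integral_antipode_faithful\<close>, now with the right ideal
  \<open>N\<close> of all \<open>x\<close> such that \<open>R(x b) = 0\<close> for every
  \<open>b\<close>: the slide puts \<open>\<Delta> x\<close> into \<open>N \<otimes> H\<close>,
  which therefore contains
  \<open>x\<^sub>1 S(x\<^sub>2) \<otimes> x\<^sub>3 = 1 \<otimes> x\<close>.\<close>

lemma right_integral_faithful:
  assumes x: "x \<in> carrier H" and zero: "\<And>b. b \<in> carrier H \<Longrightarrow> R (x \<otimes>\<^bsub>H\<^esub> b) = \<zero>\<^bsub>K\<^esub>"
  shows "x = \<zero>\<^bsub>H\<^esub>"
proof -
  note [simp] = H_mod x R_closed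
  let ?S = "antipode H" and ?m = "\<lambda>a b. a \<otimes>\<^bsub>H\<^esub> b"
  obtain f where f [simp]: "f \<in> carrier H" "R f \<noteq> \<zero>\<^bsub>K\<^esub>" using R_nonzero by blast
  have "sw H x (\<lambda>a b. sw H b (\<lambda>c d. R (?m a (?m (?S c) f)) \<odot>\<^bsub>H\<^esub> d)) = \<zero>\<^bsub>H\<^esub>"
  proof (rule sw_vanish_left[where J = "carrier H" and g = "\<lambda>b a. R (?m a b)"])
    show "sw H x (\<lambda>a c. R (?m a b) \<odot>\<^bsub>H\<^esub> c) = \<zero>\<^bsub>H\<^esub>" if "b \<in> carrier H" for b
      using that by (simp add: right_integral_slide zero sw_zero cong: sw_cong)
    show "sw H b (\<lambda>c d. R (?m a (?m (?S c) f)) \<odot>\<^bsub>H\<^esub> d) = \<zero>\<^bsub>H\<^esub>"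
      if "a \<in> carrier H" "b \<in> carrier H" "\<And>g. g \<in> carrier H \<Longrightarrow> R (?m a g) = \<zero>\<^bsub>K\<^esub>" for a b
      using that by (simp add: sw_zero cong: sw_cong)
  qed (intro R_intros | simp)+
  also have "sw H x (\<lambda>a b. sw H b (\<lambda>c d. R (?m a (?m (?S c) f)) \<odot>\<^bsub>H\<^esub> d))
      = sw H x (\<lambda>s d. sw H s (\<lambda>a c. R (?m a (?m (?S c) f)) \<odot>\<^bsub>H\<^esub> d))"
    by (rule sw_coassoc[symmetric]) (intro R_intros | simp)+
  also have "\<dots> = sw H x (\<lambda>s d. sw H s (\<lambda>a c. R (?m (?m a (?S c)) f) \<odot>\<^bsub>H\<^esub> d))"
    by (simp add: H.m_assoc cong: sw_cong)
  also have "\<dots> = sw H x (\<lambda>s d. counit H s \<odot>\<^bsub>H\<^esub> (R (?m \<one>\<^bsub>H\<^esub> f) \<odot>\<^bsub>H\<^esub> d))"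
    by (intro sw_cong sw_antipode_right) (intro R_intros | simp)+
  also have "\<dots> = R (?m \<one>\<^bsub>H\<^esub> f) \<odot>\<^bsub>H\<^esub> x"
    by (rule sw_counit_left) (intro R_intros | simp)+
  finally have "R f \<odot>\<^bsub>H\<^esub> x = \<zero>\<^bsub>H\<^esub>" by simp
  then show ?thesis
    using mod.smult_eq_zero_cancel[OF K.field_axioms R_closed[OF f(1)] x] f(2) by blast
qed

text \<open>A second slide for \<open>I\<close>, with the antipode outside the integral: invariance
  is applied to \<open>a\<^sub>2 b\<close> and multiplied by \<open>S(a\<^sub>1)\<close> from the
  left.\<close>

lemma integral_slide:
  assumes a: "a \<in> carrier H" and b: "b \<in> carrier H"
  shows "sw H b (\<lambda>p q. I (a \<otimes>\<^bsub>H\<^esub> q) \<odot>\<^bsub>H\<^esub> p) = sw H a (\<lambda>c d. I (d \<otimes>\<^bsub>H\<^esub> b) \<odot>\<^bsub>H\<^esub> antipode H c)"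
proof -
  note [simp] = H_mod a b
  let ?S = "antipode H" and ?m = "\<lambda>a b. a \<otimes>\<^bsub>H\<^esub> b"
  have 1: "I (?m d b) \<odot>\<^bsub>H\<^esub> ?S c = sw H d (\<lambda>d1 d2. sw H b (\<lambda>p q. I (?m d2 q) \<odot>\<^bsub>H\<^esub> ?m (?m (?S c) d1) p))"
    if cd: "c \<in> carrier H" "d \<in> carrier H" for c d
  proof -
    note [simp] = cd
    have "I (?m d b) \<odot>\<^bsub>H\<^esub> ?S c = sw H (?m d b) (\<lambda>p q. I q \<odot>\<^bsub>H\<^esub> ?m (?S c) p)"
      by (subst sw_integral) (intro I_intros | simp)+
    also have "\<dots> = sw H d (\<lambda>d1 d2. sw H b (\<lambda>p q. I (?m d2 q) \<odot>\<^bsub>H\<^esub> ?m (?S c) (?m d1 p)))"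
      by (rule sw_mult) (intro I_intros | simp)+
    finally show ?thesis by (simp add: H.m_assoc cong: sw_cong)
  qed
  have "sw H a (\<lambda>c d. I (?m d b) \<odot>\<^bsub>H\<^esub> ?S c)
      = sw H a (\<lambda>c d. sw H d (\<lambda>d1 d2. sw H b (\<lambda>p q. I (?m d2 q) \<odot>\<^bsub>H\<^esub> ?m (?m (?S c) d1) p)))"
    by (intro sw_cong 1) simp_all
  also have "\<dots> = sw H a (\<lambda>s d2. sw H s (\<lambda>c d1. sw H b (\<lambda>p q. I (?m d2 q) \<odot>\<^bsub>H\<^esub> ?m (?m (?S c) d1) p)))"
    by (rule sw_coassoc[symmetric]) (intro I_intros | simp)+
  also have "\<dots> = sw H a (\<lambda>s d2. counit H s \<odot>\<^bsub>H\<^esub> sw H b (\<lambda>p q. I (?m d2 q) \<odot>\<^bsub>H\<^esub> ?m \<one>\<^bsub>H\<^esub> p))"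
    by (intro sw_cong sw_antipode_left) (intro I_intros | simp)+
  also have "\<dots> = sw H b (\<lambda>p q. I (?m a q) \<odot>\<^bsub>H\<^esub> ?m \<one>\<^bsub>H\<^esub> p)"
    by (rule sw_counit_left) (intro I_intros | simp)+
  finally show ?thesis by (simp cong: sw_cong)
qed

text \<open>Both sides are \<open>R(b\<^sub>1 y) I(a b\<^sub>2)\<close>.\<close>

lemma integrals_exchange:
  assumes a: "a \<in> carrier H" and b: "b \<in> carrier H" and y: "y \<in> carrier H"
  shows "sw (scalars K) a (\<lambda>c d. I (d \<otimes>\<^bsub>H\<^esub> b) \<otimes>\<^bsub>K\<^esub> R (antipode H c \<otimes>\<^bsub>H\<^esub> y))
    = sw (scalars K) y (\<lambda>c d. R (b \<otimes>\<^bsub>H\<^esub> c) \<otimes>\<^bsub>K\<^esub> I (a \<otimes>\<^bsub>H\<^esub> antipode H d))"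
proof -
  note [simp] = H_mod S_mod a b y R_closed
  let ?S = "antipode H" and ?m = "\<lambda>a b. a \<otimes>\<^bsub>H\<^esub> b"
  have RL: "linear_map K H (scalars K) (\<lambda>z. R (?m z y))" and IL: "linear_map K H (scalars K) (\<lambda>z. I (?m a z))"
    by (intro R_intros | simp)+
  have "sw (scalars K) a (\<lambda>c d. I (?m d b) \<otimes>\<^bsub>K\<^esub> R (?m (?S c) y))
      = sw (scalars K) a (\<lambda>c d. R (?m (I (?m d b) \<odot>\<^bsub>H\<^esub> ?S c) y))"
    by (intro sw_cong) (simp_all add: linear_mapD(3)[OF RL])
  also have "\<dots> = R (?m (sw H a (\<lambda>c d. I (?m d b) \<odot>\<^bsub>H\<^esub> ?S c)) y)"
    by (rule linear_map_sw_out[OF RL, symmetric]) simp_all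
  also have "\<dots> = R (?m (sw H b (\<lambda>p q. I (?m a q) \<odot>\<^bsub>H\<^esub> p)) y)"
    by (simp add: integral_slide)
  also have "\<dots> = sw (scalars K) b (\<lambda>p q. R (?m (I (?m a q) \<odot>\<^bsub>H\<^esub> p) y))"
    by (rule linear_map_sw_out[OF RL]) simp_all
  also have "\<dots> = sw (scalars K) b (\<lambda>p q. I (?m a (R (?m p y) \<odot>\<^bsub>H\<^esub> q)))"
    by (intro sw_cong) (simp_all add: linear_mapD(3)[OF RL] linear_mapD(3)[OF IL] K.m_comm)
  also have "\<dots> = I (?m a (sw H b (\<lambda>p q. R (?m p y) \<odot>\<^bsub>H\<^esub> q)))"
    by (rule linear_map_sw_out[OF IL, symmetric]) simp_all
  also have "\<dots> = I (?m a (sw H y (\<lambda>c d. R (?m b c) \<odot>\<^bsub>H\<^esub> ?S d)))"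
    by (simp add: right_integral_slide)
  also have "\<dots> = sw (scalars K) y (\<lambda>c d. I (?m a (R (?m b c) \<odot>\<^bsub>H\<^esub> ?S d)))"
    by (rule linear_map_sw_out[OF IL]) simp_all
  also have "\<dots> = sw (scalars K) y (\<lambda>c d. R (?m b c) \<otimes>\<^bsub>K\<^esub> I (?m a (?S d)))"
    by (intro sw_cong) (simp_all add: linear_mapD(3)[OF IL])
  finally show ?thesis .
qed

text \<open>By \<open>integrals_exchange\<close> the hypothesis gives \<open>R(S(z) y) = 0\<close>
  for all \<open>y\<close>, where \<open>z = I(a\<^sub>2 b) a\<^sub>1\<close>; so
  \<open>z = 0\<close>, as \<open>R\<close> is faithful and \<open>S\<close> injective. Hence
  \<open>\<Delta> a\<close> lies in \<open>H \<otimes> L\<close>, with \<open>L\<close> the set of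
  \<open>h\<close> such that \<open>I(h b) = 0\<close> for all \<open>b\<close>. Therefore
  \<open>R(a\<^sub>1 b\<^sub>1) I(a\<^sub>2 b\<^sub>2 f)\<close> vanishes, and this expression
  equals \<open>R(a b) I(f)\<close>.\<close>

lemma integral_antipode_faithful_right_aux:
  assumes a: "a \<in> carrier H" and zero: "\<And>f. f \<in> carrier H \<Longrightarrow> I (a \<otimes>\<^bsub>H\<^esub> antipode H f) = \<zero>\<^bsub>K\<^esub>"
  shows "a = \<zero>\<^bsub>H\<^esub>"
proof (rule right_integral_faithful[OF a])
  fix b assume b: "b \<in> carrier H"
  note [simp] = H_mod S_mod a b R_closed
  let ?S = "antipode H" and ?m = "\<lambda>a b. a \<otimes>\<^bsub>H\<^esub> b"
  obtain f where f [simp]: "f \<in> carrier H" "I f \<noteq> \<zero>\<^bsub>K\<^esub>" by (rule I_nonzero)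
  have 1: "sw H a (\<lambda>c d. I (?m d b) \<odot>\<^bsub>H\<^esub> c) = \<zero>\<^bsub>H\<^esub>" if b': "b \<in> carrier H" for b
  proof (rule antipode_injective, simp_all add: b', rule right_integral_faithful)
    fix y assume y: "y \<in> carrier H"
    have RL: "linear_map K H (scalars K) (\<lambda>z. R (?m (?S z) y))"
      by (intro R_intros | simp add: y)+
    have "R (?m (?S (sw H a (\<lambda>c d. I (?m d b) \<odot>\<^bsub>H\<^esub> c))) y)
        = sw (scalars K) a (\<lambda>c d. R (?m (?S (I (?m d b) \<odot>\<^bsub>H\<^esub> c)) y))"
      by (rule linear_map_sw_out[OF RL]) (simp_all add: b')
    also have "\<dots> = sw (scalars K) a (\<lambda>c d. I (?m d b) \<otimes>\<^bsub>K\<^esub> R (?m (?S c) y))"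
      by (intro sw_cong) (simp_all add: linear_mapD(3)[OF RL] b')
    also have "\<dots> = sw (scalars K) y (\<lambda>c d. \<zero>\<^bsub>scalars K\<^esub>)"
      unfolding integrals_exchange[OF a b' y] by (intro sw_cong) (simp_all add: y zero b')
    also have "\<dots> = \<zero>\<^bsub>K\<^esub>" using sw_zero[OF S_mod] by simp
    finally show "R (?m (?S (sw H a (\<lambda>c d. I (?m d b) \<odot>\<^bsub>H\<^esub> c))) y) = \<zero>\<^bsub>K\<^esub>" .
  qed (simp add: b')
  \<comment> \<open>After the slide for \<open>R\<close>, the argument of \<open>I\<close> is
    \<open>S(b\<^sub>2) b\<^sub>3 f\<close>, which cancels to \<open>f\<close>; this is why
    \<open>f\<close> was chosen with nonzero integral.\<close>
  let ?T = "\<lambda>v h. sw (scalars K) b (\<lambda>s t. R (?m v s) \<otimes>\<^bsub>K\<^esub> I (?m h (?m t f)))"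
  have "sw (scalars K) a ?T = \<zero>\<^bsub>scalars K\<^esub>"
  proof (rule sw_vanish_right[where J = "carrier H" and g = "\<lambda>b d. I (?m d b)"])
    show "?T v h = \<zero>\<^bsub>scalars K\<^esub>"
      if "v \<in> carrier H" "h \<in> carrier H" "\<And>b. b \<in> carrier H \<Longrightarrow> I (?m h b) = \<zero>\<^bsub>K\<^esub>" for v h
      using that by (simp add: sw_scalars_zero cong: sw_cong)
  qed (intro R_intros | simp add: 1)+
  also have "sw (scalars K) a ?T
      = sw (scalars K) b (\<lambda>s t. sw (scalars K) a (\<lambda>v h. R (?m v s) \<otimes>\<^bsub>K\<^esub> I (?m h (?m t f))))"
    by (rule sw_swap) simp_all
  also have "\<dots> = sw (scalars K) b (\<lambda>s t. sw (scalars K) s (\<lambda>c d. R (?m a c) \<otimes>\<^bsub>K\<^esub> I (?m (?m (?S d) t) f)))"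
  proof (intro sw_cong)
    fix s t assume st [simp]: "s \<in> carrier H" "t \<in> carrier H"
    have L: "linear_map K H (scalars K) (\<lambda>z. I (?m z (?m t f)))"
      by (intro I_intros | simp)+
    have "sw (scalars K) a (\<lambda>v h. R (?m v s) \<otimes>\<^bsub>K\<^esub> I (?m h (?m t f)))
        = sw (scalars K) a (\<lambda>v h. I (?m (R (?m v s) \<odot>\<^bsub>H\<^esub> h) (?m t f)))"
      by (intro sw_cong) (simp_all add: linear_mapD(3)[OF L])
    also have "\<dots> = I (?m (sw H a (\<lambda>v h. R (?m v s) \<odot>\<^bsub>H\<^esub> h)) (?m t f))"
      by (rule linear_map_sw_out[OF L, symmetric]) simp_all
    also have "\<dots> = I (?m (sw H s (\<lambda>c d. R (?m a c) \<odot>\<^bsub>H\<^esub> ?S d)) (?m t f))"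
      by (simp add: right_integral_slide)
    also have "\<dots> = sw (scalars K) s (\<lambda>c d. I (?m (R (?m a c) \<odot>\<^bsub>H\<^esub> ?S d) (?m t f)))"
      by (rule linear_map_sw_out[OF L]) simp_all
    also have "\<dots> = sw (scalars K) s (\<lambda>c d. R (?m a c) \<otimes>\<^bsub>K\<^esub> I (?m (?m (?S d) t) f))"
      by (intro sw_cong) (simp_all add: linear_mapD(3)[OF L] H.m_assoc)
    finally show "sw (scalars K) a (\<lambda>v h. R (?m v s) \<otimes>\<^bsub>K\<^esub> I (?m h (?m t f)))
        = sw (scalars K) s (\<lambda>c d. R (?m a c) \<otimes>\<^bsub>K\<^esub> I (?m (?m (?S d) t) f))" .
  qed simp
  also have "\<dots> = sw (scalars K) b (\<lambda>c r. sw (scalars K) r (\<lambda>d t. R (?m a c) \<otimes>\<^bsub>K\<^esub> I (?m (?m (?S d) t) f)))"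
    by (rule sw_coassoc) (intro R_intros | simp)+
  also have "\<dots> = sw (scalars K) b (\<lambda>c r. counit H r \<odot>\<^bsub>scalars K\<^esub> (R (?m a c) \<otimes>\<^bsub>K\<^esub> I (?m \<one>\<^bsub>H\<^esub> f)))"
    by (intro sw_cong sw_antipode_left) (intro R_intros | simp)+
  also have "\<dots> = R (?m a b) \<otimes>\<^bsub>K\<^esub> I (?m \<one>\<^bsub>H\<^esub> f)"
    by (rule sw_counit_right) (intro R_intros | simp)+
  finally show "R (?m a b) = \<zero>\<^bsub>K\<^esub>" using f by (simp add: K.integral_iff)
qed

end

lemma integral_antipode_faithful_right:
  assumes "a \<in> carrier H" "\<And>f. f \<in> carrier H \<Longrightarrow> I (a \<otimes>\<^bsub>H\<^esub> antipode H f) = \<zero>\<^bsub>K\<^esub>"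
  shows "a = \<zero>\<^bsub>H\<^esub>"
proof -
  obtain u where "u \<in> carrier H" "\<exists>h \<in> carrier H. right_int u h \<noteq> \<zero>\<^bsub>K\<^esub>"
    using right_int_nonzero by blast
  then show ?thesis
    using integral_antipode_faithful_right_aux[OF right_int_linear right_int_invariant] assms by blast
qed

end

section \<open>From comodules to modules over the convolution algebra\<close>

text \<open>Comodules and modules are records of different types. Agreement of the vector space
  fields is enough to identify their linear maps, submodules, direct sums and tensor
  products.\<close>

definition same_space :: "('k, 'u, 'm) module_scheme \<Rightarrow> ('k, 'u, 'n) module_scheme \<Rightarrow> bool"
  where "same_space V M \<longleftrightarrow> carrier M = carrier V \<and> \<zero>\<^bsub>M\<^esub> = \<zero>\<^bsub>V\<^esub> \<and> add M = add V \<and> smult M = smult V"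

lemma same_space_sym: "same_space V M \<Longrightarrow> same_space M V"
  by (simp add: same_space_def)

context
  fixes V :: "('k, 'u, 'm) module_scheme" and M :: "('k, 'u, 'n) module_scheme"
  assumes same: "same_space V M"
begin

lemma same_space_simps:
  "carrier M = carrier V" "\<zero>\<^bsub>M\<^esub> = \<zero>\<^bsub>V\<^esub>" "x \<oplus>\<^bsub>M\<^esub> y = x \<oplus>\<^bsub>V\<^esub> y" "a \<odot>\<^bsub>M\<^esub> x = a \<odot>\<^bsub>V\<^esub> x"
  using same by (simp_all add: same_space_def)

lemma same_space_linear_map:
  "linear_map K M U f \<longleftrightarrow> linear_map K V U f" "linear_map K W M g \<longleftrightarrow> linear_map K W V g"
  by (simp_all add: linear_map_def same_space_simps)

lemma same_space_module:
  assumes "module K V"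
  shows "module K M"
proof -
  interpret V: module K V by fact
  show ?thesis
  proof (rule moduleI[OF V.R.cring_axioms abelian_groupI])
    show "\<exists>y \<in> carrier M. y \<oplus>\<^bsub>M\<^esub> x = \<zero>\<^bsub>M\<^esub>" if "x \<in> carrier M" for x
      using that by (intro bexI[of _ "\<ominus>\<^bsub>V\<^esub> x"]) (simp_all add: same_space_simps V.M.l_neg)
  qed (simp_all add: same_space_simps V.M.a_ac V.smult_l_distr V.smult_r_distr V.smult_assoc1)
qed

lemma same_space_submodule:
  assumes "module K V" "submodule N K V"
  shows "submodule N K M"
proof -
  interpret V: module K V by fact
  interpret M: module K M by (rule same_space_module[OF assms(1)])
  show ?thesis
    by (rule M.submoduleI')
      (use V.submoduleE(1,4,5)[OF assms(2)] V.submodule_zero[OF assms(2)] in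
        \<open>auto simp: same_space_simps\<close>)
qed

lemma same_space_finsum: "finsum M = finsum V"
  using same by (intro ext) (simp add: finsum_def finprod_def same_space_def)

lemma same_space_direct_sum: "direct_sum_of M \<W> \<longleftrightarrow> direct_sum_of V \<W>"
  by (simp add: direct_sum_of_def same_space_simps same_space_finsum)

lemma same_space_tensor: "tensor K M W = tensor K V W" "tens K M W = tens K V W"
  by (simp_all add: tensor_def tens_def tensor_null_def tensor_rels_def same_space_simps fun_eq_iff)

end

lemma (in module) finsum_submodule:
  assumes "submodule N R M" "\<And>i. i \<in> A \<Longrightarrow> f i \<in> N"
  shows "finsum M f A \<in> N"
  using assms(2)
\<comment> \<open>Over an infinite index set \<open>finsum\<close> is zero by convention, so the
  claim holds there too.\<close>
proof (induction A rule: infinite_finite_induct)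
  case (insert i A)
  have "f ` insert i A \<subseteq> carrier M" using insert.prems submoduleE(1)[OF assms(1)] by auto
  then have "finsum M f (insert i A) = f i \<oplus>\<^bsub>M\<^esub> finsum M f A"
    using insert.hyps by (intro M.finsum_insert) auto
  then show ?case using insert submoduleE(5)[OF assms(1)] by simp
qed (auto simp: submodule_zero[OF assms(1)] M.finsum_infinite)

context hopf_integral
begin

lemma conv_eq:
  assumes "g \<in> carrier H" "f \<in> carrier H"
  shows "conv K H I g f = sw H f (\<lambda>c d. I (d \<otimes>\<^bsub>H\<^esub> antipode H g) \<odot>\<^bsub>H\<^esub> c)"
proof -
  have "conv K H I g f = sw H g (\<lambda>a b. I (f \<otimes>\<^bsub>H\<^esub> antipode H a) \<odot>\<^bsub>H\<^esub> b)"
    unfolding conv_def by (rule sw_eq_lift[symmetric]) (intro I_intros | simp add: assms)+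
  then show ?thesis by (simp add: integral_antipode_slide assms)
qed

lemma conv_closed: "g \<in> carrier H \<Longrightarrow> f \<in> carrier H \<Longrightarrow> conv K H I g f \<in> carrier H"
  by (simp add: conv_eq H_mod)

text \<open>\<open>f \<mapsto> I(\<cdot> S(f))\<close> carries \<open>*\<close> to the convolution
  product of functionals on \<open>H\<close>, the product that acts on comodules. The coproduct of
  \<open>g\<close>, brought in by \<open>conv_eq\<close>, is traded for that of \<open>x\<close> by
  the slide.\<close>

lemma integral_conv:
  assumes x: "x \<in> carrier H" and f: "f \<in> carrier H" and g: "g \<in> carrier H"
  shows "I (x \<otimes>\<^bsub>H\<^esub> antipode H (conv K H I f g))
    = sw (scalars K) x (\<lambda>a b. I (a \<otimes>\<^bsub>H\<^esub> antipode H f) \<otimes>\<^bsub>K\<^esub> I (b \<otimes>\<^bsub>H\<^esub> antipode H g))"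
proof -
  note [simp] = H_mod S_mod x f g
  let ?S = "antipode H" and ?m = "\<lambda>a b. a \<otimes>\<^bsub>H\<^esub> b"
  have L: "linear_map K H (scalars K) (\<lambda>z. I (?m x (?S z)))"
    and R: "linear_map K H (scalars K) (\<lambda>z. I (?m z (?S f)))"
    by (intro I_intros | simp)+
  have "I (?m x (?S (conv K H I f g))) = sw (scalars K) g (\<lambda>c d. I (?m x (?S (I (?m d (?S f)) \<odot>\<^bsub>H\<^esub> c))))"
    unfolding conv_eq[OF f g] by (rule linear_map_sw_out[OF L]) simp_all
  also have "\<dots> = sw (scalars K) g (\<lambda>c d. I (?m (I (?m x (?S c)) \<odot>\<^bsub>H\<^esub> d) (?S f)))"
    by (intro sw_cong) (simp_all add: linear_mapD(3)[OF L] linear_mapD(3)[OF R] K.m_comm)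
  also have "\<dots> = I (?m (sw H g (\<lambda>c d. I (?m x (?S c)) \<odot>\<^bsub>H\<^esub> d)) (?S f))"
    by (rule linear_map_sw_out[OF R, symmetric]) simp_all
  also have "\<dots> = I (?m (sw H x (\<lambda>a b. I (?m b (?S g)) \<odot>\<^bsub>H\<^esub> a)) (?S f))"
    by (simp add: integral_antipode_slide)
  also have "\<dots> = sw (scalars K) x (\<lambda>a b. I (?m (I (?m b (?S g)) \<odot>\<^bsub>H\<^esub> a) (?S f)))"
    by (rule linear_map_sw_out[OF R]) simp_all
  also have "\<dots> = sw (scalars K) x (\<lambda>a b. I (?m a (?S f)) \<otimes>\<^bsub>K\<^esub> I (?m b (?S g)))"
    by (intro sw_cong) (simp_all add: linear_mapD(3)[OF R] K.m_comm)
  finally show ?thesis .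
qed

text \<open>The functionals \<open>I(\<cdot> S(f))\<close> are chosen instead of \<open>I(f S(\<cdot>))\<close>, which also turn comodules into modules:
  with the former, the left regular module is the one of the comodule \<open>(H, \<Delta>)\<close>, see \<open>conv_eq\<close>, so that
  coactions on cyclic modules can be read off from \<open>\<Delta>\<close>.\<close>

definition slice :: "('k, 'u, 'p) module_scheme \<Rightarrow> 'h \<Rightarrow> ('u \<times> 'h \<Rightarrow> 'k) set \<Rightarrow> 'u"
  where "slice V f t = tsum K V H V (\<lambda>u h. I (h \<otimes>\<^bsub>H\<^esub> antipode H f) \<odot>\<^bsub>V\<^esub> u) t"

context
  fixes V :: "('k, 'u, 'p) module_scheme"
  assumes V: "module K V"
begin

interpretation V: module K V by (rule V)

interpretation T: module K "tensor K V H" by (rule tensor_module[OF V H_mod])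

lemma slice_bilinear:
  "f \<in> carrier H \<Longrightarrow> bilinear K V H V (\<lambda>u h. I (h \<otimes>\<^bsub>H\<^esub> antipode H f) \<odot>\<^bsub>V\<^esub> u)"
  by (intro I_intros V | simp)+

lemma linear_map_slice: "f \<in> carrier H \<Longrightarrow> linear_map K (tensor K V H) V (slice V f)"
  unfolding slice_def by (intro linear_map_tsum V H_mod slice_bilinear)

lemma slice_tens:
  "f \<in> carrier H \<Longrightarrow> u \<in> carrier V \<Longrightarrow> h \<in> carrier H \<Longrightarrow>
    slice V f (tens K V H u h) = I (h \<otimes>\<^bsub>H\<^esub> antipode H f) \<odot>\<^bsub>V\<^esub> u"
  unfolding slice_def by (rule tsum_tens[OF V H_mod V slice_bilinear])

lemma slice_linear_left:
  "t \<in> carrier (tensor K V H) \<Longrightarrow> linear_map K H V (\<lambda>f. slice V f t)"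
  unfolding slice_def by (rule linear_map_tsum_body[OF V H_mod]) (intro I_intros V | simp)+

text \<open>Faithfulness of the integral enters here: an element of \<open>H\<close> killed by all
  functionals \<open>I(\<cdot> S(f))\<close> is zero, so slices in \<open>W\<close> force the tensor
  into the image of \<open>W \<otimes> H\<close>.\<close>

lemma slice_mem:
  assumes t: "t \<in> carrier (tensor K V H)" and W: "submodule W K V"
    and mem: "\<And>f. f \<in> carrier H \<Longrightarrow> slice V f t \<in> W"
  shows "t \<in> span_of K (tensor K V H) {tens K V H u h |u h. u \<in> W \<and> h \<in> carrier H}"
proof -
  let ?Z = "span_of K (tensor K V H) {tens K V H u h |u h. u \<in> W \<and> h \<in> carrier H}"
  have Wc: "W \<subseteq> carrier V" by (rule V.submoduleE(1)[OF W])
  have Z: "submodule ?Z K (tensor K V H)"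
    by (rule T.submodule_span_of) (use Wc in \<open>auto intro: tens_closed[OF V H_mod]\<close>)
  note bil = tens_bilinear[OF V H_mod]
  \<comment> \<open>The bilinear test map is \<open>tens\<close> itself, whose sum over a
    representation of \<open>t\<close> is \<open>t\<close>.\<close>
  have "tsum K V H (tensor K V H) (tens K V H) t \<in> ?Z"
  proof (rule tsum_mem_right[OF K.field_axioms V H_mod T.module_axioms t bil W Z,
        where G = "(\<lambda>f h. I (h \<otimes>\<^bsub>H\<^esub> antipode H f)) ` carrier H"])
    show "linear_map K H (scalars K) g" if "g \<in> (\<lambda>f h. I (h \<otimes>\<^bsub>H\<^esub> antipode H f)) ` carrier H" for g
      using that by clarify (intro I_intros | simp)+
    show "tsum K V H V (\<lambda>x y. g y \<odot>\<^bsub>V\<^esub> x) t \<in> W" if "g \<in> (\<lambda>f h. I (h \<otimes>\<^bsub>H\<^esub> antipode H f)) ` carrier H" for g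
      using that mem by (auto simp: slice_def)
    show "tens K V H x y \<in> ?Z" if "x \<in> W" "y \<in> carrier H" for x y
      by (rule subsetD[OF span_of_superset]) (use that in blast)
    show "tens K V H x y \<in> ?Z"
      if xy: "x \<in> carrier V" "y \<in> carrier H"
        and g: "\<And>g. g \<in> (\<lambda>f h. I (h \<otimes>\<^bsub>H\<^esub> antipode H f)) ` carrier H \<Longrightarrow> g y = \<zero>\<^bsub>K\<^esub>" for x y
    proof -
      have "I (y \<otimes>\<^bsub>H\<^esub> antipode H f) = \<zero>\<^bsub>K\<^esub>" if "f \<in> carrier H" for f
        using g[OF imageI[OF that]] .
      then have "y = \<zero>\<^bsub>H\<^esub>" by (rule integral_antipode_faithful_right[OF xy(2)])
      then show ?thesis
        using linear_map_zero[OF H_mod T.module_axioms bilinearD(2)[OF bil xy(1)]] T.submodule_zero[OF Z]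
        by simp
    qed
  qed
  then show ?thesis by (simp add: tsum_tens_id[OF V H_mod t])
qed

text \<open>The difference has zero slices, so \<open>slice_mem\<close> with the zero subspace as
  \<open>W\<close> puts it into a span of zeros.\<close>

lemma slice_eqI:
  assumes s: "s \<in> carrier (tensor K V H)" and t: "t \<in> carrier (tensor K V H)"
    and eq: "\<And>f. f \<in> carrier H \<Longrightarrow> slice V f s = slice V f t"
  shows "s = t"
proof -
  let ?d = "s \<ominus>\<^bsub>tensor K V H\<^esub> t"
  have d: "?d \<in> carrier (tensor K V H)" using s t by simp
  have "slice V f ?d = \<zero>\<^bsub>V\<^esub>" if "f \<in> carrier H" for f
    using linear_mapD[OF linear_map_slice[OF that]] linear_map_minus[OF T.module_axioms V linear_map_slice[OF that]]
      s t eq[OF that] by (simp add: a_minus_def V.M.r_neg)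
  then have "?d \<in> span_of K (tensor K V H) {tens K V H u h |u h. u \<in> {\<zero>\<^bsub>V\<^esub>} \<and> h \<in> carrier H}"
    by (intro slice_mem d zero_submodule[OF V]) simp
  moreover have "{tens K V H u h |u h. u \<in> {\<zero>\<^bsub>V\<^esub>} \<and> h \<in> carrier H} \<subseteq> {\<zero>\<^bsub>tensor K V H\<^esub>}"
    using linear_map_zero[OF V T.module_axioms bilinearD(1)[OF tens_bilinear[OF V H_mod]]] by auto
  ultimately have "?d = \<zero>\<^bsub>tensor K V H\<^esub>"
    using span_of_least[OF zero_submodule[OF T.module_axioms]] by blast
  then show ?thesis using T.minus_eq_zero_iff[OF s t] by simp
qed

end

text \<open>A relation rather than a map, so that the same lemmas cover the module built from a
  comodule and the comodule built from a module.\<close>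

definition corresponds :: "('k, 'h, 'u) comodule \<Rightarrow> ('k, 'h, 'u) conv_module \<Rightarrow> bool"
  where "corresponds V M \<longleftrightarrow> same_space V M \<and>
    (\<forall>f \<in> carrier H. \<forall>v \<in> carrier V. act M f v = slice V f (coact V v))"

context
  fixes V :: "('k, 'h, 'u) comodule"
  assumes com: "right_comodule K H V"
begin

lemma comodule_space: "module K V"
  and coact_linear: "linear_map K V (tensor K V H) (coact V)"
  using com by (simp_all add: right_comodule_def)

lemma coact_closed: "v \<in> carrier V \<Longrightarrow> coact V v \<in> carrier (tensor K V H)"
  by (rule linear_mapD(1)[OF coact_linear])

interpretation V: module K V by (rule comodule_space)

lemma coact_coassoc:
  assumes "v \<in> carrier V" "module K U" "trilinear K V H H U f"
  shows "tsum K V H U (\<lambda>x y. tsum K V H U (\<lambda>u w. f u w y) (coact V x)) (coact V v)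
    = tsum K V H U (\<lambda>x y. sw U y (f x)) (coact V v)"
  unfolding sw_def
  by (rule coassoc_tsum[OF comodule_space H_mod coact_linear comult_linear coact_closed[OF assms(1)] assms(2,3)])
    (use com assms(1) in \<open>simp add: right_comodule_def\<close>)

lemma coact_counit:
  assumes "v \<in> carrier V"
  shows "tsum K V H V (\<lambda>u h. counit H h \<odot>\<^bsub>V\<^esub> u) (coact V v) = v"
proof -
  have "bilinear K V H V (\<lambda>u h. counit H h \<odot>\<^bsub>V\<^esub> u)"
    by (intro linear_intros comodule_space | simp)+
  then show ?thesis
    using tsum_eq_lift[OF comodule_space H_mod coact_closed[OF assms] comodule_space] com assms
    by (simp add: right_comodule_def)
qed

end

context
  fixes V :: "('k, 'h, 'u) comodule" and M :: "('k, 'h, 'u) conv_module"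
  assumes com: "right_comodule K H V" and corr: "corresponds V M"
begin

interpretation V: module K V by (rule comodule_space[OF com])

lemma corresponds_same_space: "same_space V M"
  using corr by (simp add: corresponds_def)

lemmas M_simps = same_space_simps[OF corresponds_same_space]

lemma act_eq: "f \<in> carrier H \<Longrightarrow> v \<in> carrier V \<Longrightarrow> act M f v = slice V f (coact V v)"
  using corr by (simp add: corresponds_def)

lemma act_linear: "f \<in> carrier H \<Longrightarrow> linear_map K V V (act M f)"
  by (rule linear_map_cong[OF comodule_space[OF com] linear_map_comp[OF linear_map_slice[OF comodule_space[OF com]] coact_linear[OF com]]])
    (simp_all add: act_eq)

lemma act_linear_left: "v \<in> carrier V \<Longrightarrow> linear_map K H V (\<lambda>f. act M f v)"
  by (rule linear_map_cong[OF H_mod slice_linear_left[OF comodule_space[OF com] coact_closed[OF com]]])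
    (simp_all add: act_eq)

text \<open>By \<open>integral_conv\<close> the left side is
  \<open>v\<^sub>0 I(v\<^sub>1 S(f)) I(v\<^sub>2 S(g))\<close>. Coassociativity lets
  \<open>v\<^sub>0 \<otimes> v\<^sub>1\<close> be the coaction of a first component, so that
  \<open>g\<close> acts first and \<open>f\<close> on the result.\<close>

lemma act_conv:
  assumes f: "f \<in> carrier H" and g: "g \<in> carrier H" and v: "v \<in> carrier V"
  shows "act M (conv K H I f g) v = act M f (act M g v)"
proof -
  note [simp] = H_mod S_mod comodule_space[OF com] f g v coact_closed[OF com]
  let ?B = "\<lambda>x f. I (x \<otimes>\<^bsub>H\<^esub> antipode H f)"
  have "act M (conv K H I f g) v = tsum K V H V (\<lambda>u h. ?B h (conv K H I f g) \<odot>\<^bsub>V\<^esub> u) (coact V v)"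
    by (simp add: act_eq conv_closed slice_def)
  also have "\<dots> = tsum K V H V (\<lambda>u h. sw V h (\<lambda>a b. (?B a f \<otimes>\<^bsub>K\<^esub> ?B b g) \<odot>\<^bsub>V\<^esub> u)) (coact V v)"
  proof (intro tsum_cong)
    fix u h assume uh [simp]: "u \<in> carrier V" "h \<in> carrier H"
    show "?B h (conv K H I f g) \<odot>\<^bsub>V\<^esub> u = sw V h (\<lambda>a b. (?B a f \<otimes>\<^bsub>K\<^esub> ?B b g) \<odot>\<^bsub>V\<^esub> u)"
      unfolding integral_conv[OF uh(2) f g]
      by (intro linear_map_sw_out linear_map_smult_left linear_map_id) simp_all
  qed simp_all
  also have "\<dots> = tsum K V H V (\<lambda>x y. tsum K V H V (\<lambda>u w. (?B w f \<otimes>\<^bsub>K\<^esub> ?B y g) \<odot>\<^bsub>V\<^esub> u) (coact V x)) (coact V v)"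
    by (rule coact_coassoc[OF com, symmetric]) (intro I_intros | simp)+
  also have "\<dots> = tsum K V H V (\<lambda>x y. act M f (?B y g \<odot>\<^bsub>V\<^esub> x)) (coact V v)"
  proof (intro tsum_cong)
    fix x y assume xy [simp]: "x \<in> carrier V" "y \<in> carrier H"
    have "act M f (?B y g \<odot>\<^bsub>V\<^esub> x) = ?B y g \<odot>\<^bsub>V\<^esub> act M f x"
      by (rule linear_mapD(3)[OF act_linear]) simp_all
    also have "\<dots> = ?B y g \<odot>\<^bsub>V\<^esub> tsum K V H V (\<lambda>u w. ?B w f \<odot>\<^bsub>V\<^esub> u) (coact V x)"
      by (simp add: act_eq slice_def)
    also have "\<dots> = tsum K V H V (\<lambda>u w. ?B y g \<odot>\<^bsub>V\<^esub> (?B w f \<odot>\<^bsub>V\<^esub> u)) (coact V x)"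
      by (intro linear_map_tsum_out linear_map_smult linear_map_id) simp_all
    also have "\<dots> = tsum K V H V (\<lambda>u w. (?B w f \<otimes>\<^bsub>K\<^esub> ?B y g) \<odot>\<^bsub>V\<^esub> u) (coact V x)"
      by (intro tsum_cong) (simp_all add: K.m_comm flip: V.smult_assoc1)
    finally show "tsum K V H V (\<lambda>u w. (?B w f \<otimes>\<^bsub>K\<^esub> ?B y g) \<odot>\<^bsub>V\<^esub> u) (coact V x)
      = act M f (?B y g \<odot>\<^bsub>V\<^esub> x)" by simp
  qed simp_all
  also have "\<dots> = act M f (tsum K V H V (\<lambda>x y. ?B y g \<odot>\<^bsub>V\<^esub> x) (coact V v))"
    by (intro linear_map_tsum_out[symmetric] act_linear) simp_all
  also have "\<dots> = act M f (act M g v)" by (simp add: act_eq slice_def)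
  finally show ?thesis .
qed

lemma corresponds_left_conv_module: "left_conv_module K H I M"
  unfolding left_conv_module_def
  using same_space_module[OF corresponds_same_space comodule_space[OF com]] act_linear act_linear_left act_conv
  by (simp add: same_space_linear_map[OF corresponds_same_space] M_simps)

text \<open>Pure tensors with first entry in \<open>W\<close> have slices in \<open>W\<close>;
  conversely, \<open>slice_mem\<close> locates a tensor from its slices.\<close>

lemma subcomodule_iff: "subcomodule K H V W \<longleftrightarrow> conv_submodule K H M W"
proof
  assume W: "subcomodule K H V W"
  then have sub: "submodule W K V" by (simp add: subcomodule_def)
  have "act M f w \<in> W" if fw: "f \<in> carrier H" "w \<in> W" for f w
  proof -
    have Wc: "W \<subseteq> carrier V" by (rule V.submoduleE(1)[OF sub])
    have "span_of K (tensor K V H) {tens K V H u h |u h. u \<in> W \<and> h \<in> carrier H}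
        \<subseteq> {t \<in> carrier (tensor K V H). slice V f t \<in> W}"
    proof (rule span_of_least[OF linear_map_vimage[OF tensor_module[OF comodule_space[OF com] H_mod]
            comodule_space[OF com] linear_map_slice[OF comodule_space[OF com] fw(1)] sub]])
      show "{tens K V H u h |u h. u \<in> W \<and> h \<in> carrier H} \<subseteq> {t \<in> carrier (tensor K V H). slice V f t \<in> W}"
        using Wc V.submoduleE(4)[OF sub] fw(1)
        by (auto simp: slice_tens[OF comodule_space[OF com]] subset_iff intro!: tens_closed[OF comodule_space[OF com] H_mod])
    qed
    moreover have "coact V w \<in> span_of K (tensor K V H) {tens K V H u h |u h. u \<in> W \<and> h \<in> carrier H}"
      using W fw(2) by (simp add: subcomodule_def)
    ultimately have "slice V f (coact V w) \<in> W" by blast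
    then show ?thesis using Wc fw by (simp add: act_eq subset_iff)
  qed
  then show "conv_submodule K H M W"
    using same_space_submodule[OF corresponds_same_space comodule_space[OF com] sub] by (simp add: conv_submodule_def)
next
  assume W: "conv_submodule K H M W"
  have sub: "submodule W K V"
    using same_space_submodule[OF same_space_sym[OF corresponds_same_space] same_space_module[OF corresponds_same_space comodule_space[OF com]]] W
    by (simp add: conv_submodule_def)
  have Wc: "w \<in> carrier V" if "w \<in> W" for w using V.submoduleE(1)[OF sub] that by auto
  have "coact V w \<in> span_of K (tensor K V H) {tens K V H u h |u h. u \<in> W \<and> h \<in> carrier H}"
    if "w \<in> W" for w
    using that W Wc
    by (intro slice_mem[OF comodule_space[OF com] _ sub]) (auto simp: conv_submodule_def coact_closed[OF com] simp flip: act_eq)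
  then show "subcomodule K H V W" using sub by (simp add: subcomodule_def)
qed

text \<open>The counit need not be one of the functionals \<open>I(\<cdot> S(f))\<close>, so
  \<open>v\<close> is not read off from a single slice. Instead, the vanishing of all slices makes
  the coaction of \<open>v\<close> vanish, and the counit applied to the coaction returns
  \<open>v\<close>.\<close>

lemma act_zero_imp_zero:
  assumes v: "v \<in> carrier V" and zero: "\<And>f. f \<in> carrier H \<Longrightarrow> act M f v = \<zero>\<^bsub>V\<^esub>"
  shows "v = \<zero>\<^bsub>V\<^esub>"
proof -
  interpret T: module K "tensor K V H" by (rule tensor_module[OF comodule_space[OF com] H_mod])
  have "coact V v = \<zero>\<^bsub>tensor K V H\<^esub>"
    by (rule slice_eqI[OF comodule_space[OF com] coact_closed[OF com v] T.zero_closed])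
      (simp add: zero v linear_map_zero[OF T.module_axioms comodule_space[OF com] linear_map_slice[OF comodule_space[OF com]]]
        flip: act_eq)
  moreover have "linear_map K (tensor K V H) V (tsum K V H V (\<lambda>u h. counit H h \<odot>\<^bsub>V\<^esub> u))"
    by (rule linear_map_tsum[OF comodule_space[OF com] H_mod comodule_space[OF com]])
      (intro linear_intros comodule_space[OF com] | simp)+
  ultimately show ?thesis
    using coact_counit[OF com v] linear_map_zero[OF T.module_axioms comodule_space[OF com]] by metis
qed

text \<open>Subobjects agree by \<open>subcomodule_iff\<close>, so only the cyclicity demanded of
  simple modules is at issue: the orbit of a nonzero \<open>w\<close> is a submodule, nonzero by
  \<open>act_zero_imp_zero\<close>, and hence everything.\<close>

lemma simple_subcomodule_iff: "simple_subcomodule K H V W \<longleftrightarrow> simple_conv_submodule K H M W"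
proof
  assume W: "simple_subcomodule K H V W"
  then have sub: "subcomodule K H V W" and nz: "W \<noteq> {\<zero>\<^bsub>V\<^esub>}"
    and simple: "\<And>U. subcomodule K H V U \<Longrightarrow> U \<subseteq> W \<Longrightarrow> U = {\<zero>\<^bsub>V\<^esub>} \<or> U = W"
    by (simp_all add: simple_subcomodule_def)
  have mW: "submodule W K V" using sub by (simp add: subcomodule_def)
  have Wc: "W \<subseteq> carrier V" by (rule V.submoduleE(1)[OF mW])
  obtain w where w: "w \<in> W" "w \<noteq> \<zero>\<^bsub>V\<^esub>" using nz V.submodule_zero[OF mW] by blast
  define C where "C = (\<lambda>f. act M f w) ` carrier H"
  have wc: "w \<in> carrier V" using w Wc by auto
  have "submodule C K V"
    unfolding C_def
    by (rule linear_map_image[OF H_mod comodule_space[OF com] act_linear_left[OF wc] mod.carrier_is_submodule])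
  moreover have "act M g c \<in> C" if "g \<in> carrier H" "c \<in> C" for g c
    using that wc by (auto simp: C_def act_conv[symmetric] conv_closed)
  ultimately have "conv_submodule K H M C"
    using same_space_submodule[OF corresponds_same_space comodule_space[OF com]] by (simp add: conv_submodule_def)
  then have "subcomodule K H V C" by (simp add: subcomodule_iff)
  moreover have "C \<subseteq> W"
    using sub w by (auto simp: C_def subcomodule_iff conv_submodule_def)
  ultimately have "C = {\<zero>\<^bsub>V\<^esub>} \<or> C = W" by (rule simple)
  moreover have "C \<noteq> {\<zero>\<^bsub>V\<^esub>}"
    using act_zero_imp_zero[OF wc] w(2) by (auto simp: C_def)
  ultimately have "W = {act M f w |f. f \<in> carrier H}" by (auto simp: C_def)
  then show "simple_conv_submodule K H M W"
    using W w(1) by (auto simp: simple_subcomodule_def simple_conv_submodule_def subcomodule_iff M_simps)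
qed (simp add: simple_subcomodule_def simple_conv_submodule_def subcomodule_iff M_simps)

lemma completely_reducible_iff:
  "completely_reducible_comodule K H V \<longleftrightarrow> completely_reducible_conv_module K H I M"
  by (simp add: completely_reducible_comodule_def completely_reducible_conv_module_def com
      corresponds_left_conv_module simple_subcomodule_iff same_space_direct_sum[OF corresponds_same_space])

end

text \<open>Both sides of the comodule map equation at \<open>v\<close> are tensors over
  \<open>V'\<close> and can be compared by slices; the slice of the right-hand one at
  \<open>f\<close> is \<open>\<phi> (act M f v)\<close>.\<close>

lemma comodule_homs_eq:
  assumes V: "right_comodule K H V" and VM: "corresponds V M"
    and V': "right_comodule K H V'" and VM': "corresponds V' M'"
  shows "comodule_homs K H V V' = conv_module_homs K H M M'"
proof -
  note mV = comodule_space[OF V] and mV' = comodule_space[OF V']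
  note sV = corresponds_same_space[OF V VM] and sV' = corresponds_same_space[OF V' VM']
  have "coact V' (\<phi> v) = tensor_map K V H V' H \<phi> (\<lambda>h. h) (coact V v)
      \<longleftrightarrow> (\<forall>f \<in> carrier H. \<phi> (act M f v) = act M' f (\<phi> v))"
    if phi: "linear_map K V V' \<phi>" and v: "v \<in> carrier V" for \<phi> v
  proof -
    let ?t = "tensor_map K V H V' H \<phi> (\<lambda>h. h) (coact V v)"
    note cv = coact_closed[OF V v] and pc = linear_mapD(1)[OF phi]
    have T': "module K (tensor K V' H)" by (rule tensor_module[OF mV' H_mod])
    have t: "?t = tsum K V H (tensor K V' H) (\<lambda>u h. tens K V' H (\<phi> u) h) (coact V v)"
      unfolding tensor_map_def
      by (rule tsum_eq_lift[symmetric, OF mV H_mod cv T'])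
        (intro bilinearI linear_map_comp[OF bilinearD(1)[OF tens_bilinear[OF mV' H_mod]]]
          linear_map_comp[OF bilinearD(2)[OF tens_bilinear[OF mV' H_mod]]] phi linear_map_id pc; assumption)
    have tc: "?t \<in> carrier (tensor K V' H)"
      unfolding t by (intro tsum_closed mV H_mod cv T' tens_closed mV' pc)
    have "slice V' f ?t = \<phi> (act M f v)" if f: "f \<in> carrier H" for f
    proof -
      have "slice V' f ?t = tsum K V H V' (\<lambda>u h. slice V' f (tens K V' H (\<phi> u) h)) (coact V v)"
        unfolding t by (intro linear_map_tsum_out mV H_mod cv T' mV' linear_map_slice f tens_closed pc)
      also have "\<dots> = tsum K V H V' (\<lambda>u h. \<phi> (I (h \<otimes>\<^bsub>H\<^esub> antipode H f) \<odot>\<^bsub>V\<^esub> u)) (coact V v)"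
        using f pc by (intro tsum_cong mV H_mod cv) (simp add: slice_tens[OF mV'] linear_mapD(3)[OF phi])
      also have "\<dots> = \<phi> (slice V f (coact V v))"
        unfolding slice_def using f module.smult_closed[OF mV]
        by (intro linear_map_tsum_out[symmetric] mV H_mod cv mV' phi) simp
      finally show ?thesis using act_eq[OF V VM f v] by simp
    qed
    then show ?thesis
      using slice_eqI[OF mV' coact_closed[OF V' pc[OF v]] tc] act_eq[OF V' VM' _ pc[OF v]] by auto
  qed
  then show ?thesis
    by (auto simp: comodule_homs_def conv_module_homs_def same_space_linear_map[OF sV]
        same_space_linear_map[OF sV'] same_space_simps[OF sV])
qed

end

section \<open>From modules over the convolution algebra to comodules\<close>

context hopf_integral
begin

definition to_conv_module :: "('k, 'h, 'u) comodule \<Rightarrow> ('k, 'h, 'u) conv_module"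
  where "to_conv_module V = \<lparr>carrier = carrier V, monoid.mult = monoid.mult V, one = one V,
    ring.zero = ring.zero V, ring.add = ring.add V, smult = smult V,
    act = (\<lambda>f v. slice V f (coact V v))\<rparr>"

text \<open>At most one tensor has the prescribed slices, by \<open>slice_eqI\<close>;
  \<open>slice_exists\<close> shows that there is one if the module is generated by elements
  \<open>act M g w\<close>.\<close>

definition to_comodule :: "('k, 'h, 'u) conv_module \<Rightarrow> ('k, 'h, 'u) comodule"
  where "to_comodule M = \<lparr>carrier = carrier M, monoid.mult = monoid.mult M, one = one M,
    ring.zero = ring.zero M, ring.add = ring.add M, smult = smult M,
    coact = (\<lambda>v. SOME t. t \<in> carrier (tensor K M H) \<and> (\<forall>f \<in> carrier H. slice M f t = act M f v))\<rparr>"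

lemma corresponds_to_conv_module: "corresponds V (to_conv_module V)"
  by (simp add: corresponds_def same_space_def to_conv_module_def)

lemma same_space_slice: "same_space V M \<Longrightarrow> slice M f t = slice V f t"
  by (simp add: slice_def tsum_def trep_def lsum_def same_space_tensor same_space_simps)

text \<open>Each simple summand is an orbit and therefore lies in \<open>Z\<close>, and
  \<open>v\<close> is a sum of elements of summands. This is the form in which complete reducibility
  enters the construction of the coaction.\<close>

lemma completely_reducible_generated:
  assumes "completely_reducible_conv_module K H I M" and Z: "submodule Z K M"
    and act: "\<And>f v. f \<in> carrier H \<Longrightarrow> v \<in> carrier M \<Longrightarrow> act M f v \<in> Z"
    and v: "v \<in> carrier M"
  shows "v \<in> Z"
proof -
  have "module K M" using assms(1) by (simp add: completely_reducible_conv_module_def left_conv_module_def)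
  then interpret M: module K M .
  obtain \<W> where \<W>: "\<And>W. W \<in> \<W> \<Longrightarrow> simple_conv_submodule K H M W" "direct_sum_of M \<W>"
    using assms(1) by (auto simp: completely_reducible_conv_module_def)
  have "W \<subseteq> Z" if W: "W \<in> \<W>" for W
  proof -
    have s: "simple_conv_submodule K H M W" by (rule \<W>(1)[OF W])
    then have "submodule W K M" by (simp add: simple_conv_submodule_def conv_submodule_def)
    then have "W \<subseteq> carrier M" by (rule M.submoduleE(1))
    moreover obtain w where "w \<in> W" "W = {act M f w |f. f \<in> carrier H}"
      using s by (auto simp: simple_conv_submodule_def)
    ultimately show ?thesis using act by auto
  qed
  moreover obtain x where x: "x \<in> (\<Pi>\<^sub>E W\<in>\<W>. W)" "v = (\<Oplus>\<^bsub>M\<^esub>W \<in> {W \<in> \<W>. x W \<noteq> \<zero>\<^bsub>M\<^esub>}. x W)"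
    using \<W>(2) v unfolding direct_sum_of_def by blast
  ultimately show ?thesis
    unfolding x(2) by (intro M.finsum_submodule[OF Z]) auto
qed

section \<open>The coaction on a module generated by its orbits\<close>

context
  fixes M :: "('k, 'h, 'u) conv_module"
  assumes lm: "left_conv_module K H I M"
    and generated: "\<And>Z v. submodule Z K M \<Longrightarrow> (\<And>f w. f \<in> carrier H \<Longrightarrow> w \<in> carrier M \<Longrightarrow> act M f w \<in> Z)
      \<Longrightarrow> v \<in> carrier M \<Longrightarrow> v \<in> Z"
begin

lemma conv_module_space: "module K M"
  using lm by (simp add: left_conv_module_def)

lemma conv_act_linear: "f \<in> carrier H \<Longrightarrow> linear_map K M M (act M f)"
  and conv_act_linear_left: "v \<in> carrier M \<Longrightarrow> linear_map K H M (\<lambda>f. act M f v)"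
  and conv_act_conv: "f \<in> carrier H \<Longrightarrow> g \<in> carrier H \<Longrightarrow> v \<in> carrier M \<Longrightarrow>
    act M (conv K H I f g) v = act M f (act M g v)"
  using lm by (simp_all add: left_conv_module_def)

interpretation M: module K M by (rule conv_module_space)

interpretation T: module K "tensor K M H" by (rule tensor_module[OF conv_module_space H_mod])

text \<open>The slice of \<open>g\<^sub>1 \<cdot> w \<otimes> g\<^sub>2\<close> at \<open>f\<close>
  is \<open>(I(g\<^sub>2 S(f)) g\<^sub>1) \<cdot> w\<close>, which is
  \<open>(f * g) \<cdot> w\<close> by \<open>conv_eq\<close>.\<close>

lemma slice_orbit:
  assumes g: "g \<in> carrier H" and w: "w \<in> carrier M"
  defines "t \<equiv> sw (tensor K M H) g (\<lambda>a b. tens K M H (act M a w) b)"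
  shows "t \<in> carrier (tensor K M H)" "f \<in> carrier H \<Longrightarrow> slice M f t = act M f (act M g w)"
proof -
  note [simp] = H_mod conv_module_space T.module_axioms g w
  note al = conv_act_linear_left[OF w]
  have ac [simp]: "act M a w \<in> carrier M" if "a \<in> carrier H" for a
    by (rule linear_mapD(1)[OF al that])
  have cl: "tens K M H (act M a w) b \<in> carrier (tensor K M H)" if "a \<in> carrier H" "b \<in> carrier H" for a b
    using that by (intro tens_closed) simp_all
  then show "t \<in> carrier (tensor K M H)" by (simp add: t_def)
  assume f [simp]: "f \<in> carrier H"
  have "slice M f t = sw M g (\<lambda>a b. slice M f (tens K M H (act M a w) b))"
    unfolding t_def by (intro linear_map_sw_out linear_map_slice cl) simp_all
  also have "\<dots> = sw M g (\<lambda>a b. act M (I (b \<otimes>\<^bsub>H\<^esub> antipode H f) \<odot>\<^bsub>H\<^esub> a) w)"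
    by (intro sw_cong) (simp_all add: slice_tens linear_mapD(3)[OF al])
  also have "\<dots> = act M (sw H g (\<lambda>a b. I (b \<otimes>\<^bsub>H\<^esub> antipode H f) \<odot>\<^bsub>H\<^esub> a)) w"
    by (rule linear_map_sw_out[OF al, symmetric]) simp_all
  also have "\<dots> = act M f (act M g w)"
    by (simp add: conv_act_conv flip: conv_eq)
  finally show "slice M f t = act M f (act M g w)" .
qed

text \<open>The elements that possess such a tensor form a submodule, which contains the orbits by
  \<open>slice_orbit\<close>. The different ways to write an element as a sum of
  \<open>g \<cdot> w\<close> need no comparison, since slices determine the tensor.\<close>

lemma slice_exists:
  assumes v: "v \<in> carrier M"
  shows "\<exists>t. t \<in> carrier (tensor K M H) \<and> (\<forall>f \<in> carrier H. slice M f t = act M f v)"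
proof -
  let ?Z = "{v \<in> carrier M. \<exists>t. t \<in> carrier (tensor K M H) \<and> (\<forall>f \<in> carrier H. slice M f t = act M f v)}"
  note sl = linear_map_slice[OF conv_module_space]
  have "submodule ?Z K M"
  proof (rule M.submoduleI')
    show "\<zero>\<^bsub>M\<^esub> \<in> ?Z"
      using linear_map_zero[OF T.module_axioms conv_module_space sl]
        linear_map_zero[OF conv_module_space conv_module_space conv_act_linear]
      by (auto intro!: exI[of _ "\<zero>\<^bsub>tensor K M H\<^esub>"])
    show "x \<oplus>\<^bsub>M\<^esub> y \<in> ?Z" if xy: "x \<in> ?Z" "y \<in> ?Z" for x y
    proof -
      from xy obtain s t where
        "s \<in> carrier (tensor K M H)" "\<forall>f \<in> carrier H. slice M f s = act M f x"
        "t \<in> carrier (tensor K M H)" "\<forall>f \<in> carrier H. slice M f t = act M f y" by auto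
      then show ?thesis
        using xy linear_mapD(2)[OF sl] linear_mapD(2)[OF conv_act_linear]
        by (auto intro!: exI[of _ "s \<oplus>\<^bsub>tensor K M H\<^esub> t"])
    qed
    show "a \<odot>\<^bsub>M\<^esub> x \<in> ?Z" if ax: "a \<in> carrier K" "x \<in> ?Z" for a x
    proof -
      from ax obtain s where
        "s \<in> carrier (tensor K M H)" "\<forall>f \<in> carrier H. slice M f s = act M f x" by auto
      then show ?thesis
        using ax linear_mapD(3)[OF sl] linear_mapD(3)[OF conv_act_linear]
        by (auto intro!: exI[of _ "a \<odot>\<^bsub>tensor K M H\<^esub> s"])
    qed
  qed auto
  moreover have "act M g w \<in> ?Z" if "g \<in> carrier H" "w \<in> carrier M" for g w
    using slice_orbit[OF that] linear_mapD(1)[OF conv_act_linear[OF that(1)] that(2)] by blast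
  ultimately show ?thesis using generated v by blast
qed

lemma to_comodule_same_space: "same_space M (to_comodule M)"
  by (simp add: same_space_def to_comodule_def)

lemma to_comodule_coact:
  assumes "v \<in> carrier M"
  shows "coact (to_comodule M) v \<in> carrier (tensor K M H)"
    and "f \<in> carrier H \<Longrightarrow> slice M f (coact (to_comodule M) v) = act M f v"
  using someI_ex[OF slice_exists[OF assms]] by (simp_all add: to_comodule_def)

lemma corresponds_to_comodule: "corresponds (to_comodule M) M"
  using same_space_sym[OF to_comodule_same_space] to_comodule_coact(2)
  by (simp add: corresponds_def same_space_slice[OF to_comodule_same_space]
      same_space_simps[OF to_comodule_same_space])

text \<open>The coaction is chosen by \<open>SOME\<close> for each element separately; the two sides
  of each equation agree because they have the same slices.\<close>

lemma to_comodule_coact_linear: "linear_map K M (tensor K M H) (coact (to_comodule M))"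
proof (rule linear_mapI)
  note sl = linear_mapD[OF linear_map_slice[OF conv_module_space]] and al = linear_mapD[OF conv_act_linear]
  show "coact (to_comodule M) (x \<oplus>\<^bsub>M\<^esub> y) = coact (to_comodule M) x \<oplus>\<^bsub>tensor K M H\<^esub> coact (to_comodule M) y"
    if "x \<in> carrier M" "y \<in> carrier M" for x y
    by (rule slice_eqI[OF conv_module_space]) (use that in \<open>simp_all add: to_comodule_coact sl al\<close>)
  show "coact (to_comodule M) (a \<odot>\<^bsub>M\<^esub> x) = a \<odot>\<^bsub>tensor K M H\<^esub> coact (to_comodule M) x"
    if "a \<in> carrier K" "x \<in> carrier M" for a x
    by (rule slice_eqI[OF conv_module_space]) (use that in \<open>simp_all add: to_comodule_coact sl al\<close>)
qed (rule to_comodule_coact)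

lemma to_comodule_orbit:
  assumes "g \<in> carrier H" "w \<in> carrier M"
  shows "coact (to_comodule M) (act M g w) = sw (tensor K M H) g (\<lambda>a b. tens K M H (act M a w) b)"
  using assms linear_mapD(1)[OF conv_act_linear assms(2)]
  by (intro slice_eqI[OF conv_module_space]) (simp_all add: to_comodule_coact slice_orbit)

text \<open>Each axiom equates two linear maps, so it holds on a submodule and has to be checked
  only at \<open>g \<cdot> w\<close>, whose coaction is
  \<open>g\<^sub>1 \<cdot> w \<otimes> g\<^sub>2\<close>. There it reduces to the corresponding
  axiom of \<open>H\<close>.\<close>

lemma to_comodule_right_comodule: "right_comodule K H (to_comodule M)"
proof -
  define V where "V = to_comodule M"
  have ss: "same_space M V" unfolding V_def by (rule to_comodule_same_space)
  note ssi = same_space_simps[OF ss] same_space_tensor[OF ss] same_space_linear_map[OF ss]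
  have mV: "module K V" by (rule same_space_module[OF ss conv_module_space])
  have cl: "linear_map K V (tensor K V H) (coact V)"
    using to_comodule_coact_linear by (simp add: ssi V_def[symmetric])
  have orbit: "coact V (act M g w) = sw (tensor K V H) g (\<lambda>a b. tens K V H (act M a w) b)"
    if "g \<in> carrier H" "w \<in> carrier V" for g w
    using to_comodule_orbit that by (simp add: ssi V_def[symmetric])
  have al: "linear_map K H V (\<lambda>a. act M a w)" if "w \<in> carrier V" for w
    using conv_act_linear_left that by (simp add: ssi)
  have gen: "v \<in> Z" if "submodule Z K V" "\<And>f w. f \<in> carrier H \<Longrightarrow> w \<in> carrier V \<Longrightarrow> act M f w \<in> Z"
    "v \<in> carrier V" for v Z
    using generated[OF same_space_submodule[OF same_space_sym[OF ss] mV that(1)]] that(2,3) by (simp add: ssi)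
  let ?VHH = "tensor K V (tensor K H H)"
  have HH: "module K (tensor K H H)" and VHH: "module K ?VHH" and VH: "module K (tensor K V H)"
    by (intro tensor_module mV H_mod)+
  note [simp] = H_mod mV HH VHH VH
  have ac [simp]: "act M a w \<in> carrier V" if "a \<in> carrier H" "w \<in> carrier V" for a w
    by (rule linear_mapD(1)[OF al[OF that(2)] that(1)])
  note cc [simp] = linear_mapD(1)[OF cl]
  note lt = linear_map_comp[OF bilinearD(1)[OF tens_bilinear]] linear_map_comp[OF bilinearD(2)[OF tens_bilinear]]
  note intros = lt linear_map_id cl comult_linear tensor_module mV H_mod linear_map_tsum_body bilinearI
    linear_map_comp[OF linear_map_tsum cl]
  let ?l = "\<lambda>x y. tsum K V H ?VHH (\<lambda>u z. tens K V (tensor K H H) u (tens K H H z y)) (coact V x)"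
  let ?r = "\<lambda>x y. tens K V (tensor K H H) x (comult H y)"
  have bt: "bilinear K V H ?VHH (\<lambda>u z. tens K V (tensor K H H) u (tens K H H z b))" if "b \<in> carrier H" for b
    using that by (intro intros | simp add: tens_closed)+
  have bl: "bilinear K V H ?VHH ?l"
    by (intro intros | simp add: tens_closed)+
  have br: "bilinear K V H ?VHH ?r"
    by (intro intros comult_closed | simp add: comult_closed)+
  have coassoc: "tsum K V H ?VHH ?l (coact V v) = tsum K V H ?VHH ?r (coact V v)" if v: "v \<in> carrier V" for v
  proof -
    have "v \<in> {v \<in> carrier V. tsum K V H ?VHH ?l (coact V v) = tsum K V H ?VHH ?r (coact V v)}"
    proof (rule gen[OF linear_map_equalizer[OF mV VHH] _ v])
      fix g w assume gw [simp]: "g \<in> carrier H" "w \<in> carrier V"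
      have "tsum K V H ?VHH ?l (coact V (act M g w))
          = sw ?VHH g (\<lambda>a b. tsum K V H ?VHH ?l (tens K V H (act M a w) b))"
        unfolding orbit[OF gw] by (intro linear_map_sw_out linear_map_tsum bl) (simp_all add: tens_closed)
      also have "\<dots> = sw ?VHH g (\<lambda>a b. ?l (act M a w) b)"
        by (intro sw_cong tsum_tens bl) simp_all
      \<comment> \<open>The first component \<open>a \<cdot> w\<close> lies again in an orbit, so
        the formula for the coaction can be applied a second time.\<close>
      also have "\<dots> = sw ?VHH g (\<lambda>a b. sw ?VHH a (\<lambda>c d. tsum K V H ?VHH
          (\<lambda>u z. tens K V (tensor K H H) u (tens K H H z b)) (tens K V H (act M c w) d)))"
      proof (intro sw_cong)
        fix a b assume ab [simp]: "a \<in> carrier H" "b \<in> carrier H"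
        show "?l (act M a w) b = sw ?VHH a (\<lambda>c d. tsum K V H ?VHH
          (\<lambda>u z. tens K V (tensor K H H) u (tens K H H z b)) (tens K V H (act M c w) d))"
          unfolding orbit[OF ab(1) gw(2)]
          by (intro linear_map_sw_out linear_map_tsum bt) (simp_all add: tens_closed)
      qed simp
      also have "\<dots> = sw ?VHH g (\<lambda>a b. sw ?VHH a (\<lambda>c d. tens K V (tensor K H H) (act M c w) (tens K H H d b)))"
        by (intro sw_cong tsum_tens bt) (simp_all add: tens_closed)
      also have "\<dots> = sw ?VHH g (\<lambda>a b. sw ?VHH b (\<lambda>c d. tens K V (tensor K H H) (act M a w) (tens K H H c d)))"
        by (rule sw_coassoc) (intro trilinearI lt al linear_map_id | simp add: tens_closed)+
      also have "\<dots> = sw ?VHH g (\<lambda>a b. ?r (act M a w) b)"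
      proof (intro sw_cong)
        fix a b assume ab [simp]: "a \<in> carrier H" "b \<in> carrier H"
        have "?r (act M a w) b = tens K V (tensor K H H) (act M a w) (sw (tensor K H H) b (tens K H H))"
          by (simp add: sw_def tsum_tens_id comult_closed)
        also have "\<dots> = sw ?VHH b (\<lambda>c d. tens K V (tensor K H H) (act M a w) (tens K H H c d))"
          by (intro linear_map_sw_out bilinearD(2)[OF tens_bilinear]) (simp_all add: tens_closed)
        finally show "sw ?VHH b (\<lambda>c d. tens K V (tensor K H H) (act M a w) (tens K H H c d)) = ?r (act M a w) b"
          by simp
      qed simp
      also have "\<dots> = sw ?VHH g (\<lambda>a b. tsum K V H ?VHH ?r (tens K V H (act M a w) b))"
        by (intro sw_cong tsum_tens[symmetric] br) simp_all
      also have "\<dots> = tsum K V H ?VHH ?r (coact V (act M g w))"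
        unfolding orbit[OF gw]
        by (intro linear_map_sw_out[symmetric] linear_map_tsum br) (simp_all add: tens_closed)
      finally show "act M g w \<in> {v \<in> carrier V. tsum K V H ?VHH ?l (coact V v) = tsum K V H ?VHH ?r (coact V v)}"
        by simp
    qed (intro linear_map_comp[OF linear_map_tsum cl] bl br mV H_mod VHH)+
    then show ?thesis by simp
  qed
  let ?e = "\<lambda>u h. counit H h \<odot>\<^bsub>V\<^esub> u"
  have be: "bilinear K V H V ?e"
    by (intro linear_intros mV | simp add: module.smult_closed)+
  have counit: "tsum K V H V ?e (coact V v) = v" if v: "v \<in> carrier V" for v
  proof -
    have "v \<in> {v \<in> carrier V. tsum K V H V ?e (coact V v) = v}"
    proof (rule gen[OF linear_map_equalizer[OF mV mV] _ v])
      fix g w assume gw [simp]: "g \<in> carrier H" "w \<in> carrier V"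
      have "tsum K V H V ?e (coact V (act M g w)) = sw V g (\<lambda>a b. tsum K V H V ?e (tens K V H (act M a w) b))"
        unfolding orbit[OF gw] by (intro linear_map_sw_out linear_map_tsum be) (simp_all add: tens_closed)
      also have "\<dots> = sw V g (\<lambda>a b. ?e (act M a w) b)"
        by (intro sw_cong tsum_tens be) simp_all
      also have "\<dots> = act M g w"
        by (rule sw_counit_right[OF mV al]) simp_all
      finally show "act M g w \<in> {v \<in> carrier V. tsum K V H V ?e (coact V v) = v}" by simp
    qed (intro linear_map_comp[OF linear_map_tsum cl] linear_map_id be mV H_mod)+
    then show ?thesis by simp
  qed
  show ?thesis
    unfolding right_comodule_def V_def[symmetric]
    using coassoc counit
    by (simp add: cl tensor_assoc_map[OF mV H_mod cl comult_linear]
        tensor_map_comult[OF mV H_mod cl comult_linear] tsum_eq_lift[OF mV H_mod _ mV be, symmetric])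
qed

end

section \<open>The two categories and the equivalence\<close>

lemma conv_module_homs_id:
  assumes "left_conv_module K H I M"
  shows "(\<lambda>v \<in> carrier M. v) \<in> conv_module_homs K H M M"
proof -
  have "module K M" using assms by (simp add: left_conv_module_def)
  then interpret M: module K M .
  show ?thesis
    using assms by (auto simp: conv_module_homs_def left_conv_module_def linear_map_def Pi_iff)
qed

lemma conv_module_homs_compose:
  assumes "left_conv_module K H I M" "\<phi> \<in> conv_module_homs K H M N" "\<psi> \<in> conv_module_homs K H N P"
  shows "compose (carrier M) \<psi> \<phi> \<in> conv_module_homs K H M P"
proof -
  have "module K M" using assms(1) by (simp add: left_conv_module_def)
  then interpret M: module K M .
  show ?thesis
    using assms by (auto simp: conv_module_homs_def left_conv_module_def linear_map_def Pi_iff compose_def)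
qed

lemma is_category_conv_module:
  "is_category (cr_conv_module_cat K H I :: (('k, 'h, 'u) conv_module, 'u \<Rightarrow> 'u) cat)"
  unfolding is_category_def cr_conv_module_cat_def
  by (auto simp: completely_reducible_conv_module_def conv_module_homs_id conv_module_homs_compose)
    (auto simp: conv_module_homs_def linear_map_def compose_def fun_eq_iff extensional_def Pi_iff restrict_def)

lemma to_conv_module_cr:
  assumes "completely_reducible_comodule K H V"
  shows "completely_reducible_conv_module K H I (to_conv_module V)"
proof -
  have "right_comodule K H V" using assms by (simp add: completely_reducible_comodule_def)
  then show ?thesis using completely_reducible_iff[OF _ corresponds_to_conv_module] assms by blast
qed

lemma to_comodule_cr:
  assumes M: "completely_reducible_conv_module K H I M"
  shows "right_comodule K H (to_comodule M)" "corresponds (to_comodule M) M"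
    and "completely_reducible_comodule K H (to_comodule M)"
proof -
  have lm: "left_conv_module K H I M" using M by (simp add: completely_reducible_conv_module_def)
  show 1: "right_comodule K H (to_comodule M)" "corresponds (to_comodule M) M"
    using to_comodule_right_comodule[OF lm] corresponds_to_comodule[OF lm]
      completely_reducible_generated[OF M] by blast+
  show "completely_reducible_comodule K H (to_comodule M)"
    using completely_reducible_iff[OF 1] M by simp
qed

lemma comodule_homs_to_conv_module:
  assumes "completely_reducible_comodule K H V" "completely_reducible_comodule K H W"
  shows "comodule_homs K H V W = conv_module_homs K H (to_conv_module V) (to_conv_module W)"
  using assms
  by (intro comodule_homs_eq corresponds_to_conv_module) (simp_all add: completely_reducible_comodule_def)

lemma carrier_to_conv_module [simp]: "carrier (to_conv_module V) = carrier V"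
  by (simp add: to_conv_module_def)

lemma carrier_to_comodule [simp]: "carrier (to_comodule M) = carrier M"
  by (simp add: to_comodule_def)

lemma comodule_homs_to_comodule:
  assumes "completely_reducible_conv_module K H I M" "completely_reducible_conv_module K H I N"
  shows "comodule_homs K H (to_comodule M) (to_comodule N) = conv_module_homs K H M N"
  using to_comodule_cr assms by (intro comodule_homs_eq) auto

text \<open>Used with \<open>V\<close> and \<open>W\<close> in both orders, this makes the identity
  an isomorphism between a comodule and the one reconstructed from its module.\<close>

lemma identity_comodule_homs:
  assumes "right_comodule K H V" "corresponds V M" "right_comodule K H W" "corresponds W M"
  shows "(\<lambda>v \<in> carrier V. v) \<in> comodule_homs K H V W"
proof -
  have "comodule_homs K H V W = conv_module_homs K H M M"
    using assms by (rule comodule_homs_eq)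
  moreover have "carrier M = carrier V" using assms(2) by (simp add: corresponds_def same_space_def)
  ultimately show ?thesis
    using conv_module_homs_id[OF corresponds_left_conv_module[OF assms(1,2)]] by simp
qed

text \<open>\<open>M\<close> and \<open>N\<close> may differ as records, for instance in
  \<open>act\<close> outside the carriers; hence the composite functor is compared with the identity
  functor by an isomorphism and not by equality.\<close>

lemma identity_conv_module_homs:
  assumes "right_comodule K H V" "corresponds V M" "corresponds V N"
  shows "(\<lambda>v \<in> carrier M. v) \<in> conv_module_homs K H M N"
proof -
  have "conv_module_homs K H M N = comodule_homs K H V V"
    using comodule_homs_eq[OF assms(1,2,1,3)] by simp
  moreover have "carrier M = carrier V" using assms(2) by (simp add: corresponds_def same_space_def)
  ultimately show ?thesis using identity_comodule_homs[OF assms(1,2,1,2)] by simp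
qed

lemma comodule_homs_compose_id:
  assumes "\<phi> \<in> comodule_homs K H V W"
  shows "compose (carrier V) (\<lambda>v \<in> carrier W. v) \<phi> = \<phi>" "compose (carrier V) \<phi> (\<lambda>v \<in> carrier V. v) = \<phi>"
  using assms Id_compose[of \<phi> "carrier V" "carrier W"] compose_Id[of \<phi> "carrier V" "carrier W"]
  by (auto simp: comodule_homs_def linear_map_def)

lemma conv_module_homs_compose_id:
  assumes "\<phi> \<in> conv_module_homs K H V W"
  shows "compose (carrier V) (\<lambda>v \<in> carrier W. v) \<phi> = \<phi>" "compose (carrier V) \<phi> (\<lambda>v \<in> carrier V. v) = \<phi>"
  using assms Id_compose[of \<phi> "carrier V" "carrier W"] compose_Id[of \<phi> "carrier V" "carrier W"]
  by (auto simp: conv_module_homs_def linear_map_def)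

lemma compose_id_id: "compose A (\<lambda>v \<in> A. v) (\<lambda>v \<in> A. v) = (\<lambda>v \<in> A. v)"
  by (auto simp: compose_def)

text \<open>Closure under composition is inherited from modules through the equality of hom-sets,
  which avoids the functoriality of \<open>tensor_map\<close>.\<close>

lemma comodule_homs_compose:
  assumes "completely_reducible_comodule K H U" "completely_reducible_comodule K H V"
    "completely_reducible_comodule K H W"
    and "\<phi> \<in> comodule_homs K H U V" "\<psi> \<in> comodule_homs K H V W"
  shows "compose (carrier U) \<psi> \<phi> \<in> comodule_homs K H U W"
  using assms(4,5) conv_module_homs_compose[of "to_conv_module U"] to_conv_module_cr[OF assms(1)]
  by (simp add: comodule_homs_to_conv_module assms(1-3) completely_reducible_conv_module_def)

lemma is_category_comodule:
  "is_category (cr_comodule_cat K H :: (('k, 'h, 'u) comodule, 'u \<Rightarrow> 'u) cat)"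
proof -
  have "(\<lambda>v \<in> carrier V. v) \<in> comodule_homs K H V V" if "completely_reducible_comodule K H V"
    for V :: "('k, 'h, 'u) comodule"
  proof -
    have "right_comodule K H V" using that by (simp add: completely_reducible_comodule_def)
    then show ?thesis
      using identity_comodule_homs[OF _ corresponds_to_conv_module _ corresponds_to_conv_module] by blast
  qed
  moreover have "compose (carrier U) \<chi> (compose (carrier U) \<psi> \<phi>)
      = compose (carrier U) (compose (carrier V) \<chi> \<psi>) \<phi>"
    if "\<phi> \<in> comodule_homs K H U V" for U V :: "('k, 'h, 'u) comodule" and \<phi> \<psi> \<chi> :: "'u \<Rightarrow> 'u"
    using that by (intro compose_assoc) (auto simp: comodule_homs_def linear_map_def)
  ultimately show ?thesis
    unfolding is_category_def cr_comodule_cat_def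
    by (simp add: comodule_homs_compose_id comodule_homs_compose)
qed

lemma equivalent_categories_cr:
  "equivalent_categories (cr_comodule_cat K H :: (('k, 'h, 'u) comodule, 'u \<Rightarrow> 'u) cat)
    (cr_conv_module_cat K H I :: (('k, 'h, 'u) conv_module, 'u \<Rightarrow> 'u) cat)"
  (is "equivalent_categories ?C ?D")
proof -
  have com: "right_comodule K H V" if "completely_reducible_comodule K H V" for V :: "('k, 'h, 'u) comodule"
    using that by (simp add: completely_reducible_comodule_def)
  have F: "is_functor ?C ?D to_conv_module (\<lambda>_ _ f. f)"
    by (simp add: is_functor_def cr_comodule_cat_def cr_conv_module_cat_def to_conv_module_cr
        comodule_homs_to_conv_module)
  have G: "is_functor ?D ?C to_comodule (\<lambda>_ _ f. f)"
    by (simp add: is_functor_def cr_comodule_cat_def cr_conv_module_cat_def to_comodule_cr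
        comodule_homs_to_comodule)
  have "natural_iso ?C ?C (\<lambda>a. a) (\<lambda>a b f. f) (\<lambda>a. to_comodule (to_conv_module a)) (\<lambda>a b f. f)
    (\<lambda>V. \<lambda>v \<in> carrier V. v)"
  proof -
    have "(\<lambda>v \<in> carrier V. v) \<in> comodule_homs K H V (to_comodule (to_conv_module V))"
      "(\<lambda>v \<in> carrier V. v) \<in> comodule_homs K H (to_comodule (to_conv_module V)) V"
      if V: "completely_reducible_comodule K H V" for V :: "('k, 'h, 'u) comodule"
      using identity_comodule_homs[OF com[OF V] corresponds_to_conv_module to_comodule_cr(1,2)[OF to_conv_module_cr[OF V]]]
        identity_comodule_homs[OF to_comodule_cr(1,2)[OF to_conv_module_cr[OF V]] com[OF V] corresponds_to_conv_module]
      by simp_all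
    then show ?thesis
      by (auto simp: natural_iso_def is_iso_def cr_comodule_cat_def compose_id_id comodule_homs_compose_id
          intro!: bexI[of _ "\<lambda>v \<in> carrier _. v"])
  qed
  moreover have "natural_iso ?D ?D (\<lambda>a. to_conv_module (to_comodule a)) (\<lambda>a b f. f) (\<lambda>a. a) (\<lambda>a b f. f)
    (\<lambda>M. \<lambda>v \<in> carrier M. v)"
  proof -
    have "(\<lambda>v \<in> carrier M. v) \<in> conv_module_homs K H (to_conv_module (to_comodule M)) M"
      "(\<lambda>v \<in> carrier M. v) \<in> conv_module_homs K H M (to_conv_module (to_comodule M))"
      if M: "completely_reducible_conv_module K H I M" for M :: "('k, 'h, 'u) conv_module"
      using identity_conv_module_homs[OF to_comodule_cr(1)[OF M] corresponds_to_conv_module to_comodule_cr(2)[OF M]]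
        identity_conv_module_homs[OF to_comodule_cr(1,2)[OF M] corresponds_to_conv_module]
      by simp_all
    then show ?thesis
      by (auto simp: natural_iso_def is_iso_def cr_conv_module_cat_def compose_id_id conv_module_homs_compose_id
          intro!: bexI[of _ "\<lambda>v \<in> carrier _. v"])
  qed
  ultimately show ?thesis
    unfolding equivalent_categories_def
    using is_category_comodule is_category_conv_module F G by blast
qed

end

theorem theorem2p4:
  fixes K :: "('k, 'r) ring_scheme"
    and H :: "('k, 'h, 'm) hopf_scheme"
    and I :: "'h \<Rightarrow> 'k"
  assumes "algebraically_closed K"
    and "\<And>n::nat. n > 0 \<Longrightarrow> [n] \<cdot>\<^bsub>K\<^esub> \<one>\<^bsub>K\<^esub> \<noteq> \<zero>\<^bsub>K\<^esub>"
    and "hopf_algebra K H"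
    and "left_integral K H I"
  shows "equivalent_categories
    (cr_comodule_cat K H :: (('k, 'h, 'u) comodule, 'u \<Rightarrow> 'u) cat)
    (cr_conv_module_cat K H I :: (('k, 'h, 'u) conv_module, 'u \<Rightarrow> 'u) cat)"
proof -
  interpret hopf_integral K H I
    using assms(3,4) by (simp add: hopf_integral_def hopf_integral_axioms_def)
  show ?thesis by (rule equivalent_categories_cr)
qed

end
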